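(* Let $K$ be an infinite field and $S=K[x_1,\dots,x_n]$ with the standard grading. Let $d\in\mathbb{N}$, $0\leq k\leq\binom{n+d-1}{d}$, and let $I\subset S$ be a graded ideal with $d$-linear resolution and $k$ generators (i.e. $\beta_{0,d}(I)=k$). Then $$\beta_{i,i+j}(I)\leq\beta_{i,i+j}(J(d,k))\quad\text{for all } i,j\in\mathbb{N}.$$
   Context: $\mathbb{N}=\{0,1,2,\dots\}$. $\beta_{i,i+j}(I)=\dim_K\operatorname{Tor}^S_i(I,K)_{i+j}$. A graded ideal $I$ has a $d$-linear resolution if $\beta_{i,i+j}(I)=0$ for all $i$ and all $j\neq d$. The order $>_{lex}$ on monomials: $x^a>_{lex}x^b$ if either $|a|>|b|$, or $|a|=|b|$ and there is an $r$ with $a_r>b_r$ and $a_s=b_s$ for $s<r$ (here $|a|=a_1+\dots+a_n$). For a monomial $x^a$ with $|a|=d$, the lex-segment is $L(x^a)=\{x^b: |b|=d,\ x^b\geq_{lex}x^a\}$. $J(d,k)$ is the ideal of $S$ generated by the lex-segment $L(x^a)$ of degree $d$ with $|L(x^a)|=k$, i.e. by the $k$ largest monomials of degree $d$ with respect to $>_{lex}$; for $k=0$ it is the zero ideal. *)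

theory Defs
  imports Complex_Main "HOL-Library.Poly_Mapping" "HOL-Library.Function_Algebras"
begin

section \<open>The polynomial ring and its graded ideals\<close>

text \<open>
  A monomial is its exponent vector, with index \<open>l\<close> standing for the variable \<open>x\<^sub>l\<^sub>+\<^sub>1\<close>.
  The ring \<open>K[x\<^sub>1, \<dots>, x\<^sub>n]\<close> is the subring \<open>polys n\<close> of the polynomials that involve only the
  variables with index below \<open>n\<close>.
\<close>

type_synonym monomial = "nat \<Rightarrow>\<^sub>0 nat"
type_synonym 'k mpoly = "monomial \<Rightarrow>\<^sub>0 'k"

definition monomials :: "nat \<Rightarrow> monomial set" where
  "monomials n = {a. Poly_Mapping.keys a \<subseteq> {..<n}}"

definition mdeg :: "monomial \<Rightarrow> nat" where
  "mdeg a = (\<Sum>l\<in>Poly_Mapping.keys a. Poly_Mapping.lookup a l)"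

definition polys :: "nat \<Rightarrow> 'k::field mpoly set" where
  "polys n = {p. Poly_Mapping.keys p \<subseteq> monomials n}"

definition is_ideal :: "nat \<Rightarrow> 'k::field mpoly set \<Rightarrow> bool" where
  "is_ideal n I \<longleftrightarrow> I \<subseteq> polys n \<and> 0 \<in> I \<and> (\<forall>p\<in>I. \<forall>q\<in>I. p + q \<in> I) \<and>
     (\<forall>s\<in>polys n. \<forall>p\<in>I. s * p \<in> I)"

definition ideal_of :: "nat \<Rightarrow> 'k::field mpoly set \<Rightarrow> 'k mpoly set" where
  "ideal_of n G = is_ideal n hull G"

definition homogeneous :: "nat \<Rightarrow> 'k::field mpoly \<Rightarrow> bool" where
  "homogeneous j p \<longleftrightarrow> (\<forall>a\<in>Poly_Mapping.keys p. mdeg a = j)"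

definition hom_component :: "nat \<Rightarrow> 'k::field mpoly \<Rightarrow> 'k mpoly" where
  "hom_component j p = (\<Sum>a\<in>{a\<in>Poly_Mapping.keys p. mdeg a = j}. Poly_Mapping.single a (Poly_Mapping.lookup p a))"

definition graded_ideal :: "nat \<Rightarrow> 'k::field mpoly set \<Rightarrow> bool" where
  "graded_ideal n I \<longleftrightarrow> is_ideal n I \<and> (\<forall>p\<in>I. \<forall>j. hom_component j p \<in> I)"

section \<open>Graded free resolutions\<close>

definition mat_vec :: "nat \<Rightarrow> nat \<Rightarrow> (nat \<Rightarrow> nat \<Rightarrow> 'a::comm_ring_1) \<Rightarrow> (nat \<Rightarrow> 'a) \<Rightarrow> nat \<Rightarrow> 'a" where
  "mat_vec r s M v = (\<lambda>l. if l < r then \<Sum>m<s. M l m * v m else 0)"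

definition free_module :: "nat \<Rightarrow> nat \<Rightarrow> (nat \<Rightarrow> 'k::field mpoly) set" where
  "free_module n r = {v. (\<forall>l<r. v l \<in> polys n) \<and> (\<forall>l\<ge>r. v l = 0)}"

text \<open>
  Data of an augmented complex \<open>\<dots> \<rightarrow> F\<^sub>1 \<rightarrow> F\<^sub>0 \<rightarrow> S\<close> of graded free modules of finite rank:
  \<open>F\<^sub>i\<close> is the direct sum of the \<open>S(-e)\<close> for \<open>e\<close> in the list \<open>shifts F i\<close>, \<open>diff F i\<close> is the matrix
  of \<open>F\<^sub>i\<^sub>+\<^sub>1 \<rightarrow> F\<^sub>i\<close> (row index first), and \<open>aug F m\<close> is the image in \<open>S\<close> of the \<open>m\<close>-th basis
  element of \<open>F\<^sub>0\<close>.
\<close>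

record (overloaded) 'k free_complex =
  shifts :: "nat \<Rightarrow> nat list"
  aug :: "nat \<Rightarrow> 'k mpoly"
  diff :: "nat \<Rightarrow> nat \<Rightarrow> nat \<Rightarrow> 'k mpoly"

definition frank :: "'k::field free_complex \<Rightarrow> nat \<Rightarrow> nat" where
  "frank F i = length (shifts F i)"

definition aug_map :: "'k::field free_complex \<Rightarrow> (nat \<Rightarrow> 'k mpoly) \<Rightarrow> 'k mpoly" where
  "aug_map F v = (\<Sum>m<frank F 0. aug F m * v m)"

definition diff_map :: "'k::field free_complex \<Rightarrow> nat \<Rightarrow> (nat \<Rightarrow> 'k mpoly) \<Rightarrow> nat \<Rightarrow> 'k mpoly" where
  "diff_map F i = mat_vec (frank F i) (frank F (Suc i)) (diff F i)"

text \<open>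
  The first two conditions say that the maps are homogeneous of degree 0, the others that
  \<open>\<dots> \<rightarrow> F\<^sub>1 \<rightarrow> F\<^sub>0 \<rightarrow> I \<rightarrow> 0\<close> is exact. Shifts in \<open>\<nat>\<close> suffice because \<open>I\<close> lives in nonnegative degrees.
\<close>

definition graded_free_resolution :: "nat \<Rightarrow> 'k::field mpoly set \<Rightarrow> 'k free_complex \<Rightarrow> bool" where
  "graded_free_resolution n I F \<longleftrightarrow>
     (\<forall>m<frank F 0. aug F m \<in> polys n \<and> homogeneous (shifts F 0 ! m) (aug F m)) \<and>
     (\<forall>i. \<forall>l<frank F i. \<forall>m<frank F (Suc i). diff F i l m \<in> polys n \<and>
        (\<forall>a\<in>Poly_Mapping.keys (diff F i l m). shifts F i ! l + mdeg a = shifts F (Suc i) ! m)) \<and>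
     aug_map F ` free_module n (frank F 0) = I \<and>
     {v \<in> free_module n (frank F 0). aug_map F v = 0} =
       diff_map F 0 ` free_module n (frank F 1) \<and>
     (\<forall>i. {v \<in> free_module n (frank F (Suc i)). diff_map F i v = (\<lambda>_. 0)} =
       diff_map F (Suc i) ` free_module n (frank F (Suc (Suc i))))"

section \<open>Graded Betti numbers\<close>

global_interpretation kvec: vector_space "\<lambda>(c::'k::field) (v::nat \<Rightarrow> 'k) l. c * v l"
  by unfold_locales (simp_all add: fun_eq_iff algebra_simps)

text \<open>
  Here \<open>K = S/(x\<^sub>1, \<dots>, x\<^sub>n)\<close>, so \<open>F\<^sub>i \<otimes>\<^sub>S K\<close> is the sum of the \<open>K(-e)\<close> for \<open>e\<close> in
  \<open>shifts F i\<close>, and the matrix of \<open>F\<^sub>i\<^sub>+\<^sub>1 \<otimes>\<^sub>S K \<rightarrow> F\<^sub>i \<otimes>\<^sub>S K\<close> consists of the constant coefficients of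
  the matrix of \<open>F\<^sub>i\<^sub>+\<^sub>1 \<rightarrow> F\<^sub>i\<close>. The argument \<open>q\<close> selects the graded piece of degree \<open>q\<close>.
  The augmentation is not part of the complex whose homology is taken.
\<close>

definition tensor_K :: "'k::field free_complex \<Rightarrow> nat \<Rightarrow> nat \<Rightarrow> (nat \<Rightarrow> 'k) set" where
  "tensor_K F i q = {c. \<forall>l. c l \<noteq> 0 \<longrightarrow> l < frank F i \<and> shifts F i ! l = q}"

definition tensor_K_map :: "'k::field free_complex \<Rightarrow> nat \<Rightarrow> (nat \<Rightarrow> 'k) \<Rightarrow> nat \<Rightarrow> 'k" where
  "tensor_K_map F i = mat_vec (frank F i) (frank F (Suc i)) (\<lambda>l m. Poly_Mapping.lookup (diff F i l m) 0)"

definition tor_cycles :: "'k::field free_complex \<Rightarrow> nat \<Rightarrow> nat \<Rightarrow> (nat \<Rightarrow> 'k) set" where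
  "tor_cycles F i q = {c \<in> tensor_K F i q.
     case i of 0 \<Rightarrow> True | Suc i' \<Rightarrow> tensor_K_map F i' c = (\<lambda>_. 0)}"

definition tor_boundaries :: "'k::field free_complex \<Rightarrow> nat \<Rightarrow> nat \<Rightarrow> (nat \<Rightarrow> 'k) set" where
  "tor_boundaries F i q = tensor_K_map F i ` tensor_K F (Suc i) q"

definition tor_dim :: "'k::field free_complex \<Rightarrow> nat \<Rightarrow> nat \<Rightarrow> nat" where
  "tor_dim F i q = kvec.dim (tor_cycles F i q) - kvec.dim (tor_boundaries F i q)"

text \<open>
  \<open>betti n I i q\<close> is the dimension of the degree-\<open>q\<close> part of \<open>Tor\<^sub>i(I, K)\<close>. A graded ideal has a
  graded free resolution of finite rank because \<open>S\<close> is Noetherian, and \<open>tor_dim\<close> does not depend on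
  the resolution, so the choice is immaterial.
\<close>

definition betti :: "nat \<Rightarrow> 'k::field mpoly set \<Rightarrow> nat \<Rightarrow> nat \<Rightarrow> nat" where
  "betti n I i q = tor_dim (SOME F. graded_free_resolution n I F) i q"

definition linear_resolution :: "nat \<Rightarrow> nat \<Rightarrow> 'k::field mpoly set \<Rightarrow> bool" where
  "linear_resolution n d I \<longleftrightarrow> (\<forall>i j. j \<noteq> d \<longrightarrow> betti n I i (i + j) = 0)"

section \<open>Lex-segments\<close>

definition lex_greater :: "monomial \<Rightarrow> monomial \<Rightarrow> bool" where
  "lex_greater a b \<longleftrightarrow> mdeg a > mdeg b \<or>
     (mdeg a = mdeg b \<and> (\<exists>r. Poly_Mapping.lookup a r > Poly_Mapping.lookup b r \<and> (\<forall>s<r. Poly_Mapping.lookup a s = Poly_Mapping.lookup b s)))"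

definition lex_segment :: "nat \<Rightarrow> monomial \<Rightarrow> monomial set" where
  "lex_segment n a = {b \<in> monomials n. mdeg b = mdeg a \<and> (b = a \<or> lex_greater b a)}"

text \<open>
  For \<open>1 \<le> k \<le> (n + d - 1) choose d\<close> there is exactly one monomial of degree \<open>d\<close> whose lex-segment
  has \<open>k\<close> elements; \<open>lex_ideal\<close> is meaningful only for such \<open>k\<close> and for \<open>k = 0\<close>.
\<close>

definition lex_ideal :: "nat \<Rightarrow> nat \<Rightarrow> nat \<Rightarrow> 'k::field mpoly set" where
  "lex_ideal n d k = (if k = 0 then {0} else
     ideal_of n ((\<lambda>b. Poly_Mapping.single b 1) `
       lex_segment n (THE a. a \<in> monomials n \<and> mdeg a = d \<and> card (lex_segment n a) = k)))"

end

theory Submission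
  imports Defs "HOL-Computational_Algebra.Polynomial" "HOL-Library.FuncSet" "HOL-Library.Product_Lexorder"
begin

text \<open>
  If \<open>I\<close> vanishes in degrees below \<open>d\<close>, the double complex that the Koszul complex of the variables forms
  with a free resolution of \<open>I\<close> identifies \<open>Tor\<^sub>i(I, K)\<^sub>i\<^sub>+\<^sub>d\<close> with the space \<open>Z\<^sub>i(V)\<close> of Koszul cycles
  with coefficients in \<open>V = I\<^sub>d\<close>. So it suffices to compare \<open>dim Z\<^sub>i(V)\<close> with \<open>dim Z\<^sub>i\<close> of the span of the first
  \<open>dim V\<close> monomials, for an arbitrary space \<open>V\<close> of forms of degree \<open>d\<close>. This goes by induction on the
  number of variables. Restricting to a hyperplane \<open>x\<^sub>n = \<Sum>\<^sub>j c\<^sub>j x\<^sub>j\<close>, with image \<open>W\<close> of \<open>V\<close>, gives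
  \<open>dim Z\<^sub>i(V) \<le> (n choose i) (dim V - dim W) + dim Z\<^sub>i(W)\<close>, and for a lex-segment and the hyperplane \<open>x\<^sub>n = 0\<close>
  this is an equality. By Green's restriction theorem (where \<open>K\<close> has to be infinite) a suitable
  hyperplane makes \<open>dim W\<close> at least as large as for the lex-segment.
\<close>

section \<open>Dimensions of subspaces\<close>

text \<open>In degree \<open>i + d\<close> the Koszul boundaries have coefficients in the piece of
  degree \<open>d - 1\<close>, which is zero; so the homology consists of cycles, and only the
  vector space I_d matters. The induction needs a class of objects closed under restriction to an
  arbitrary hyperplane, and the spaces of forms of degree \<open>d\<close> are such a class. The
  obstacle is that the hyperplane found may leave a \<open>W\<close> that is strictly larger than
  the restricted lex-segment, so that the bound for \<open>V\<close> and the formula for the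
  lex-segment do not match. They are bridged by the lex-segment of size \<open>dim W\<close>: each
  monomial that it has in excess costs at most \<open>n choose i\<close> cycles, which is exactly
  what a unit of \<open>dim W\<close> saves in the term with \<open>dim V - dim W\<close>. No
  construction divides by integers, so the characteristic is arbitrary.\<close>

definition fin_dim :: "('a::field \<Rightarrow> 'b::ab_group_add \<Rightarrow> 'b) \<Rightarrow> 'b set \<Rightarrow> bool" where
  "fin_dim s X \<longleftrightarrow> (\<exists>B. finite B \<and> X \<subseteq> module.span s B)"

context vector_space begin

lemma fin_dim_subset: "fin_dim scale Y \<Longrightarrow> X \<subseteq> Y \<Longrightarrow> fin_dim scale X"
  unfolding fin_dim_def by blast

lemma fin_dim_span: "finite B \<Longrightarrow> fin_dim scale (span B)"
  unfolding fin_dim_def by blast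

lemma independent_finite_fin_dim:
  assumes "fin_dim scale X" "B \<subseteq> X" "independent B"
  shows "finite B"
proof -
  obtain C where "finite C" "X \<subseteq> span C" using assms(1) unfolding fin_dim_def by blast
  then show ?thesis using independent_span_bound[of C B] assms by blast
qed

lemma card_independent_le_dim:
  assumes "fin_dim scale X" "B \<subseteq> X" "independent B"
  shows "card B \<le> dim X"
proof -
  obtain C where C: "C \<subseteq> X" "independent C" "X \<subseteq> span C" "card C = dim X"
    using basis_exists by blast
  have "finite C" using independent_finite_fin_dim[OF assms(1) C(1,2)] .
  then show ?thesis using independent_span_bound[of C B] assms C by auto
qed

text \<open>As a cardinality, \<open>dim\<close> is 0 for an infinite-dimensional space, so
  monotonicity requires the larger space to be finite-dimensional. The polynomials form an
  infinite-dimensional space, hence finiteness is tracked subspace by subspace.\<close>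

lemma dim_mono_fin_dim:
  assumes "fin_dim scale Y" "X \<subseteq> Y"
  shows "dim X \<le> dim Y"
proof -
  obtain C where C: "C \<subseteq> X" "independent C" "X \<subseteq> span C" "card C = dim X"
    using basis_exists by blast
  then show ?thesis using card_independent_le_dim[OF assms(1), of C] assms(2) by auto
qed

lemma fin_dim_sums:
  assumes "fin_dim scale X" "fin_dim scale Y"
  shows "fin_dim scale {x + y |x y. x \<in> X \<and> y \<in> Y}"
proof -
  obtain A B where A: "finite A" "X \<subseteq> span A" and B: "finite B" "Y \<subseteq> span B"
    using assms unfolding fin_dim_def by blast
  have "{x + y |x y. x \<in> X \<and> y \<in> Y} \<subseteq> span (A \<union> B)"
    unfolding span_Un using A B by blast
  then show ?thesis unfolding fin_dim_def using A B by blast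
qed

lemma dim_eq_subspace_eq:
  assumes "fin_dim scale Y" "subspace X" "X \<subseteq> Y" "dim Y \<le> dim X"
  shows "X = Y"
proof -
  obtain C where C: "C \<subseteq> X" "independent C" "X \<subseteq> span C" "card C = dim X"
    using basis_exists by blast
  obtain D where D: "C \<subseteq> D" "D \<subseteq> Y" "independent D" "Y \<subseteq> span D"
    using maximal_independent_subset_extend[of C Y] C assms(3) by blast
  have "finite D" using independent_finite_fin_dim assms(1) D by blast
  moreover have "card D \<le> card C" using card_independent_le_dim[OF assms(1) D(2,3)] assms(4) C(4) by simp
  ultimately have "C = D" using D(1) card_seteq by blast
  then show ?thesis using D C assms(2,3) span_minimal by blast
qed

lemma dim_span_singleton: "x \<noteq> 0 \<Longrightarrow> dim (span {x}) = 1"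
  using dim_span_eq_card_independent[of "{x}"] by simp

end

section \<open>Rank-nullity on subspaces and dimensions of quotients\<close>

lemma fin_dim_linear_image:
  assumes "Vector_Spaces.linear s1 s2 f" "fin_dim s1 X"
  shows "fin_dim s2 (f ` X)"
proof -
  interpret Vector_Spaces.linear s1 s2 f by fact
  obtain B where "finite B" "X \<subseteq> vs1.span B" using assms(2) unfolding fin_dim_def by blast
  then have "finite (f ` B)" "f ` X \<subseteq> vs2.span (f ` B)" using span_image by auto
  then show ?thesis unfolding fin_dim_def by blast
qed

text \<open>A basis of the kernel inside \<open>X\<close> extends to a basis of \<open>X\<close>,
  and the added vectors \<open>C\<close> map injectively to a basis of the image.\<close>

lemma rank_nullity:
  assumes "Vector_Spaces.linear s1 s2 f" "module.subspace s1 X" "fin_dim s1 X"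
  shows "vector_space.dim s1 X = vector_space.dim s1 {x \<in> X. f x = 0} + vector_space.dim s2 (f ` X)"
proof -
  interpret Vector_Spaces.linear s1 s2 f by fact
  interpret vector_space_pair s1 s2 by unfold_locales
  let ?N = "{x \<in> X. f x = 0}"
  obtain B0 where B0: "B0 \<subseteq> ?N" "vs1.independent B0" "?N \<subseteq> vs1.span B0" "card B0 = vs1.dim ?N"
    using vs1.basis_exists by blast
  obtain B where B: "B0 \<subseteq> B" "B \<subseteq> X" "vs1.independent B" "X \<subseteq> vs1.span B"
    using vs1.maximal_independent_subset_extend[of B0 X] B0 by auto
  define C where "C = B - B0"
  have fB: "finite B" using vs1.independent_finite_fin_dim assms(3) B by blast
  have indC: "vs1.independent C" using B(3) C_def vs1.independent_mono by blast
  have XB: "vs1.span B = X" using B assms(2) vs1.span_minimal by blast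
  have NB: "vs1.span B0 = ?N"
  proof -
    have "vs1.subspace ?N" using assms(2)
      by (auto simp: vs1.subspace_def add scale)
    then show ?thesis using B0 vs1.span_minimal by blast
  qed
  \<comment> \<open>A difference of two points with the same image lies in the span of
    \<open>C\<close> and in that of \<open>B0\<close>; its representation over \<open>B\<close> is
    then supported in two disjoint sets.\<close>
  have inj: "inj_on f (vs1.span C)"
  proof (rule inj_onI)
    fix x y assume xy: "x \<in> vs1.span C" "y \<in> vs1.span C" "f x = f y"
    define u where "u = x - y"
    have uC: "u \<in> vs1.span C" using xy vs1.span_diff u_def by blast
    then have "u \<in> X" using XB C_def vs1.span_mono[of C B] by blast
    then have u0: "u \<in> vs1.span B0" using NB xy diff u_def by auto
    have "vs1.representation B u = vs1.representation B0 u" "vs1.representation B u = vs1.representation C u"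
      using vs1.representation_extend[OF B(3) u0 B(1)] vs1.representation_extend[OF B(3) uC] C_def by blast+
    then have "vs1.representation B u b = 0" for b
      using vs1.representation_ne_zero[of B0 u b] vs1.representation_ne_zero[of C u b]
      unfolding C_def by (metis DiffD2)
    moreover have "u \<in> vs1.span B" using u0 B(1) vs1.span_mono by blast
    ultimately have "u = 0" using vs1.sum_nonzero_representation_eq[OF B(3), of u] by simp
    then show "x = y" unfolding u_def by simp
  qed
  have ifC: "vs2.independent (f ` C)"
    using linear_independent_injective_image[OF assms(1) indC inj] .
  have "f ` X = vs2.span (f ` C)"
  proof -
    have "f ` X = vs2.span (f ` B)" using XB span_image[of B] by simp
    also have "f ` B = f ` C \<union> f ` B0" unfolding C_def using B(1) by (simp add: image_Un[symmetric] Un_absorb2)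
    also have "vs2.span (f ` C \<union> f ` B0) = vs2.span (f ` C)"
    proof
      show "vs2.span (f ` C \<union> f ` B0) \<subseteq> vs2.span (f ` C)"
      proof (rule vs2.span_minimal)
        show "f ` C \<union> f ` B0 \<subseteq> vs2.span (f ` C)"
        proof
          fix y assume "y \<in> f ` C \<union> f ` B0"
          moreover have "f b = 0" if "b \<in> B0" for b using that B0(1) by blast
          ultimately have "y \<in> f ` C \<or> y = 0" by blast
          then show "y \<in> vs2.span (f ` C)" using vs2.span_base vs2.span_zero by blast
        qed
      qed (rule vs2.subspace_span)
    qed (simp add: vs2.span_mono)
    finally show ?thesis .
  qed
  then have "vs2.dim (f ` X) = card (f ` C)" using vs2.dim_span_eq_card_independent[OF ifC] by simp
  also have "\<dots> = card C" using card_image[OF inj_on_subset[OF inj vs1.span_superset]] .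
  finally have 1: "vs2.dim (f ` X) = card C" .
  have "vs1.dim X = card B" using XB vs1.dim_span_eq_card_independent[OF B(3)] by simp
  also have "\<dots> = card B0 + card C" unfolding C_def using fB B(1)
    using card_Diff_subset[OF finite_subset[OF B(1) fB] B(1)] card_mono[OF fB B(1)] by linarith
  finally show ?thesis using 1 B0(4) by simp
qed

lemma dim_inj_image:
  assumes "Vector_Spaces.linear s1 s2 f" "module.subspace s1 X" "fin_dim s1 X"
    "\<And>x. x \<in> X \<Longrightarrow> f x = 0 \<Longrightarrow> x = 0"
  shows "vector_space.dim s2 (f ` X) = vector_space.dim s1 X"
proof -
  interpret Vector_Spaces.linear s1 s2 f by fact
  have "{x \<in> X. f x = 0} = {0}" using assms(4) vs1.subspace_0[OF assms(2)] by auto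
  moreover have "vs1.dim {0} = 0"
using vs1.dim_span_eq_card_independent[OF vs1.independent_empty] by (simp add: vs1.span_empty)
  ultimately show ?thesis using rank_nullity[OF assms(1-3)] by simp
qed

lemma dim_le_of_inj:
  assumes "Vector_Spaces.linear s1 s2 f" "module.subspace s1 X" "fin_dim s1 X"
    "\<And>x. x \<in> X \<Longrightarrow> f x = 0 \<Longrightarrow> x = 0" "f ` X \<subseteq> Y" "fin_dim s2 Y"
  shows "vector_space.dim s1 X \<le> vector_space.dim s2 Y"
proof -
  interpret Vector_Spaces.linear s1 s2 f by fact
  show ?thesis using dim_inj_image[OF assms(1-4)] vs2.dim_mono_fin_dim[OF assms(6,5)] by simp
qed

context vector_space begin

text \<open>This replaces the quotient map modulo \<open>Y\<close>: the identity minus a projection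
  onto \<open>Y\<close> has kernel \<open>Y\<close> and stays in the same type.\<close>

lemma exists_linear_with_kernel:
  assumes "subspace Y"
  shows "\<exists>q. Vector_Spaces.linear scale scale q \<and> (\<forall>x. q x = 0 \<longleftrightarrow> x \<in> Y)"
proof -
  interpret vector_space_pair scale scale by unfold_locales
  have "Vector_Spaces.linear scale scale (\<lambda>x. x)" using linear_id by (simp add: id_def)
  from linear_exists_left_inverse_on[OF this assms]
  obtain g where g: "g ` UNIV \<subseteq> Y" "Vector_Spaces.linear scale scale g" "\<forall>v\<in>Y. g v = v"
    by (auto simp: inj_on_def)
  have "Vector_Spaces.linear scale scale (\<lambda>x. x - g x)"
    using linear_compose_sub[OF \<open>Vector_Spaces.linear scale scale (\<lambda>x. x)\<close> g(2)] .
  moreover have "x - g x = 0 \<longleftrightarrow> x \<in> Y" for x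
    using g by (metis eq_iff_diff_eq_0 rangeI subsetD)
  ultimately show ?thesis by blast
qed

text \<open>A map with kernel \<open>Y\<close> has the same image on \<open>X\<close> and on the
  sum, its kernels there being the intersection and \<open>Y\<close>.\<close>

lemma dim_sums_plus_dim_Int:
  assumes "subspace X" "subspace Y" "fin_dim scale X" "fin_dim scale Y"
  shows "dim {x + y |x y. x \<in> X \<and> y \<in> Y} + dim (X \<inter> Y) = dim X + dim Y"
proof -
  let ?S = "{x + y |x y. x \<in> X \<and> y \<in> Y}"
  obtain q where q: "Vector_Spaces.linear scale scale q" "\<And>x. q x = 0 \<longleftrightarrow> x \<in> Y"
    using exists_linear_with_kernel[OF assms(2)] by blast
  interpret q: Vector_Spaces.linear scale scale q by fact
  have YS: "Y \<subseteq> ?S" using subspace_0[OF assms(1)] by force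
  have XS: "X \<subseteq> ?S" using subspace_0[OF assms(2)] by force
  have "dim X = dim {x \<in> X. q x = 0} + dim (q ` X)" using rank_nullity[OF q(1)] assms by blast
  moreover have "{x \<in> X. q x = 0} = X \<inter> Y" using q(2) by auto
  moreover have "dim ?S = dim {x \<in> ?S. q x = 0} + dim (q ` ?S)"
    using rank_nullity[OF q(1) subspace_sums[OF assms(1,2)] fin_dim_sums[OF assms(3,4)]] .
  moreover have "{x \<in> ?S. q x = 0} = Y" using q(2) YS by auto
  moreover have "q ` ?S = q ` X"
  proof
    have "q (x + y) = q x" if "y \<in> Y" for x y using q.add q(2) that by simp
    then show "q ` ?S \<subseteq> q ` X" by auto
  qed (use XS in blast)
  ultimately show ?thesis by simp
qed

end

text \<open>\<open>f\<close> induces an isomorphism from \<open>X\<close> modulo \<open>Y\<close> to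
  \<open>X'\<close> modulo \<open>Y'\<close>; the last two assumptions are its surjectivity and its
  injectivity. Quotients appear as differences of dimensions because Tor is measured in this
  way.\<close>

lemma quotient_dim_eq:
  assumes lin: "Vector_Spaces.linear s1 s2 f"
    and X: "module.subspace s1 X" "fin_dim s1 X" "Y \<subseteq> X"
    and X': "module.subspace s2 X'" "fin_dim s2 X'" "module.subspace s2 Y'" "Y' \<subseteq> X'"
    and "f ` X \<subseteq> X'" "\<And>x'. x' \<in> X' \<Longrightarrow> \<exists>x\<in>X. x' - f x \<in> Y'"
    and "\<And>x. x \<in> X \<Longrightarrow> f x \<in> Y' \<longleftrightarrow> x \<in> Y"
  shows "vector_space.dim s1 X - vector_space.dim s1 Y = vector_space.dim s2 X' - vector_space.dim s2 Y'"
proof -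
  interpret Vector_Spaces.linear s1 s2 f by fact
  interpret vector_space_pair s1 s2 by unfold_locales
  obtain q where q: "Vector_Spaces.linear s2 s2 q" "\<And>x. q x = 0 \<longleftrightarrow> x \<in> Y'"
    using vs2.exists_linear_with_kernel[OF X'(3)] by blast
  interpret q: Vector_Spaces.linear s2 s2 q by fact
  have qf: "Vector_Spaces.linear s1 s2 (q \<circ> f)" using Vector_Spaces.linear_compose[OF lin q(1)] .
  have "{x \<in> X. (q \<circ> f) x = 0} = Y" using q(2) assms(11) X(3) by auto
  then have 1: "vs1.dim X = vs1.dim Y + vs2.dim ((q \<circ> f) ` X)" using rank_nullity[OF qf X(1,2)] by simp
  have "{x \<in> X'. q x = 0} = Y'" using q(2) X'(4) by auto
  then have 2: "vs2.dim X' = vs2.dim Y' + vs2.dim (q ` X')" using rank_nullity[OF q(1) X'(1,2)] by simp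
  have "q ` X' = (q \<circ> f) ` X"
  proof
    show "q ` X' \<subseteq> (q \<circ> f) ` X"
    proof
      fix w assume "w \<in> q ` X'"
      then obtain x' where x': "x' \<in> X'" "w = q x'" by blast
      then obtain x where x: "x \<in> X" "x' - f x \<in> Y'" using assms(10) by blast
      then have "q x' - q (f x) = 0" using q(2) q.diff by metis
      then show "w \<in> (q \<circ> f) ` X" using x x' by auto
    qed
  qed (use assms(9) in auto)
  then show ?thesis using 1 2 by simp
qed

section \<open>Polynomials\<close>

abbreviation cst :: "'k::field \<Rightarrow> 'k mpoly" where
  "cst c \<equiv> Poly_Mapping.single 0 c"

definition mvar :: "nat \<Rightarrow> monomial" where
  "mvar l = Poly_Mapping.single l 1"

abbreviation var :: "nat \<Rightarrow> 'k::field mpoly" where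
  "var l \<equiv> Poly_Mapping.single (mvar l) 1"

lemma lookup_mvar [simp]: "Poly_Mapping.lookup (mvar l) k = (if l = k then 1 else 0)"
  by (simp add: mvar_def lookup_single when_def)

abbreviation (input) mcoeff :: "'k::field mpoly \<Rightarrow> monomial \<Rightarrow> 'k" where
  "mcoeff \<equiv> Poly_Mapping.lookup"

abbreviation (input) expo :: "monomial \<Rightarrow> nat \<Rightarrow> nat" where
  "expo \<equiv> Poly_Mapping.lookup"

abbreviation (input) pscale :: "'k::field \<Rightarrow> 'k mpoly \<Rightarrow> 'k mpoly" where
  "pscale c p \<equiv> cst c * p"

abbreviation (input) fscale :: "'k::field \<Rightarrow> ('a \<Rightarrow> 'k mpoly) \<Rightarrow> 'a \<Rightarrow> 'k mpoly" where
  "fscale c v \<equiv> (\<lambda>l. cst c * v l)"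

lemma cst_mult: "cst (c * d) = cst c * cst d"
  by (simp add: mult_single)

global_interpretation pvec: vector_space "pscale :: 'k::field \<Rightarrow> _"
  by unfold_locales (simp_all add: algebra_simps single_add mult_single flip: mult.assoc)

global_interpretation fvec: vector_space "fscale :: 'k::field \<Rightarrow> ('a \<Rightarrow> 'k mpoly) \<Rightarrow> _"
  by unfold_locales (simp_all add: fun_eq_iff algebra_simps single_add mult_single flip: mult.assoc)

lemma linear_pfI:
  assumes "\<And>x y. f (x + y) = f x + f y" "\<And>c x. f (pscale c x) = pscale c (f x)"
  shows "Vector_Spaces.linear pscale pscale f"
  by (unfold_locales) (simp_all add: assms)

lemma linear_ffI:
  fixes f :: "('a \<Rightarrow> 'k::field mpoly) \<Rightarrow> ('b \<Rightarrow> 'k mpoly)"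
  assumes "\<And>x y. f (x + y) = f x + f y" "\<And>c x. f (fscale c x) = fscale c (f x)"
  shows "Vector_Spaces.linear fscale fscale f"
  by (unfold_locales) (simp_all add: assms)

lemma coeff_single_mult: "mcoeff (Poly_Mapping.single a c * p) (a + b) = c * mcoeff p b"
  by (simp add: lookup_mult lookup_single when_mult)

lemma coeff_single_mult_zero:
  assumes "\<And>b'. b \<noteq> a + b'"
  shows "mcoeff (Poly_Mapping.single a c * p) b = 0"
  using assms by (simp add: lookup_mult lookup_single when_mult)

lemma coeff_cst_mult [simp]: "mcoeff (cst c * p) b = c * mcoeff p b"
  using coeff_single_mult[of 0 c p b] by simp

lemma monomial_minus_var: "expo a l > 0 \<Longrightarrow> mvar l + (a - mvar l) = a"
  by (rule poly_mapping_eqI) (auto simp: lookup_add lookup_minus lookup_single when_def)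

lemma coeff_var_mult:
  "mcoeff (var l * p) a = (if expo a l = 0 then 0 else mcoeff p (a - mvar l))"
proof (cases "expo a l = 0")
  case True
  then have "a \<noteq> mvar l + b'" for b' by (auto simp: lookup_add)
  then show ?thesis using True coeff_single_mult_zero[of a "mvar l" 1 p] by simp
next
  case False
  then show ?thesis using coeff_single_mult[of "mvar l" 1 p "a - mvar l"]
    monomial_minus_var[of a l] by simp
qed

lemma poly_eq_sum_single: "(p :: 'k::field mpoly) = (\<Sum>a\<in>Poly_Mapping.keys p. Poly_Mapping.single a (Poly_Mapping.lookup p a))"
proof (rule poly_mapping_eqI)
  fix b
  have "mcoeff (\<Sum>a\<in>Poly_Mapping.keys p. Poly_Mapping.single a (Poly_Mapping.lookup p a)) b
    = (\<Sum>a\<in>Poly_Mapping.keys p. if a = b then Poly_Mapping.lookup p a else 0)"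
    unfolding lookup_sum by (rule sum.cong) (auto simp: lookup_single when_def)
  also have "\<dots> = Poly_Mapping.lookup p b" by (simp add: sum.delta in_keys_iff)
  finally show "Poly_Mapping.lookup p b
    = Poly_Mapping.lookup (\<Sum>a\<in>Poly_Mapping.keys p. Poly_Mapping.single a (Poly_Mapping.lookup p a)) b" by simp
qed

lemma poly_induct_sum:
  fixes p :: "'k::field mpoly"
  assumes "P 0" "\<And>p q. P p \<Longrightarrow> P q \<Longrightarrow> P (p + q)"
    "\<And>a. a \<in> Poly_Mapping.keys p \<Longrightarrow> P (Poly_Mapping.single a (Poly_Mapping.lookup p a))"
  shows "P p"
proof -
  have "P (\<Sum>a\<in>B. Poly_Mapping.single a (Poly_Mapping.lookup p a))" if "finite B" "B \<subseteq> Poly_Mapping.keys p" for B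
    using that by (induction B rule: finite_induct) (use assms in auto)
  from this[OF _ order_refl] show ?thesis using poly_eq_sum_single[of p] by simp
qed

lemma keys_mult_subset: "(\<And>a b. a \<in> Poly_Mapping.keys p \<Longrightarrow> b \<in> Poly_Mapping.keys q \<Longrightarrow> a + b \<in> S) \<Longrightarrow> Poly_Mapping.keys (p * q) \<subseteq> S"
  using keys_mult[of p q] by fastforce

lemma keys_add_subset: "Poly_Mapping.keys p \<subseteq> S \<Longrightarrow> Poly_Mapping.keys q \<subseteq> S \<Longrightarrow> Poly_Mapping.keys (p + q) \<subseteq> S"
  using keys_add[of p q] by blast

lemma keys_sum_subset: "(\<And>i. i \<in> I \<Longrightarrow> Poly_Mapping.keys (f i) \<subseteq> S) \<Longrightarrow> Poly_Mapping.keys (sum f I) \<subseteq> S"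
  using keys_sum[of f I] by blast

subsection \<open>Monomials of a given degree\<close>

lemma monomials_iff: "a \<in> monomials n \<longleftrightarrow> (\<forall>l\<ge>n. expo a l = 0)"
  unfolding monomials_def subset_iff in_keys_iff lessThan_iff mem_Collect_eq by (metis linorder_not_le)

lemma mdeg_eq_sum: "a \<in> monomials n \<Longrightarrow> mdeg a = (\<Sum>l<n. expo a l)"
  unfolding mdeg_def monomials_def by (rule sum.mono_neutral_left) (auto simp: in_keys_iff)

lemma exists_monomials: "\<exists>n. a \<in> monomials n \<and> b \<in> monomials n"
proof -
  have "finite (Poly_Mapping.keys a \<union> Poly_Mapping.keys b)" by simp
  then obtain n where "\<forall>l\<in>Poly_Mapping.keys a \<union> Poly_Mapping.keys b. l < n"
    using finite_nat_set_iff_bounded by blast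
  then show ?thesis unfolding monomials_def by (auto intro!: exI[of _ n])
qed

lemma mdeg_add [simp]: "mdeg (a + b) = mdeg a + mdeg b"
proof -
  obtain n where n: "a \<in> monomials n" "b \<in> monomials n" using exists_monomials by blast
  then have "a + b \<in> monomials n" by (simp add: monomials_iff lookup_add)
  then show ?thesis using n by (simp add: mdeg_eq_sum lookup_add sum.distrib)
qed

lemma mdeg_single [simp]: "mdeg (Poly_Mapping.single l e) = e"
  unfolding mdeg_def by (cases "e = 0") auto

lemma mdeg_mvar [simp]: "mdeg (mvar l) = 1"
  by (simp add: mvar_def)

lemma mdeg_zero [simp]: "mdeg 0 = 0" by (simp add: mdeg_def)

lemma expo_le_mdeg: "expo a l \<le> mdeg a"
  unfolding mdeg_def
  by (cases "l \<in> Poly_Mapping.keys a") (auto simp: in_keys_iff intro: member_le_sum)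

lemma mdeg_eq_0_iff [simp]: "mdeg a = 0 \<longleftrightarrow> a = 0"
  using expo_le_mdeg[of a] by (auto intro!: poly_mapping_eqI)

definition hmons :: "nat \<Rightarrow> nat \<Rightarrow> monomial set" where
  "hmons n e = {a \<in> monomials n. mdeg a = e}"

lemma hmons_add: "a \<in> hmons n d \<Longrightarrow> b \<in> hmons n e \<Longrightarrow> a + b \<in> hmons n (d + e)"
  by (simp add: hmons_def monomials_iff lookup_add)

lemma finite_hmons [simp]: "finite (hmons n e)"
proof (rule finite_subset)
  let ?f = "\<lambda>f. \<Sum>l<n. Poly_Mapping.single l (f l)"
  show "hmons n e \<subseteq> ?f ` ({..<n} \<rightarrow>\<^sub>E {..e})"
  proof
    fix a assume a: "a \<in> hmons n e"
    have "a = ?f (restrict (expo a) {..<n})"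
    proof (rule poly_mapping_eqI)
      fix k
      have "expo (?f (restrict (expo a) {..<n})) k = (\<Sum>l<n. if l = k then expo a l else 0)"
        unfolding lookup_sum by (rule sum.cong) (auto simp: lookup_single when_def)
      also have "\<dots> = expo a k" using a by (auto simp: hmons_def monomials_iff)
      finally show "expo a k = expo (?f (restrict (expo a) {..<n})) k" ..
    qed
    moreover have "restrict (expo a) {..<n} \<in> {..<n} \<rightarrow>\<^sub>E {..e}"
      using a expo_le_mdeg[of a] by (auto simp: hmons_def)
    ultimately show "a \<in> ?f ` ({..<n} \<rightarrow>\<^sub>E {..e})" by blast
  qed
qed (intro finite_imageI finite_PiE, auto)

lemma keys_single_subset: "Poly_Mapping.keys (Poly_Mapping.single a c) \<subseteq> {a}"
  by simp

definition mspan :: "monomial set \<Rightarrow> 'k::field mpoly set" where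
  "mspan L = {p. Poly_Mapping.keys p \<subseteq> L}"

lemma mspan_eq_span: "(mspan L :: 'k::field mpoly set) = pvec.span ((\<lambda>a. Poly_Mapping.single a 1) ` L)"
proof
  have sub: "pvec.subspace (mspan L :: 'k mpoly set)"
    unfolding pvec.subspace_def mspan_def
  proof (intro conjI ballI allI)
    show "x + y \<in> {p. Poly_Mapping.keys p \<subseteq> L}" if "x \<in> {p. Poly_Mapping.keys p \<subseteq> L}" "y \<in> {p. Poly_Mapping.keys p \<subseteq> L}" for x y :: "'k mpoly"
      using that keys_add_subset by blast
    show "cst c * x \<in> {p. Poly_Mapping.keys p \<subseteq> L}" if "x \<in> {p. Poly_Mapping.keys p \<subseteq> L}" for c and x :: "'k mpoly"
      using that by (auto simp: in_keys_iff subset_iff)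
  qed simp
  show "pvec.span ((\<lambda>a. Poly_Mapping.single a 1) ` L) \<subseteq> (mspan L :: 'k mpoly set)"
  proof (rule pvec.span_minimal[OF _ sub])
    show "(\<lambda>a. Poly_Mapping.single a (1::'k)) ` L \<subseteq> mspan L"
    proof (rule image_subsetI)
      fix a assume "a \<in> L"
      then have "{a} \<subseteq> L" by simp
      then show "Poly_Mapping.single a (1::'k) \<in> mspan L"
        unfolding mspan_def mem_Collect_eq by (rule subset_trans[OF keys_single_subset])
    qed
  qed
  show "mspan L \<subseteq> pvec.span ((\<lambda>a. Poly_Mapping.single a (1::'k)) ` L)"
  proof
    fix p :: "'k mpoly" assume "p \<in> mspan L"
    then have k: "Poly_Mapping.keys p \<subseteq> L" by (simp add: mspan_def)
    have "Poly_Mapping.single a (mcoeff p a) \<in> pvec.span ((\<lambda>a. Poly_Mapping.single a (1::'k)) ` L)"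
      if a: "a \<in> Poly_Mapping.keys p" for a
    proof -
      have "Poly_Mapping.single a (mcoeff p a) = cst (mcoeff p a) * Poly_Mapping.single a 1"
        by (simp add: mult_single)
      moreover have "Poly_Mapping.single a 1 \<in> pvec.span ((\<lambda>a. Poly_Mapping.single a (1::'k)) ` L)"
        using k a by (intro pvec.span_base imageI) blast
      ultimately show ?thesis using pvec.span_scale by metis
    qed
    then have "(\<Sum>a\<in>Poly_Mapping.keys p. Poly_Mapping.single a (mcoeff p a)) \<in> pvec.span ((\<lambda>a. Poly_Mapping.single a 1) ` L)"
      by (rule pvec.span_sum)
    then show "p \<in> pvec.span ((\<lambda>a. Poly_Mapping.single a 1) ` L)"
      using poly_eq_sum_single[of p] by simp
  qed
qed

subsection \<open>Homogeneous polynomials\<close>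

definition hpolys :: "nat \<Rightarrow> nat \<Rightarrow> 'k::field mpoly set" where
  "hpolys n e = {p. Poly_Mapping.keys p \<subseteq> hmons n e}"

lemma hpolys_iff: "p \<in> hpolys n e \<longleftrightarrow> p \<in> polys n \<and> homogeneous e p"
  unfolding hpolys_def polys_def hmons_def homogeneous_def by auto

lemma zero_in_hpolys [simp]: "0 \<in> hpolys n e" by (simp add: hpolys_def)

lemma add_in_hpolys: "p \<in> hpolys n e \<Longrightarrow> q \<in> hpolys n e \<Longrightarrow> p + q \<in> hpolys n e"
  unfolding hpolys_def using keys_add_subset by blast

lemma mult_in_hpolys: "p \<in> hpolys n d \<Longrightarrow> q \<in> hpolys n e \<Longrightarrow> p * q \<in> hpolys n (d + e)"
  unfolding hpolys_def mem_Collect_eq by (rule keys_mult_subset) (use hmons_add in blast)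

lemma sum_in_hpolys: "(\<And>i. i \<in> I \<Longrightarrow> f i \<in> hpolys n e) \<Longrightarrow> sum f I \<in> hpolys n e"
  unfolding hpolys_def by (simp add: keys_sum_subset)

lemma single_in_hpolys: "a \<in> hmons n e \<Longrightarrow> Poly_Mapping.single a c \<in> hpolys n e"
  unfolding hpolys_def using keys_single_subset[of a c] by blast

lemma cst_in_hpolys [simp]: "cst c \<in> hpolys n 0"
  by (simp add: single_in_hpolys hmons_def monomials_iff)

lemma var_in_hpolys: "l < n \<Longrightarrow> var l \<in> hpolys n 1"
  by (rule single_in_hpolys) (auto simp: hmons_def monomials_iff lookup_single when_def)

lemma cst_mult_in_hpolys: "p \<in> hpolys n e \<Longrightarrow> cst c * p \<in> hpolys n e"
  using mult_in_hpolys[OF cst_in_hpolys, of p n e c] by simp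

lemma subspace_hpolys: "pvec.subspace (hpolys n e)"
  by (simp add: pvec.subspace_def add_in_hpolys cst_mult_in_hpolys)

lemma hpolys_eq_span: "(hpolys n e :: 'k::field mpoly set) = pvec.span ((\<lambda>a. Poly_Mapping.single a 1) ` hmons n e)"
  unfolding mspan_eq_span[symmetric] by (simp add: hpolys_def mspan_def)

lemma fin_dim_hpolys [simp]: "fin_dim pscale (hpolys n e)"
  unfolding hpolys_eq_span by (simp add: pvec.fin_dim_span)

lemma independent_monomials: "pvec.independent ((\<lambda>a. Poly_Mapping.single a 1) ` M :: 'k::field mpoly set)"
proof -
  have "Poly_Mapping.single a 1 \<notin> pvec.span ((\<lambda>a. Poly_Mapping.single a 1) ` M - {Poly_Mapping.single a (1::'k)})" for a
  proof
    let ?S = "{p :: 'k mpoly. mcoeff p a = 0}"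
    assume *: "Poly_Mapping.single a (1::'k) \<in> pvec.span ((\<lambda>a. Poly_Mapping.single a 1) ` M - {Poly_Mapping.single a 1})"
    have "pvec.span ((\<lambda>a. Poly_Mapping.single a 1) ` M - {Poly_Mapping.single a (1::'k)}) \<subseteq> ?S"
      by (rule pvec.span_minimal) (auto simp: pvec.subspace_def lookup_add lookup_single when_def)
    then show False using * by auto
  qed
  then show ?thesis unfolding pvec.dependent_def by blast
qed

lemma dim_span_monomials: "pvec.dim (pvec.span ((\<lambda>a. Poly_Mapping.single a 1) ` M :: 'k::field mpoly set)) = card M"
proof -
  have "inj_on (\<lambda>a. Poly_Mapping.single a (1::'k)) M"
  proof (rule inj_onI)
    fix a b :: monomial assume "Poly_Mapping.single a (1::'k) = Poly_Mapping.single b 1"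
    then have "mcoeff (Poly_Mapping.single a (1::'k)) a = mcoeff (Poly_Mapping.single b 1) a" by simp
    then show "a = b" by (auto simp: lookup_single when_def split: if_splits)
  qed
  moreover have "pvec.dim (pvec.span ((\<lambda>a. Poly_Mapping.single a (1::'k)) ` M)) = card ((\<lambda>a. Poly_Mapping.single a (1::'k)) ` M)"
    by (rule pvec.dim_span_eq_card_independent[OF independent_monomials])
  ultimately show ?thesis using card_image by metis
qed

lemma zero_in_polys [simp]: "0 \<in> polys n" by (simp add: polys_def)

lemma add_in_polys: "p \<in> polys n \<Longrightarrow> q \<in> polys n \<Longrightarrow> p + q \<in> polys n"
  unfolding polys_def using keys_add_subset by blast

lemma mult_in_polys: "p \<in> polys n \<Longrightarrow> q \<in> polys n \<Longrightarrow> p * q \<in> polys n"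
  unfolding polys_def mem_Collect_eq by (rule keys_mult_subset) (auto simp: monomials_iff lookup_add subset_iff)

lemma hpolys_subset_polys: "p \<in> hpolys n e \<Longrightarrow> p \<in> polys n"
  by (simp add: hpolys_iff)

lemma cst_in_polys [simp]: "cst c \<in> polys n"
  using cst_in_hpolys hpolys_subset_polys by blast

lemma uminus_in_polys: "p \<in> polys n \<Longrightarrow> - p \<in> polys n"
  by (simp add: polys_def)

lemma diff_in_polys: "p \<in> polys n \<Longrightarrow> q \<in> polys n \<Longrightarrow> p - q \<in> polys n"
  using add_in_polys[OF _ uminus_in_polys, of p n q] by simp

lemma single_in_polys: "a \<in> monomials n \<Longrightarrow> Poly_Mapping.single a c \<in> polys n"
  unfolding polys_def using keys_single_subset[of a c] by blast

lemma cst_eq_0_iff [simp]: "cst c = 0 \<longleftrightarrow> c = 0"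
  by (metis lookup_single_eq lookup_zero single_zero)

lemma hpolys_0_eq: "p \<in> hpolys n 0 \<Longrightarrow> p = cst (mcoeff p 0)"
  by (rule poly_mapping_eqI) (auto simp: hpolys_def hmons_def lookup_single when_def in_keys_iff subset_iff)

subsection \<open>Restricting to a set of monomials\<close>

definition prestrict :: "(monomial \<Rightarrow> bool) \<Rightarrow> 'k::field mpoly \<Rightarrow> 'k mpoly" where
  "prestrict Q p = (\<Sum>a\<in>{a\<in>Poly_Mapping.keys p. Q a}. Poly_Mapping.single a (Poly_Mapping.lookup p a))"

lemma coeff_prestrict [simp]: "mcoeff (prestrict Q p) b = (if Q b then mcoeff p b else 0)"
proof -
  have "mcoeff (prestrict Q p) b
    = (\<Sum>a\<in>{a\<in>Poly_Mapping.keys p. Q a}. if a = b then Poly_Mapping.lookup p a else 0)"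
    unfolding lookup_sum prestrict_def by (rule sum.cong) (auto simp: lookup_single when_def)
  also have "\<dots> = (if Q b then mcoeff p b else 0)" by (auto simp: sum.delta in_keys_iff)
  finally show ?thesis .
qed

lemma hom_component_eq: "hom_component j = prestrict (\<lambda>a. mdeg a = j)"
  by (simp add: fun_eq_iff hom_component_def prestrict_def)

lemma coeff_hom_component [simp]: "mcoeff (hom_component j p) b = (if mdeg b = j then mcoeff p b else 0)"
  by (simp add: hom_component_eq)

lemma hom_component_add: "hom_component j (p + q) = hom_component j p + hom_component j q"
  by (rule poly_mapping_eqI) (simp add: lookup_add)

lemma hom_component_zero [simp]: "hom_component j 0 = 0"
  by (rule poly_mapping_eqI) simp

lemma hom_component_sum: "hom_component j (sum f I) = (\<Sum>i\<in>I. hom_component j (f i))"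
  by (induction I rule: infinite_finite_induct) (simp_all add: hom_component_add)

lemma hom_component_in_hpolys: "p \<in> polys n \<Longrightarrow> hom_component j p \<in> hpolys n j"
  by (auto simp: hpolys_def hmons_def polys_def in_keys_iff subset_iff split: if_splits)

lemma hom_component_hpolys: "p \<in> hpolys n e \<Longrightarrow> hom_component j p = (if j = e then p else 0)"
  by (rule poly_mapping_eqI) (auto simp: hpolys_def hmons_def in_keys_iff subset_iff)

text \<open>By bilinearity two single terms suffice. This allows an inhomogeneous preimage under a
  homogeneous matrix to be replaced by its component of the right degree.\<close>

lemma hom_component_mult:
  assumes "p \<in> hpolys n e"
  shows "hom_component (e + j) (p * q) = p * hom_component j q"
proof -
  have "hom_component (e + j) (Poly_Mapping.single a c * Poly_Mapping.single b d)
     = Poly_Mapping.single a c * hom_component j (Poly_Mapping.single b d)" if "mdeg a = e" for a b and c d :: 'a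
  proof -
    have "hom_component j (Poly_Mapping.single b d) = (if mdeg b = j then Poly_Mapping.single b d else 0)"
      by (rule poly_mapping_eqI) (auto simp: lookup_single when_def)
    moreover have "hom_component (e + j) (Poly_Mapping.single (a + b) (c * d))
       = (if mdeg b = j then Poly_Mapping.single (a + b) (c * d) else 0)"
      using that by (intro poly_mapping_eqI) (auto simp: lookup_single when_def)
    ultimately show ?thesis by (simp add: mult_single)
  qed note 1 = this
  have 2: "hom_component (e + j) (Poly_Mapping.single a c * q) = Poly_Mapping.single a c * hom_component j q"
    if "mdeg a = e" for a and c :: 'a
    by (induction q rule: poly_induct_sum) (simp_all add: 1[OF that] hom_component_add algebra_simps)
  have k: "mdeg a = e" if "a \<in> Poly_Mapping.keys p" for a using assms that by (auto simp: hpolys_def hmons_def)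
  have "hom_component (e + j) ((\<Sum>a\<in>Poly_Mapping.keys p. Poly_Mapping.single a (Poly_Mapping.lookup p a)) * q)
     = (\<Sum>a\<in>Poly_Mapping.keys p. Poly_Mapping.single a (Poly_Mapping.lookup p a)) * hom_component j q"
    unfolding sum_distrib_right hom_component_sum by (rule sum.cong) (simp_all add: 2 k)
  then show ?thesis using poly_eq_sum_single[of p] by simp
qed

lemma hom_component_mult_less:
  assumes "p \<in> hpolys n e" "j < e"
  shows "hom_component j (p * q) = 0"
proof (rule poly_mapping_eqI)
  fix b
  have "mcoeff (p * q) b = 0" if "mdeg b = j"
  proof (rule ccontr)
    assume "mcoeff (p * q) b \<noteq> 0"
    then obtain a a' where "a \<in> Poly_Mapping.keys p" "b = a + a'" using keys_mult[of p q] by (auto simp: in_keys_iff subset_iff)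
    then show False using assms that by (auto simp: hpolys_def hmons_def)
  qed
  then show "mcoeff (hom_component j (p * q)) b = mcoeff 0 b" by simp
qed

text \<open>Exponents are natural numbers, so a product of monomials is 1 only if both factors are.
  Taking constant coefficients is the ring homomorphism from S to K.\<close>

lemma coeff_mult_0: "mcoeff (p * q) 0 = mcoeff p 0 * mcoeff q (0::monomial)"
proof -
  have zero: "a + b = 0 \<longleftrightarrow> a = 0 \<and> b = 0" for a b :: monomial
    by (auto simp: poly_mapping_eq_iff fun_eq_iff lookup_add)
  have s: "mcoeff (Poly_Mapping.single a c * Poly_Mapping.single b d) 0 = mcoeff (Poly_Mapping.single a c) 0 * mcoeff (Poly_Mapping.single b d) 0"
    for a b and c d :: 'a
    by (auto simp: mult_single lookup_single when_def zero)
  have "mcoeff (Poly_Mapping.single a c * q) 0 = mcoeff (Poly_Mapping.single a c) 0 * mcoeff q 0" for a c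
    by (induction q rule: poly_induct_sum) (simp_all add: s lookup_add distrib_left)
  then show ?thesis
    by (induction p rule: poly_induct_sum) (simp_all add: lookup_add distrib_right)
qed

section \<open>The Koszul complex\<close>

text \<open>
  An element of \<open>\<And> K\<^sup>n \<otimes> M\<close> is the function that maps \<open>A \<subseteq> {..<n}\<close> to the coefficient of the wedge of
  the basis vectors with index in \<open>A\<close>, in increasing order; \<open>ksign j A\<close> is the sign that arises
  when the \<open>j\<close>-th basis vector is moved to its place.
\<close>

definition ksign :: "nat \<Rightarrow> nat set \<Rightarrow> 'k::field mpoly" where
  "ksign j A = (- 1) ^ card {s \<in> A. s < j}"

text \<open>The interior product with the \<open>j\<close>-th dual basis vector;
  \<open>wedge\<close> is exterior multiplication by the \<open>j\<close>-th basis vector from the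
  left.\<close>

definition contract :: "nat \<Rightarrow> (nat set \<Rightarrow> 'k::field mpoly) \<Rightarrow> nat set \<Rightarrow> 'k mpoly" where
  "contract j z A = (if j \<in> A then 0 else ksign j A * z (insert j A))"

definition wedge :: "nat \<Rightarrow> (nat set \<Rightarrow> 'k::field mpoly) \<Rightarrow> nat set \<Rightarrow> 'k mpoly" where
  "wedge j z A = (if j \<in> A then ksign j A * z (A - {j}) else 0)"

text \<open>The Koszul differential of the first \<open>n\<close> variables, acting on functions on
  all index sets at once; the homological degree is the cardinality of the index sets in the
  support.\<close>

definition kos :: "nat \<Rightarrow> (nat set \<Rightarrow> 'k::field mpoly) \<Rightarrow> nat set \<Rightarrow> 'k mpoly" where
  "kos n z A = (\<Sum>l<n. var l * contract l z A)"

lemma finite_less_subset [simp]: "finite {s \<in> A. s < (j::nat)}"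
  by (rule finite_subset[of _ "{..<j}"]) auto

lemma ksign_mult_self [simp]: "ksign j A * ksign j A = 1" "ksign j A * (ksign j A * p) = p"
  unfolding ksign_def by (simp_all flip: mult.assoc power_add)

lemma ksign_insert:
  assumes "l \<notin> A"
  shows "ksign j (insert l A) = (if l < j then - ksign j A else ksign j A)"
proof -
  have "{s \<in> insert l A. s < j} = (if l < j then insert l {s \<in> A. s < j} else {s \<in> A. s < j})" by auto
  then show ?thesis unfolding ksign_def using assms by auto
qed

lemma ksign_remove:
  assumes "l \<in> A"
  shows "ksign j (A - {l}) = (if l < j then - ksign j A else ksign j A :: 'k::field mpoly)"
proof -
  have "(ksign j (insert l (A - {l})) :: 'k mpoly) = (if l < j then - ksign j (A - {l}) else ksign j (A - {l}))"
    by (rule ksign_insert) simp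
  then show ?thesis using assms by (cases "l < j") (simp_all add: insert_absorb)
qed

lemma contract_add: "contract l (y + z) = contract l y + contract l z"
  by (auto simp: fun_eq_iff contract_def algebra_simps)

lemma contract_scale: "contract l (\<lambda>A. p * z A) = (\<lambda>A. p * contract l z A)"
  by (auto simp: fun_eq_iff contract_def algebra_simps)

lemma contract_contract_self: "contract j (contract j z) = 0"
  by (auto simp: fun_eq_iff contract_def)

lemma contract_anticommute: "contract j (contract l z) A = - contract l (contract j z) A"
  by (cases "j = l")
    (auto simp: contract_contract_self contract_def ksign_insert insert_commute)

text \<open>The interior product is an antiderivation, so the anticommutator is the pairing of a
  basis vector with a dual one, which is 0 or 1.\<close>

lemma contract_wedge: "contract j (wedge l z) A + wedge l (contract j z) A = (if j = l then z A else 0)"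
proof (cases "j = l")
  case True
  then show ?thesis by (auto simp: contract_def wedge_def ksign_insert ksign_remove insert_absorb)
next
  case False
  then have "insert j (A - {l}) = insert j A - {l}" by auto
  then show ?thesis using False
    by (auto simp: contract_def wedge_def ksign_insert ksign_remove)
qed

text \<open>The vanishing of the diagonal is a separate hypothesis because antisymmetry does not
  imply it in characteristic 2.\<close>

lemma sum_antisymmetric:
  fixes g :: "nat \<Rightarrow> nat \<Rightarrow> 'a::ab_group_add"
  assumes "\<And>l m. g l m = - g m l" "\<And>l. g l l = 0"
  shows "(\<Sum>l<n. \<Sum>m<n. g l m) = 0"
proof (induction n)
  case (Suc n)
  have "(\<Sum>l<Suc n. \<Sum>m<Suc n. g l m) = (\<Sum>l<n. \<Sum>m<n. g l m) + ((\<Sum>l<n. g l n) + (\<Sum>m<n. g n m))"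
    using assms(2) by (simp add: sum.distrib algebra_simps)
  moreover have "(\<Sum>l<n. g l n) = - (\<Sum>m<n. g n m)"
    unfolding sum_negf[symmetric] using assms(1) by (rule sum.cong[OF refl])
  ultimately show ?case using Suc.IH by simp
qed simp

lemma contract_sum: "contract m (\<lambda>A. \<Sum>i\<in>I. f i A) A = (\<Sum>i\<in>I. contract m (f i) A)"
  by (simp add: contract_def sum_distrib_left)

lemma kos_add: "kos n (y + z) = kos n y + kos n z"
  by (simp add: fun_eq_iff kos_def contract_add distrib_left sum.distrib)

lemma kos_scale: "kos n (\<lambda>A. p * z A) = (\<lambda>A. p * kos n z A)"
  by (simp add: fun_eq_iff kos_def contract_scale sum_distrib_left mult.left_commute)

lemma kos_zero [simp]: "kos n 0 = 0" "kos n (\<lambda>_. 0) = (\<lambda>_. 0)"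
  by (simp_all add: fun_eq_iff kos_def contract_def cong: if_cong)

text \<open>Products of variables commute, contractions anticommute, and a repeated contraction
  vanishes.\<close>

lemma kos_kos: "kos n (kos n z) = 0"
proof
  fix A
  have "contract m (kos n z) A = (\<Sum>l<n. var l * contract m (contract l z) A)" for m
    unfolding kos_def contract_sum contract_scale by simp
  then have "kos n (kos n z) A = (\<Sum>m<n. \<Sum>l<n. var m * var l * contract m (contract l z) A)"
    unfolding kos_def[of n "kos n z"] by (simp add: sum_distrib_left mult.assoc)
  also have "\<dots> = 0"
  proof (rule sum_antisymmetric)
    show "var m * var l * contract m (contract l z) A = - (var l * var m * contract l (contract m z) A)" for l m
      by (subst contract_anticommute) (simp add: mult.commute)
  qed (simp add: contract_contract_self)
  finally show "kos n (kos n z) A = 0 A" by simp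
qed

lemma kos_contract: "kos n (contract j z) A = - contract j (kos n z) A"
proof -
  have "contract j (kos n z) A = (\<Sum>l<n. var l * contract j (contract l z) A)"
    unfolding kos_def contract_sum contract_scale by simp
  also have "\<dots> = (\<Sum>l<n. - (var l * contract l (contract j z) A))"
    by (rule sum.cong[OF refl], subst contract_anticommute) simp
  finally show ?thesis by (simp add: kos_def sum_negf)
qed

text \<open>Exterior multiplication by the \<open>j\<close>-th basis vector is a homotopy for
  multiplication by \<open>x_j\<close>. For \<open>j < n\<close> it turns a cycle into an element
  whose boundary is \<open>x_j\<close> times that cycle, which is the form used in both hyperplane
  estimates.\<close>

lemma kos_wedge: "kos n (wedge j z) A + wedge j (kos n z) A = (if j < n then var j * z A else 0)"
proof -
  have "wedge j (kos n z) A = (\<Sum>l<n. var l * wedge j (contract l z) A)"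
    by (simp add: wedge_def kos_def sum_distrib_left mult.left_commute)
  then have "kos n (wedge j z) A + wedge j (kos n z) A
     = (\<Sum>l<n. var l * (contract l (wedge j z) A + wedge j (contract l z) A))"
    by (simp add: kos_def distrib_left sum.distrib)
  also have "\<dots> = (\<Sum>l<n. if l = j then var l * z A else 0)"
    unfolding contract_wedge by (rule sum.cong) auto
  finally show ?thesis by simp
qed

subsection \<open>The contracting homotopy\<close>

text \<open>
  \<open>var_quot j p\<close> divides by \<open>x\<^sub>j\<close> the sum of the terms of \<open>p\<close> whose first variable is \<open>x\<^sub>j\<close>.
\<close>

definition avoids_below :: "nat \<Rightarrow> monomial \<Rightarrow> bool" where
  "avoids_below j a \<longleftrightarrow> (\<forall>l<j. expo a l = 0)"

definition no_vars_below :: "nat \<Rightarrow> 'k::field mpoly \<Rightarrow> 'k mpoly" where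
  "no_vars_below j = prestrict (avoids_below j)"

definition var_quot :: "nat \<Rightarrow> 'k::field mpoly \<Rightarrow> 'k mpoly" where
  "var_quot j p = no_vars_below j (Poly_Mapping.map_key (\<lambda>b. b + mvar j) p)"

text \<open>On a monomial times the wedge over \<open>B\<close>, the first variable
  \<open>x_j\<close> of the monomial is traded for the index \<open>j\<close> if \<open>j\<close>
  precedes all of \<open>B\<close>; otherwise the result is 0. Unlike a homotopy built on Euler's
  formula it divides by no integer.\<close>

definition kos_htpy :: "(nat set \<Rightarrow> 'k::field mpoly) \<Rightarrow> nat set \<Rightarrow> 'k mpoly" where
  "kos_htpy z A = (if A = {} then 0 else var_quot (Min A) (z (A - {Min A})))"

lemma coeff_var_quot: "mcoeff (var_quot j p) b = (if avoids_below j b then mcoeff p (b + mvar j) else 0)"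
proof -
  have "inj (\<lambda>b. b + mvar j)" by (rule injI) simp
  then show ?thesis by (simp add: var_quot_def no_vars_below_def map_key.rep_eq)
qed

lemma coeff_no_vars_below: "mcoeff (no_vars_below j p) b = (if avoids_below j b then mcoeff p b else 0)"
  by (simp add: no_vars_below_def)

lemma monomial_minus_var': "expo a l > 0 \<Longrightarrow> a - mvar l + mvar l = a"
  using monomial_minus_var[of a l] by (simp add: add.commute)

text \<open>The terms with first variable \<open>x_j\<close> are those that avoid all earlier
  variables, without those that avoid \<open>x_j\<close> too. In this form the sum over
  \<open>j\<close> telescopes.\<close>

lemma var_mult_var_quot: "var j * var_quot j p = no_vars_below j p - no_vars_below (Suc j) p"
proof (rule poly_mapping_eqI)
  fix a
  show "mcoeff (var j * var_quot j p) a = mcoeff (no_vars_below j p - no_vars_below (Suc j) p) a"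
    by (cases "expo a j = 0")
      (auto simp: coeff_var_mult coeff_var_quot coeff_no_vars_below lookup_minus avoids_below_def less_Suc_eq monomial_minus_var')
qed

lemma var_quot_var_mult:
  "var_quot j (var l * p) = (if l < j then 0 else if l = j then no_vars_below j p else var l * var_quot j p)"
proof (rule poly_mapping_eqI)
  fix b
  have "b + mvar j - mvar l = b - mvar l + mvar j" if "expo b l > 0"
    using that by (intro poly_mapping_eqI) (auto simp: lookup_add lookup_minus)
  then show "mcoeff (var_quot j (var l * p)) b
     = mcoeff (if l < j then 0 else if l = j then no_vars_below j p else var l * var_quot j p) b"
    by (auto simp: coeff_var_mult coeff_var_quot coeff_no_vars_below lookup_add lookup_minus avoids_below_def)
qed

lemma var_quot_add: "var_quot j (p + q) = var_quot j p + var_quot j q"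
  by (rule poly_mapping_eqI) (simp add: coeff_var_quot lookup_add)

lemma var_quot_zero [simp]: "var_quot j 0 = 0"
  by (rule poly_mapping_eqI) (simp add: coeff_var_quot)

lemma var_quot_sum: "var_quot j (sum f I) = (\<Sum>i\<in>I. var_quot j (f i))"
  by (induction I rule: infinite_finite_induct) (simp_all add: var_quot_add)

lemma ksign_cases: "ksign j A = 1 \<or> ksign j A = - 1"
  unfolding ksign_def by (metis neg_one_even_power neg_one_odd_power)

lemma var_quot_uminus: "var_quot j (- p) = - var_quot j p"
  by (rule poly_mapping_eqI) (simp add: coeff_var_quot)

lemma var_quot_ksign: "var_quot j (ksign i A * p) = ksign i A * var_quot j (p :: 'k::field mpoly)"
proof -
  consider "ksign i A = (1 :: 'k mpoly)" | "ksign i A = (- 1 :: 'k mpoly)" using ksign_cases by blast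
  then show ?thesis
  proof cases
    case 2
    have "var_quot j (ksign i A * p) = var_quot j (- p)" unfolding 2 by simp
    also have "\<dots> = ksign i A * var_quot j p" unfolding 2 var_quot_uminus by simp
    finally show ?thesis .
  qed simp
qed

lemma no_vars_below_0 [simp]: "no_vars_below 0 p = p"
  by (rule poly_mapping_eqI) (simp add: coeff_no_vars_below avoids_below_def)

lemma sum_var_mult_var_quot: "(\<Sum>l<m. var l * var_quot l p) = p - no_vars_below m p"
  unfolding var_mult_var_quot by (induction m) simp_all

lemma no_vars_below_polys: "p \<in> polys n \<Longrightarrow> no_vars_below n p = cst (mcoeff p 0)"
proof (rule poly_mapping_eqI)
  fix b assume p: "p \<in> polys n"
  have "b = 0" if "\<forall>l<n. expo b l = 0" "mcoeff p b \<noteq> 0"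
    using p that by (intro poly_mapping_eqI) (metis in_keys_iff monomials_iff not_le_imp_less polys_def
        subset_iff lookup_zero mem_Collect_eq)
  then show "mcoeff (no_vars_below n p) b = mcoeff (cst (mcoeff p 0)) b"
    by (auto simp: coeff_no_vars_below lookup_single when_def avoids_below_def)
qed

lemma Min_insert_less:
  assumes "finite A" "A \<noteq> {} \<Longrightarrow> l < Min A"
  shows "Min (insert l A) = l"
  using assms by (cases "A = {}") (auto intro!: Min_eqI simp: less_imp_le)

text \<open>Let \<open>m\<close> be the minimum of \<open>A\<close>. In the first composite the
  indices \<open>l < m\<close> yield the terms of \<open>z A\<close> that contain a variable before
  \<open>x_m\<close>; in the second one \<open>l = m\<close> yields the other terms; for
  \<open>l > m\<close> the contributions cancel. If \<open>A\<close> is empty, only the first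
  composite is present, and the terms without any of the \<open>n\<close> variables are left
  over.\<close>

lemma kos_htpy_identity:
  fixes z :: "nat set \<Rightarrow> 'k::field mpoly"
  assumes A: "A \<subseteq> {..<n}"
  shows "kos n (kos_htpy z) A + kos_htpy (kos n z) A = z A - (if A = {} then no_vars_below n (z {}) else 0)"
proof (cases "A = {}")
  case True
  have "contract l (kos_htpy z) {} = var_quot l (z {})" for l
    by (simp add: contract_def kos_htpy_def ksign_def)
  then have "kos n (kos_htpy z) {} = z {} - no_vars_below n (z {})"
    unfolding kos_def using sum_var_mult_var_quot by simp
  then show ?thesis using True by (simp add: kos_htpy_def)
next
  case False
  have fin: "finite A" using A finite_subset by blast
  define m where "m = Min A"
  define B where "B = A - {m}"
  have mA: "m \<in> A" using fin False m_def by simp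
  have m_less: "m < b" if "b \<in> B" for b
    using that fin B_def m_def by (metis DiffE Min_le le_neq_implies_less singletonI)
  have mB: "m \<notin> B" "A = insert m B" "finite B" using mA B_def fin by auto
  have mn: "m < n" using mA A by auto
  have Min_l: "Min (insert l A) = l" if "l < m" for l
    using Min_insert_less[OF fin, of l] that m_def by simp
  have sB: "ksign m B = (1 :: 'k mpoly)"
  proof -
    have "{s \<in> B. s < m} = {}" using m_less by fastforce
    then show ?thesis by (simp only: ksign_def card.empty power_0)
  qed
  have sl: "ksign l A = (1 :: 'k mpoly)" if "l < m" for l
  proof -
    have "{s \<in> A. s < l} = {}" using m_less that mB(2) by fastforce
    then show ?thesis by (simp only: ksign_def card.empty power_0)
  qed
  have Min_g: "Min (insert l A) = m" if "l > m" for l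
    using that mA fin m_def by (metis False Min_insert min.strict_order_iff min.commute)
  \<comment> \<open>The contribution of an index \<open>l > m\<close>. It occurs in both composites
    with opposite signs, since adding \<open>m\<close> to \<open>B\<close> changes
    \<open>ksign l\<close> by -1.\<close>
  define t where "t l = (if l \<in> B then 0 else ksign l B * (var l * var_quot m (z (insert l B))))" for l
  have c1: "var l * contract l (kos_htpy z) A =
      (if l < m then var l * var_quot l (z A) else if l = m then 0 else - t l)" for l
  proof -
    consider "l < m" | "l = m" | "l > m" by linarith
    then show ?thesis
    proof cases
      case 1
      then have "l \<notin> A" using m_less mB(2) by fastforce
      then show ?thesis using 1 sl Min_l by (simp add: contract_def kos_htpy_def)
    next
      case 2
      then show ?thesis using mA by (simp add: contract_def)
    next
      case 3
      then have "insert l A - {m} = insert l B" using B_def by auto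
      moreover have "l \<in> A \<longleftrightarrow> l \<in> B" using 3 mB(2) by auto
      moreover have "ksign l A = (- ksign l B :: 'k mpoly)" using 3 mB by (simp add: ksign_insert)
      ultimately show ?thesis using 3 Min_g by (simp add: contract_def kos_htpy_def t_def algebra_simps)
    qed
  qed
  have c2: "var_quot m (var l * contract l z B) = (if l < m then 0 else if l = m then no_vars_below m (z A) else t l)" for l
  proof -
    have "var l * contract l z B = ksign l B * (var l * (if l \<in> B then 0 else z (insert l B)))"
      by (simp add: contract_def algebra_simps)
    then have "var_quot m (var l * contract l z B) = ksign l B * var_quot m (var l * (if l \<in> B then 0 else z (insert l B)))"
      by (simp only: var_quot_ksign)
    then show ?thesis using mB sB by (auto simp: var_quot_var_mult t_def)
  qed
  have "kos n (kos_htpy z) A + kos_htpy (kos n z) A =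
     (\<Sum>l<n. var l * contract l (kos_htpy z) A + var_quot m (var l * contract l z B))"
    using False by (simp add: kos_def[of n "kos_htpy z"] kos_htpy_def[of "kos n z"] sum.distrib
      m_def[symmetric] B_def[symmetric]) (simp add: kos_def var_quot_sum)
  also have "\<dots> = (\<Sum>l<n. (if l < m then var l * var_quot l (z A) else 0) + (if l = m then no_vars_below m (z A) else 0))"
    unfolding c1 c2 by (rule sum.cong) auto
  also have "\<dots> = (\<Sum>l\<in>{l\<in>{..<n}. l < m}. var l * var_quot l (z A)) + no_vars_below m (z A)"
    using mn unfolding sum.distrib by (simp add: sum.inter_filter flip: lessThan_iff)
  also have "{l\<in>{..<n}. l < m} = {..<m}" using mn by auto
  finally show ?thesis using False sum_var_mult_var_quot[of "z A" m] by simp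
qed

lemma kos_exact:
  assumes "\<And>A. \<not> A \<subseteq> {..<n} \<Longrightarrow> z A = 0" "kos n z = 0"
  shows "kos n (kos_htpy z) A = z A - (if A = {} then no_vars_below n (z {}) else 0)"
proof (cases "A \<subseteq> {..<n}")
  case True
  have "kos_htpy (kos n z) A = 0" unfolding assms(2) by (simp add: kos_htpy_def)
  then show ?thesis using kos_htpy_identity[OF True, of z] by simp
next
  case False
  have "contract l (kos_htpy z) A = 0" if "l < n" for l
  proof (cases "l \<in> A")
    case lA: False
    \<comment> \<open>For finite \<open>A\<close> the removed minimum is at most
      \<open>l < n\<close>, so an index of \<open>A\<close> outside \<open>{..<n}\<close> survives;
      an infinite set stays infinite.\<close>
    have "z (insert l A - {Min (insert l A)}) = 0"
    proof (rule assms(1), rule notI)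
      assume *: "insert l A - {Min (insert l A)} \<subseteq> {..<n}"
      then have "finite (insert l A - {Min (insert l A)})" using finite_subset by blast
      then have "finite (insert l A)" by simp
      then have "Min (insert l A) \<le> l" by simp
      then have "Min (insert l A) < n" using that by simp
      then have "A \<subseteq> {..<n}" using * by auto
      then show False using False by simp
    qed
    then show ?thesis using lA by (simp add: contract_def kos_htpy_def)
  qed (simp add: contract_def)
  then have "kos n (kos_htpy z) A = 0" by (simp add: kos_def)
  then show ?thesis using False assms(1) by auto
qed

section \<open>Double complexes\<close>

text \<open>\<open>f\<close> lowers the first index and \<open>g\<close> the second. The
  \<open>f\<close>-complexes with positive second index and the \<open>g\<close>-complexes with
  positive first index are exact, down to surjectivity at the end; the homologies of the two
  remaining edge complexes are to be compared. Squares commute without signs, as no total complex is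
  formed.\<close>

locale double_complex = vector_space scale
  for scale :: "'a::field \<Rightarrow> 'b::ab_group_add \<Rightarrow> 'b" +
  fixes C :: "nat \<Rightarrow> nat \<Rightarrow> 'b set"
    and f g :: "nat \<Rightarrow> nat \<Rightarrow> 'b \<Rightarrow> 'b"
  assumes C: "subspace (C p q)" "fin_dim scale (C p q)"
    and linear_f: "Vector_Spaces.linear scale scale (f p q)"
    and linear_g: "Vector_Spaces.linear scale scale (g p q)"
    and f_in: "x \<in> C (Suc p) q \<Longrightarrow> f p q x \<in> C p q"
    and g_in: "x \<in> C p (Suc q) \<Longrightarrow> g p q x \<in> C p q"
    and commute: "x \<in> C (Suc p) (Suc q) \<Longrightarrow> f p q (g (Suc p) q x) = g p q (f p (Suc q) x)"
    and ff: "x \<in> C (Suc (Suc p)) q \<Longrightarrow> f p q (f (Suc p) q x) = 0"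
    and gg: "x \<in> C p (Suc (Suc q)) \<Longrightarrow> g p q (g p (Suc q) x) = 0"
    and row_exact: "x \<in> C p (Suc q) \<Longrightarrow> (0 < p \<Longrightarrow> f (p - 1) (Suc q) x = 0) \<Longrightarrow> x \<in> f p (Suc q) ` C (Suc p) (Suc q)"
    and col_exact: "x \<in> C (Suc p) q \<Longrightarrow> (0 < q \<Longrightarrow> g (Suc p) (q - 1) x = 0) \<Longrightarrow> x \<in> g (Suc p) q ` C (Suc p) (Suc q)"
begin

lemma transpose: "double_complex scale (\<lambda>p q. C q p) (\<lambda>p q. g q p) (\<lambda>p q. f q p)"
proof (rule double_complex.intro[OF vector_space_axioms double_complex_axioms.intro], goal_cases)
  case 1 show ?case by (rule C)
next
  case 2 show ?case by (rule C)
next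
  case 3 show ?case by (rule linear_g)
next
  case 4 show ?case by (rule linear_f)
next
  case 5 then show ?case by (rule g_in)
next
  case 6 then show ?case by (rule f_in)
next
  case 7 then show ?case by (rule commute[symmetric])
next
  case 8 then show ?case by (rule gg)
next
  case 9 then show ?case by (rule ff)
next
  case 10 then show ?case by (rule col_exact)
next
  case 11 then show ?case by (rule row_exact)
qed

text \<open>
  The receptor and the donor of the salamander lemma. Along a row or column that is exact there,
  the differential induces an isomorphism from a donor to a receptor.
\<close>

definition receptor_dim :: "nat \<Rightarrow> nat \<Rightarrow> nat" where
  "receptor_dim p q =
     dim {x \<in> C p q. (0 < p \<longrightarrow> f (p - 1) q x = 0) \<and> (0 < q \<longrightarrow> g p (q - 1) x = 0)}
     - dim ((\<lambda>x. f p q (g (Suc p) q x)) ` C (Suc p) (Suc q))"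

definition donor_dim :: "nat \<Rightarrow> nat \<Rightarrow> nat" where
  "donor_dim p q =
     dim {x \<in> C (Suc p) (Suc q). f p q (g (Suc p) q x) = 0}
     - dim {x + y |x y. x \<in> f (Suc p) (Suc q) ` C (Suc (Suc p)) (Suc q)
          \<and> y \<in> g (Suc p) (Suc q) ` C (Suc p) (Suc (Suc q))}"

text \<open>\<open>donor_dim p q\<close> belongs to the position \<open>(p + 1, q + 1)\<close>, and
  \<open>f\<close> maps this donor to the receptor at \<open>(p, q + 1)\<close>. Exactness of the
  \<open>f\<close>-complex at the receptor gives surjectivity, exactness at the donor gives
  injectivity.\<close>

lemma receptor_dim_eq_donor_dim: "receptor_dim p (Suc q) = donor_dim p q"
  unfolding receptor_dim_def donor_dim_def
proof (rule quotient_dim_eq[symmetric, of scale scale "f p (Suc q)"])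
  interpret f: Vector_Spaces.linear scale scale "f p q" for p q by (rule linear_f)
  interpret g: Vector_Spaces.linear scale scale "g p q" for p q by (rule linear_g)
  let ?X = "{x \<in> C (Suc p) (Suc q). f p q (g (Suc p) q x) = 0}"
  let ?Y = "{x + y |x y. x \<in> f (Suc p) (Suc q) ` C (Suc (Suc p)) (Suc q)
          \<and> y \<in> g (Suc p) (Suc q) ` C (Suc p) (Suc (Suc q))}"
  let ?X' = "{x \<in> C p (Suc q). (0 < p \<longrightarrow> f (p - 1) (Suc q) x = 0) \<and> (0 < Suc q \<longrightarrow> g p (Suc q - 1) x = 0)}"
  let ?Y' = "(\<lambda>x. f p (Suc q) (g (Suc p) (Suc q) x)) ` C (Suc p) (Suc (Suc q))"
  show "Vector_Spaces.linear scale scale (f p (Suc q))" by (rule linear_f)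
  show "subspace ?X" using C(1)[of "Suc p" "Suc q"]
    by (auto simp: subspace_def f.add g.add f.scale g.scale f.zero g.zero)
  show "fin_dim scale ?X" by (rule fin_dim_subset[OF C(2)[of "Suc p" "Suc q"]]) auto
  show "?Y \<subseteq> ?X"
  proof
    fix z assume "z \<in> ?Y"
    then obtain a b where ab: "a \<in> C (Suc (Suc p)) (Suc q)" "b \<in> C (Suc p) (Suc (Suc q))"
      "z = f (Suc p) (Suc q) a + g (Suc p) (Suc q) b" by blast
    then have "f p q (g (Suc p) q z) = 0"
      using commute[of a "Suc p" q] ff[OF g_in[OF ab(1)]] gg[OF ab(2)] by (simp add: f.add g.add f.zero)
    then show "z \<in> ?X" using ab f_in g_in subspace_add[OF C(1)] by simp
  qed
  show "subspace ?X'" using C(1)[of p "Suc q"]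
    by (auto simp: subspace_def f.add g.add f.scale g.scale f.zero g.zero)
  show "fin_dim scale ?X'" by (rule fin_dim_subset[OF C(2)[of p "Suc q"]]) auto
  show "subspace ?Y'"
  proof -
    have "?Y' = f p (Suc q) ` g (Suc p) (Suc q) ` C (Suc p) (Suc (Suc q))" by auto
    then show ?thesis using f.subspace_image g.subspace_image C(1) by simp
  qed
  show "?Y' \<subseteq> ?X'"
  proof
    fix z assume "z \<in> ?Y'"
    then obtain b where b: "b \<in> C (Suc p) (Suc (Suc q))" "z = f p (Suc q) (g (Suc p) (Suc q) b)" by blast
    have "f (p - 1) (Suc q) z = 0" if p0: "0 < p"
    proof -
      obtain p' where "p = Suc p'" using gr0_implies_Suc[OF p0] by blast
      then show ?thesis using ff[of "g (Suc p) (Suc q) b" p' "Suc q"] g_in[OF b(1)] b(2) by simp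
    qed
    moreover have "g p q z = 0"
      using commute[OF g_in[OF b(1)]] gg[OF b(1)] b(2) by (simp add: f.zero)
    ultimately show "z \<in> ?X'" using b f_in g_in by simp
  qed
  show "f p (Suc q) ` ?X \<subseteq> ?X'"
  proof
    fix z assume "z \<in> f p (Suc q) ` ?X"
    then obtain x where x: "x \<in> C (Suc p) (Suc q)" "f p q (g (Suc p) q x) = 0" "z = f p (Suc q) x" by blast
    have "f (p - 1) (Suc q) z = 0" if p0: "0 < p"
    proof -
      obtain p' where "p = Suc p'" using gr0_implies_Suc[OF p0] by blast
      then show ?thesis using ff[of x p' "Suc q"] x(1,3) by simp
    qed
    then show "z \<in> ?X'" using x f_in commute[OF x(1)] by simp
  qed
  show "\<exists>x\<in>?X. x' - f p (Suc q) x \<in> ?Y'" if x': "x' \<in> ?X'" for x'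
  proof -
    have "x' \<in> f p (Suc q) ` C (Suc p) (Suc q)" by (rule row_exact) (use x' in auto)
    then obtain x where x: "x \<in> C (Suc p) (Suc q)" "x' = f p (Suc q) x" by blast
    have "0 \<in> ?Y'"
      using subspace_0[OF C(1), of "Suc p" "Suc (Suc q)"]
      by (intro image_eqI[of _ _ 0]) (simp_all add: f.zero g.zero)
    then show ?thesis using x x' commute[OF x(1)] by (intro bexI[of _ x]) auto
  qed
  show "f p (Suc q) x \<in> ?Y' \<longleftrightarrow> x \<in> ?Y" if x: "x \<in> ?X" for x
  proof
    assume "f p (Suc q) x \<in> ?Y'"
    then obtain b where b: "b \<in> C (Suc p) (Suc (Suc q))" "f p (Suc q) x = f p (Suc q) (g (Suc p) (Suc q) b)" by blast
    then have "f p (Suc q) (x - g (Suc p) (Suc q) b) = 0" by (simp add: f.diff)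
    moreover have "x - g (Suc p) (Suc q) b \<in> C (Suc p) (Suc q)" using x g_in[OF b(1)] subspace_diff[OF C(1)] by simp
    ultimately have "x - g (Suc p) (Suc q) b \<in> f (Suc p) (Suc q) ` C (Suc (Suc p)) (Suc q)"
      using row_exact[of "x - g (Suc p) (Suc q) b" "Suc p" q] by simp
    moreover have "x = (x - g (Suc p) (Suc q) b) + g (Suc p) (Suc q) b" by simp
    ultimately show "x \<in> ?Y" using imageI[OF b(1)] unfolding mem_Collect_eq by (intro exI conjI)
  next
    assume "x \<in> ?Y"
    then obtain a b where ab: "a \<in> C (Suc (Suc p)) (Suc q)" "b \<in> C (Suc p) (Suc (Suc q))"
      "x = f (Suc p) (Suc q) a + g (Suc p) (Suc q) b" by blast
    then have "f p (Suc q) x = f p (Suc q) (g (Suc p) (Suc q) b)" using ff[OF ab(1)] by (simp add: f.add)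
    then show "f p (Suc q) x \<in> ?Y'" by (rule image_eqI) (rule ab(2))
  qed
qed

lemma transpose_receptor_dim:
  "double_complex.receptor_dim scale (\<lambda>p q. C q p) (\<lambda>p q. g q p) (\<lambda>p q. f q p) p q = receptor_dim q p"
proof -
  have "(\<lambda>x. g q p (f q (Suc p) x)) ` C (Suc q) (Suc p) = (\<lambda>x. f q p (g (Suc q) p x)) ` C (Suc q) (Suc p)"
    by (rule image_cong) (simp_all add: commute)
  then show ?thesis
    unfolding receptor_dim_def double_complex.receptor_dim_def[OF transpose]
    by (simp add: conj_commute)
qed

lemma transpose_donor_dim:
  "double_complex.donor_dim scale (\<lambda>p q. C q p) (\<lambda>p q. g q p) (\<lambda>p q. f q p) p q = donor_dim q p"
proof -
  have "{x \<in> C (Suc q) (Suc p). g q p (f q (Suc p) x) = 0} = {x \<in> C (Suc q) (Suc p). f q p (g (Suc q) p x) = 0}"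
    by (rule Collect_cong) (metis commute)
  moreover have "{x + y |x y. x \<in> A \<and> y \<in> B} = {x + y |x y. x \<in> B \<and> y \<in> A}" for A B :: "'b set"
    by (rule Collect_cong) (metis add.commute)
  ultimately show ?thesis
    unfolding donor_dim_def double_complex.donor_dim_def[OF transpose] by simp
qed

text \<open>Both receptors are identified with the donor at \<open>(p + 1, q + 1)\<close>, one along
  \<open>f\<close> and the other along \<open>g\<close>.\<close>

lemma receptor_dim_diagonal: "receptor_dim p (Suc q) = receptor_dim (Suc p) q"
  using receptor_dim_eq_donor_dim[of p q] transpose_receptor_dim[of q "Suc p"] transpose_donor_dim[of q p]
    double_complex.receptor_dim_eq_donor_dim[OF transpose, of q p] by simp

lemma receptor_dim_antidiagonal: "receptor_dim 0 (p + q) = receptor_dim p q"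
proof (induction p arbitrary: q)
  case (Suc p)
  show ?case using Suc.IH[of "Suc q"] receptor_dim_diagonal by simp
qed simp

text \<open>On the edge \<open>p = 0\<close> the incoming \<open>f\<close> is onto, so the image of
  the diagonal map is the image of \<open>g\<close>, and the receptor is ordinary homology.\<close>

lemma receptor_dim_left:
  "receptor_dim 0 (Suc q) = dim {x \<in> C 0 (Suc q). g 0 q x = 0} - dim (g 0 (Suc q) ` C 0 (Suc (Suc q)))"
proof -
  have "(\<lambda>x. f 0 (Suc q) (g (Suc 0) (Suc q) x)) ` C (Suc 0) (Suc (Suc q))
    = g 0 (Suc q) ` f 0 (Suc (Suc q)) ` C (Suc 0) (Suc (Suc q))"
    unfolding image_image by (rule image_cong) (simp_all add: commute)
  also have "f 0 (Suc (Suc q)) ` C (Suc 0) (Suc (Suc q)) = C 0 (Suc (Suc q))"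
    using row_exact[of _ 0 "Suc q"] f_in by auto
  finally show ?thesis unfolding receptor_dim_def by simp
qed

text \<open>The two sides are the receptors at \<open>(0, i + 1)\<close> and
  \<open>(i + 1, 0)\<close>, the ends of one antidiagonal.\<close>

theorem left_homology_eq_bottom_homology:
  "dim {x \<in> C 0 (Suc i). g 0 i x = 0} - dim (g 0 (Suc i) ` C 0 (Suc (Suc i)))
   = dim {x \<in> C (Suc i) 0. f i 0 x = 0} - dim (f (Suc i) 0 ` C (Suc (Suc i)) 0)"
  using receptor_dim_left[of i] receptor_dim_antidiagonal[of "Suc i" 0]
    double_complex.receptor_dim_left[OF transpose, of i] transpose_receptor_dim[of 0 "Suc i"]
  by simp

end

section \<open>Families of polynomials\<close>

text \<open>A product of spaces, realised by total functions whose value off \<open>J\<close> is 0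
  rather than arbitrary, which makes it a linear subspace.\<close>

definition funs :: "'a set \<Rightarrow> ('a \<Rightarrow> 'k::field mpoly set) \<Rightarrow> ('a \<Rightarrow> 'k mpoly) set" where
  "funs J V = {v. \<forall>i. if i \<in> J then v i \<in> V i else v i = 0}"

lemma funsI: "(\<And>i. i \<in> J \<Longrightarrow> v i \<in> V i) \<Longrightarrow> (\<And>i. i \<notin> J \<Longrightarrow> v i = 0) \<Longrightarrow> v \<in> funs J V"
  by (simp add: funs_def)

lemma funs_in: "v \<in> funs J V \<Longrightarrow> i \<in> J \<Longrightarrow> v i \<in> V i"
  unfolding funs_def by (metis (mono_tags, lifting) mem_Collect_eq)

lemma funs_out: "v \<in> funs J V \<Longrightarrow> i \<notin> J \<Longrightarrow> v i = 0"
  unfolding funs_def by (metis (mono_tags, lifting) mem_Collect_eq)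

lemma subspace_funs:
  assumes "\<And>i. i \<in> J \<Longrightarrow> pvec.subspace (V i)"
  shows "fvec.subspace (funs J V)"
  using assms unfolding fvec.subspace_def funs_def pvec.subspace_def by auto

lemma linear_delta: "Vector_Spaces.linear pscale fscale (\<lambda>p i. if i = j then p else (0 :: 'k::field mpoly))"
  by unfold_locales auto

lemma linear_eval: "Vector_Spaces.linear fscale pscale (\<lambda>v. v j)"
  by unfold_locales auto

lemma fin_dim_funs:
  assumes "finite J" "\<And>i. i \<in> J \<Longrightarrow> fin_dim pscale (V i)"
  shows "fin_dim fscale (funs J V)"
  using assms
proof (induction J)
  case empty
  have "funs {} V \<subseteq> fvec.span {}" unfolding fvec.span_empty by (auto simp: funs_def fun_eq_iff)
  then show ?case unfolding fin_dim_def using finite.emptyI by blast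
next
  case (insert j J)
  let ?d = "\<lambda>p i. if i = j then p else 0"
  have "funs (insert j J) V \<subseteq> {x + y |x y. x \<in> funs J V \<and> y \<in> ?d ` V j}"
  proof
    fix v assume v: "v \<in> funs (insert j J) V"
    have "v = v(j := 0) + ?d (v j)" by (simp add: fun_eq_iff)
    moreover have "v(j := 0) \<in> funs J V"
    proof (rule funsI)
      show "(v(j := 0)) i \<in> V i" if "i \<in> J" for i using that insert.hyps(2) funs_in[OF v, of i] by auto
      show "(v(j := 0)) i = 0" if "i \<notin> J" for i using that funs_out[OF v, of i] by auto
    qed
    moreover have "v j \<in> V j" using v by (rule funs_in) simp
    ultimately show "v \<in> {x + y |x y. x \<in> funs J V \<and> y \<in> ?d ` V j}" by blast
  qed
  moreover have "fin_dim fscale (?d ` V j)"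
    by (rule fin_dim_linear_image[OF linear_delta]) (simp add: insert.prems)
  moreover have "fin_dim fscale (funs J V)" by (rule insert.IH) (simp add: insert.prems)
  ultimately show ?case 
    using fvec.fin_dim_subset[OF fvec.fin_dim_sums, of "funs J V" "?d ` V j"] by blast
qed

lemma dim_funs:
  fixes V :: "'k::field mpoly set" and J :: "'a set"
  assumes "finite J" "pvec.subspace V" "fin_dim pscale V"
  shows "fvec.dim (funs J (\<lambda>_. V)) = card J * pvec.dim V"
  using assms(1)
proof (induction J)
  case empty
  have "funs ({} :: 'a set) (\<lambda>_. V) = fvec.span {}" unfolding fvec.span_empty by (auto simp: funs_def fun_eq_iff)
  then show ?case by (simp only: fvec.dim_span_eq_card_independent[OF fvec.independent_empty] card.empty mult_0)
next
  case (insert j J)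
  have "fvec.dim (funs (insert j J) (\<lambda>_. V))
     = fvec.dim {v \<in> funs (insert j J) (\<lambda>_. V). v j = 0} + pvec.dim ((\<lambda>v. v j) ` funs (insert j J) (\<lambda>_. V))"
    by (rule rank_nullity[OF linear_eval subspace_funs fin_dim_funs]) (use assms insert.hyps in simp_all)
  moreover have "{v \<in> funs (insert j J) (\<lambda>_. V). v j = 0} = funs J (\<lambda>_. V)"
  proof (intro equalityI subsetI)
    fix v assume v: "v \<in> {v \<in> funs (insert j J) (\<lambda>_. V). v j = 0}"
    show "v \<in> funs J (\<lambda>_. V)"
    proof (rule funsI)
      show "v i \<in> V" if "i \<in> J" for i using v that funs_in[of v "insert j J" "\<lambda>_. V" i] by simp
      show "v i = 0" if "i \<notin> J" for i using v that funs_out[of v "insert j J" "\<lambda>_. V" i] by (cases "i = j") simp_all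
    qed
  next
    fix v assume v: "v \<in> funs J (\<lambda>_. V)"
    have "v j = 0" using funs_out[OF v] insert.hyps(2) .
    moreover have "v \<in> funs (insert j J) (\<lambda>_. V)"
    proof (rule funsI)
      show "v i \<in> V" if "i \<in> insert j J" for i
        using that funs_in[OF v, of i] \<open>v j = 0\<close> pvec.subspace_0[OF assms(2)] by (cases "i = j") simp_all
      show "v i = 0" if "i \<notin> insert j J" for i using that funs_out[OF v, of i] by simp
    qed
    ultimately show "v \<in> {v \<in> funs (insert j J) (\<lambda>_. V). v j = 0}" by simp
  qed
  moreover have "(\<lambda>v. v j) ` funs (insert j J) (\<lambda>_. V) = V"
  proof
    show "V \<subseteq> (\<lambda>v. v j) ` funs (insert j J) (\<lambda>_. V)"
    proof
      fix p assume "p \<in> V"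
      then have "(\<lambda>i. if i = j then p else 0 :: 'k mpoly) \<in> funs (insert j J) (\<lambda>_. V)"
        using pvec.subspace_0[OF assms(2)] by (intro funsI) simp_all
      then show "p \<in> (\<lambda>v. v j) ` funs (insert j J) (\<lambda>_. V)" by (rule rev_image_eqI) simp
    qed
    show "(\<lambda>v. v j) ` funs (insert j J) (\<lambda>_. V) \<subseteq> V"
    proof (rule image_subsetI)
      fix v assume "v \<in> funs (insert j J) (\<lambda>_. V)"
      from funs_in[OF this, of j] show "v j \<in> V" by simp
    qed
  qed
  ultimately show ?case using insert by simp
qed

section \<open>Betti numbers and Koszul cycles\<close>

lemma sum_fun_apply: "(\<Sum>m\<in>M. h m) l = (\<Sum>m\<in>M. h m l)"
  by (induction M rule: infinite_finite_induct) simp_all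

lemma kos_add_apply: "kos n (\<lambda>A. y A + z A) B = kos n y B + kos n z B"
  using fun_cong[OF kos_add[of n y z], of B] by (simp add: plus_fun_def)

lemma kvec_fin_dim: "fin_dim (\<lambda>(c::'k::field) (v::nat \<Rightarrow> 'k) l. c * v l) {c. \<forall>l. c l \<noteq> 0 \<longrightarrow> l < r}"
proof -
  let ?B = "(\<lambda>m l. if l = m then 1 else 0 :: 'k) ` {..<r}"
  have "c \<in> kvec.span ?B" if "\<forall>l. c l \<noteq> 0 \<longrightarrow> l < r" for c
  proof -
    have "c = (\<Sum>m<r. (\<lambda>l. c m * (if l = m then 1 else 0)))"
    proof
      fix l
      have "(\<Sum>m<r. (\<lambda>l. c m * (if l = m then 1 else 0))) l = (\<Sum>m<r. if l = m then c m else 0)"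
        by (simp add: sum_fun_apply if_distrib cong: if_cong)
      also have "\<dots> = c l" using that by auto
      finally show "c l = (\<Sum>m<r. (\<lambda>l. c m * (if l = m then 1 else 0))) l" ..
    qed
    also have "\<dots> \<in> kvec.span ?B"
      by (intro kvec.span_sum kvec.span_scale kvec.span_base) simp
    finally show ?thesis .
  qed
  then show ?thesis unfolding fin_dim_def by (intro exI[of _ ?B]) auto
qed

text \<open>
  Row \<open>p + 1\<close> of the double complex is the Koszul complex tensored with \<open>F\<^sub>p\<close>, in total degree \<open>e\<close>;
  row \<open>0\<close> is the Koszul complex tensored with the ideal, and column \<open>0\<close> is the complex tensored
  with \<open>K\<close>. The index \<open>(l, A)\<close> stands for the \<open>l\<close>-th basis vector of \<open>F\<^sub>p\<close> times the wedge with index set \<open>A\<close>.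
\<close>

locale ideal_resolution =
  fixes n :: nat and I :: "'k::field mpoly set" and F :: "'k free_complex" and e :: nat
  assumes I: "graded_ideal n I" and F: "graded_free_resolution n I F"
begin

definition rk :: "nat \<Rightarrow> nat" where
  "rk p = (case p of 0 \<Rightarrow> 1 | Suc p' \<Rightarrow> frank F p')"

definition shf :: "nat \<Rightarrow> nat \<Rightarrow> nat" where
  "shf p l = (case p of 0 \<Rightarrow> 0 | Suc p' \<Rightarrow> shifts F p' ! l)"

definition mat :: "nat \<Rightarrow> nat \<Rightarrow> nat \<Rightarrow> 'k mpoly" where
  "mat p l m = (case p of 0 \<Rightarrow> aug F m | Suc p' \<Rightarrow> diff F p' l m)"

text \<open>The second index is shifted: \<open>q' + 1\<close> is exterior degree \<open>q'\<close>,
  whereas \<open>q = 0\<close> is the tensor product with K, which lives in internal degree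
  \<open>e\<close> alone. The inequality with \<open>e\<close> removes components of negative
  degree, for which the truncated subtraction in \<open>val\<close> would give degree 0. The corner
  \<open>(0, 0)\<close> is empty, so that no map into it cuts down Tor in degree 0.\<close>

definition idx :: "nat \<Rightarrow> nat \<Rightarrow> (nat \<times> nat set) set" where
  "idx p q = (case q of
      0 \<Rightarrow> {(l, A). 0 < p \<and> l < rk p \<and> shf p l = e \<and> A = {}}
    | Suc q' \<Rightarrow> {(l, A). l < rk p \<and> A \<subseteq> {..<n} \<and> card A = q' \<and> shf p l + q' \<le> e})"

definition val :: "nat \<Rightarrow> nat \<times> nat set \<Rightarrow> 'k mpoly set" where
  "val p i = hpolys n (e - shf p (fst i) - card (snd i)) \<inter> (if p = 0 then I else UNIV)"

definition C :: "nat \<Rightarrow> nat \<Rightarrow> (nat \<times> nat set \<Rightarrow> 'k mpoly) set" where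
  "C p q = funs (idx p q) (val p)"

definition matq :: "nat \<Rightarrow> nat \<Rightarrow> nat \<Rightarrow> nat \<Rightarrow> 'k mpoly" where
  "matq p q l m = (if q = 0 then cst (mcoeff (mat p l m) 0) else mat p l m)"

definition active :: "nat \<Rightarrow> nat \<Rightarrow> nat \<Rightarrow> bool" where
  "active p q l \<longleftrightarrow> (0 < p \<or> 0 < q) \<and> l < rk p"

definition f :: "nat \<Rightarrow> nat \<Rightarrow> (nat \<times> nat set \<Rightarrow> 'k mpoly) \<Rightarrow> nat \<times> nat set \<Rightarrow> 'k mpoly" where
  "f p q v i = (if active p q (fst i) then \<Sum>m<rk (Suc p). matq p q (fst i) m * v (m, snd i) else 0)"

definition g :: "nat \<Rightarrow> nat \<Rightarrow> (nat \<times> nat set \<Rightarrow> 'k mpoly) \<Rightarrow> nat \<times> nat set \<Rightarrow> 'k mpoly" where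
  "g p q v i = (case q of
      0 \<Rightarrow> (if p = 0 \<or> snd i \<noteq> {} then 0 else cst (mcoeff (v i) 0))
    | Suc q' \<Rightarrow> kos n (\<lambda>A. v (fst i, A)) (snd i))"

section \<open>Degrees of the matrix entries and closure under the maps\<close>

lemma is_ideal_I: "is_ideal n I" using I by (simp add: graded_ideal_def)

lemma I_closed: "0 \<in> I" "p \<in> I \<Longrightarrow> q \<in> I \<Longrightarrow> p + q \<in> I" "s \<in> polys n \<Longrightarrow> p \<in> I \<Longrightarrow> s * p \<in> I"
  and I_polys: "p \<in> I \<Longrightarrow> p \<in> polys n"
  using is_ideal_I by (auto simp: is_ideal_def)

lemma I_sum: "(\<And>i. i \<in> J \<Longrightarrow> h i \<in> I) \<Longrightarrow> sum h J \<in> I"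
  by (induction J rule: infinite_finite_induct) (auto simp: I_closed)

lemma mat_in:
  assumes "l < rk p" "m < rk (Suc p)"
  shows "mat p l m \<in> polys n" "a \<in> Poly_Mapping.keys (mat p l m) \<Longrightarrow> shf p l + mdeg a = shf (Suc p) m"
  using assms F unfolding graded_free_resolution_def mat_def rk_def shf_def homogeneous_def
  by (auto split: nat.splits)

lemma mat_hpolys:
  assumes "l < rk p" "m < rk (Suc p)" "shf p l \<le> shf (Suc p) m"
  shows "mat p l m \<in> hpolys n (shf (Suc p) m - shf p l)"
  using mat_in[OF assms(1,2)] assms(3) unfolding hpolys_iff homogeneous_def by fastforce

lemma mat_zero:
  assumes "l < rk p" "m < rk (Suc p)" "\<not> shf p l \<le> shf (Suc p) m"
  shows "mat p l m = 0"
  using mat_in(2)[OF assms(1,2)] assms(3) by (metis le_add1 keys_eq_empty ex_in_conv)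

lemma coeff_mat_0:
  assumes "l < rk p" "m < rk (Suc p)" "shf p l \<noteq> shf (Suc p) m"
  shows "mcoeff (mat p l m) 0 = 0"
  using mat_in(2)[OF assms(1,2), of 0] assms(3) by (auto simp: in_keys_iff)

lemma subspace_val: "pvec.subspace (val p i)"
  using subspace_hpolys[of n] I_closed cst_in_polys by (auto simp: val_def pvec.subspace_def)

lemma fin_dim_val: "fin_dim pscale (val p i)"
  by (rule pvec.fin_dim_subset[OF fin_dim_hpolys[of n "e - shf p (fst i) - card (snd i)"]]) (auto simp: val_def)

lemma finite_idx: "finite (idx p q)"
proof (rule finite_subset)
  show "idx p q \<subseteq> {..<rk p} \<times> Pow {..<n}" by (auto simp: idx_def split: nat.splits)
qed auto

lemma subspace_C: "fvec.subspace (C p q)"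
  unfolding C_def by (rule subspace_funs) (rule subspace_val)

lemma fin_dim_C: "fin_dim fscale (C p q)"
  unfolding C_def by (rule fin_dim_funs) (rule finite_idx, rule fin_dim_val)

lemma linear_f: "Vector_Spaces.linear fscale fscale (f p q)"
  by (rule linear_ffI)
    (simp_all add: f_def fun_eq_iff distrib_left sum.distrib sum_distrib_left mult.left_commute)

lemma linear_g: "Vector_Spaces.linear fscale fscale (g p q)"
proof (rule linear_ffI)
  show "g p q (x + y) = g p q x + g p q y" for x y
    by (auto simp: g_def fun_eq_iff lookup_add single_add kos_add_apply split: nat.splits)
  show "g p q (fscale c x) = fscale c (g p q x)" for c x
    by (auto simp: g_def fun_eq_iff kos_scale cst_mult split: nat.splits)
qed

lemma C_in:
  assumes "v \<in> C p q" "i \<in> idx p q"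
  shows "v i \<in> hpolys n (e - shf p (fst i) - card (snd i))" "p = 0 \<Longrightarrow> v i \<in> I"
  using funs_in[of v "idx p q" "val p" i] assms by (auto simp: C_def val_def)

lemma C_out: "v \<in> C p q \<Longrightarrow> i \<notin> idx p q \<Longrightarrow> v i = 0"
  unfolding C_def by (rule funs_out)

lemma C_polys: "v \<in> C p q \<Longrightarrow> v i \<in> polys n"
  using C_in(1)[of v p q i] C_out[of v p q i] hpolys_subset_polys by (cases "i \<in> idx p q") auto

lemma CI:
  assumes "\<And>l A. (l, A) \<in> idx p q \<Longrightarrow> v (l, A) \<in> hpolys n (e - shf p l - card A)"
    "\<And>l A. (l, A) \<in> idx p q \<Longrightarrow> p = 0 \<Longrightarrow> v (l, A) \<in> I"
    "\<And>l A. (l, A) \<notin> idx p q \<Longrightarrow> v (l, A) = 0"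
  shows "v \<in> C p q"
  unfolding C_def using assms by (intro funsI) (auto simp: val_def)

lemma C_0_0: "C 0 0 = {0}"
  by (auto simp: C_def funs_def idx_def fun_eq_iff)

text \<open>The degree of an entry is the difference of two shifts, so products get the degree
  prescribed in the target. Entries of negative degree vanish, and for \<open>q = 0\<close> constant
  coefficients link equal shifts only; hence no product leaves the index set.\<close>

lemma f_in:
  assumes v: "v \<in> C (Suc p) q"
  shows "f p q v \<in> C p q"
proof (cases "p = 0 \<and> q = 0")
  case True
  then show ?thesis by (simp add: C_0_0 f_def fun_eq_iff active_def)
next
  case False
  have idx_step: "(m, A) \<in> idx (Suc p) q \<Longrightarrow> l < rk p \<Longrightarrow> shf p l \<le> shf (Suc p) m \<Longrightarrow> q > 0 \<Longrightarrow> (l, A) \<in> idx p q" for l m A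
    by (cases q) (auto simp: idx_def)
  have idx_step0: "(m, A) \<in> idx (Suc p) 0 \<Longrightarrow> l < rk p \<Longrightarrow> shf p l = shf (Suc p) m \<Longrightarrow> p > 0 \<Longrightarrow> (l, A) \<in> idx p 0" for l m A
    by (auto simp: idx_def)
  have idx_rk: "(l, A) \<in> idx p' q' \<Longrightarrow> l < rk p'" for l A p' q' by (auto simp: idx_def split: nat.splits)
  have idx_le: "(l, A) \<in> idx p' q' \<Longrightarrow> shf p' l + card A \<le> e" for l A p' q' by (auto simp: idx_def split: nat.splits)
  have summand: "matq p q l m * v (m, A) \<in> hpolys n (e - shf p l - card A)
      \<and> ((l, A) \<notin> idx p q \<longrightarrow> matq p q l m * v (m, A) = 0)" if "l < rk p" "m < rk (Suc p)" for l m A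
  proof (cases "(m, A) \<in> idx (Suc p) q \<and> matq p q l m \<noteq> 0")
    case True
    then have vm: "v (m, A) \<in> hpolys n (e - shf (Suc p) m - card A)" using C_in(1)[OF v] by auto
    show ?thesis
    proof (cases "q = 0")
      case q: True
      then have sh: "shf p l = shf (Suc p) m" using True coeff_mat_0[OF that] by (auto simp: matq_def)
      have "(l, A) \<in> idx p q" using idx_step0[of m A l] True q False that sh by auto
      moreover have "matq p q l m * v (m, A) \<in> hpolys n (e - shf p l - card A)"
        using mult_in_hpolys[OF cst_in_hpolys vm] q sh by (simp add: matq_def)
      ultimately show ?thesis by blast
    next
      case q: False
      then have m: "matq p q l m = mat p l m" by (simp add: matq_def)
      then have sh: "shf p l \<le> shf (Suc p) m" using True mat_zero[OF that] by auto
      have "(l, A) \<in> idx p q" using idx_step[of m A l] True q that sh by auto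
      moreover have "shf (Suc p) m - shf p l + (e - shf (Suc p) m - card A) = e - shf p l - card A"
        using sh idx_le[of m A "Suc p" q] True by linarith
      ultimately show ?thesis using mult_in_hpolys[OF mat_hpolys[OF that sh] vm] m by simp
    qed
  qed (use C_out[OF v] in auto)
  show ?thesis
  proof (rule CI)
    fix l A assume i: "(l, A) \<in> idx p q"
    show "f p q v (l, A) \<in> hpolys n (e - shf p l - card A)"
      unfolding f_def active_def using False idx_rk[OF i] summand by (auto intro!: sum_in_hpolys)
    show "f p q v (l, A) \<in> I" if p: "p = 0"
    proof -
      \<comment> \<open>The entries of the augmentation are images of basis vectors and lie in
        \<open>I\<close>.\<close>
      have "mat 0 l m \<in> I" if "m < rk (Suc 0)" for m
      proof -
        have "(\<lambda>l. if l = m then 1 else 0) \<in> free_module n (frank F 0)"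
          using that cst_in_polys[of 1 n] by (auto simp: free_module_def rk_def)
        moreover have "aug_map F (\<lambda>l. if l = m then 1 else 0) = aug F m"
          using that by (simp add: aug_map_def rk_def if_distrib cong: if_cong)
        moreover have "aug_map F ` free_module n (frank F 0) = I"
          using F unfolding graded_free_resolution_def by (elim conjE)
        ultimately have "aug F m \<in> I" by (metis imageI)
        then show ?thesis by (simp add: mat_def)
      qed
      then have "mat 0 l m * v (m, A) \<in> I" if "m < rk (Suc 0)" for m
      proof -
        have "v (m, A) * mat 0 l m \<in> I" by (rule I_closed(3)[OF C_polys[OF v]]) (rule \<open>\<And>m. m < rk (Suc 0) \<Longrightarrow> mat 0 l m \<in> I\<close>[OF that])
        then show ?thesis by (simp only: mult.commute)
      qed
      then show ?thesis using p False idx_rk[OF i] by (auto simp: f_def active_def matq_def intro!: I_sum)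
    qed
  next
    fix l A assume i: "(l, A) \<notin> idx p q"
    then show "f p q v (l, A) = 0" unfolding f_def active_def using summand by (auto intro!: sum.neutral)
  qed
qed

lemma g_in:
  assumes v: "v \<in> C p (Suc q)"
  shows "g p q v \<in> C p q"
proof (cases q)
  case 0
  have idx1: "(l, {}) \<in> idx p (Suc 0) \<longleftrightarrow> l < rk p \<and> shf p l \<le> e" for l
    by (auto simp: idx_def)
  show ?thesis
  proof (rule CI)
    fix l A assume "(l, A) \<in> idx p q"
    then show "g p q v (l, A) \<in> hpolys n (e - shf p l - card A)" by (auto simp: idx_def g_def 0)
  next
    fix l A assume "(l, A) \<in> idx p q" "p = 0" then show "g p q v (l, A) \<in> I" by (simp add: idx_def 0)
  next
    fix l A assume nidx: "(l, A) \<notin> idx p q"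
    show "g p q v (l, A) = 0"
    proof (cases "p > 0 \<and> A = {} \<and> (l, {}) \<in> idx p (Suc 0)")
      case True
      then have "shf p l < e" using nidx 0 idx1 by (auto simp: idx_def)
      moreover have "v (l, {}) \<in> hpolys n (e - shf p l)" using C_in(1)[OF v, of "(l, {})"] True 0 by simp
      ultimately have "mcoeff (v (l, {})) 0 = 0" by (auto simp: hpolys_def hmons_def in_keys_iff subset_iff)
      then show ?thesis using True by (simp add: g_def 0)
    next
      case False
      then show ?thesis using C_out[OF v, of "(l, {})"] 0 by (auto simp: g_def)
    qed
  qed
next
  case (Suc q')
  have ix: "(l, insert j A) \<in> idx p (Suc q) \<longleftrightarrow> (l, A) \<in> idx p q \<and> shf p l + card A + 1 \<le> e" if "j < n" "j \<notin> A" for l j A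
  proof (cases "finite A")
    case True
    then show ?thesis using that by (auto simp: idx_def Suc)
  next
    case False
    then have "\<not> A \<subseteq> {..<n}" using finite_subset by blast
    then show ?thesis by (auto simp: idx_def Suc)
  qed
  have card_ix: "(l, A) \<in> idx p q \<Longrightarrow> finite A" for l A
    using finite_subset[of A "{..<n}"] by (auto simp: idx_def Suc)
  have summand: "var j * contract j (\<lambda>A. v (l, A)) A \<in> hpolys n (e - shf p l - card A)
     \<and> ((l, A) \<notin> idx p q \<longrightarrow> var j * contract j (\<lambda>A. v (l, A)) A = 0)
     \<and> (p = 0 \<longrightarrow> var j * contract j (\<lambda>A. v (l, A)) A \<in> I)" if j: "j < n" for j l A
  proof (cases "j \<notin> A \<and> (l, insert j A) \<in> idx p (Suc q)")
    case True
    then have lA: "(l, A) \<in> idx p q" "shf p l + card A + 1 \<le> e" using ix j by auto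
    have *: "v (l, insert j A) \<in> hpolys n (e - shf p l - card A - 1)"
      using C_in(1)[OF v, of "(l, insert j A)"] True card_ix[OF lA(1)] by (simp add: diff_diff_left)
    have "ksign j A * v (l, insert j A) \<in> hpolys n (e - shf p l - card A - 1)"
      using ksign_cases[of j A, where ?'a = 'k] *
        pvec.subspace_neg[OF subspace_hpolys *] by (metis mult_1 mult_minus1)
    then have "var j * (ksign j A * v (l, insert j A)) \<in> hpolys n (1 + (e - shf p l - card A - 1))"
      using mult_in_hpolys var_in_hpolys[OF j] by blast
    moreover have "1 + (e - shf p l - card A - 1) = e - shf p l - card A" using lA(2) by linarith
    moreover have "var j * ksign j A * v (l, insert j A) \<in> I" if "p = 0"
    proof -
      have "ksign j A \<in> polys n" unfolding ksign_def
        by (metis cst_in_polys ksign_cases ksign_def single_one single_uminus)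
      then show ?thesis
        using I_closed(3)[OF mult_in_polys C_in(2)[OF v _ that]] True hpolys_subset_polys[OF var_in_hpolys[OF j]] by blast
    qed
    ultimately show ?thesis using True lA by (simp add: contract_def mult.assoc)
  next
    case False
    then have "contract j (\<lambda>A. v (l, A)) A = 0" using C_out[OF v] by (auto simp: contract_def)
    then show ?thesis using I_closed(1) by simp
  qed
  show ?thesis
  proof (rule CI)
    fix l A
    show "g p q v (l, A) \<in> hpolys n (e - shf p l - card A)"
      using summand by (auto simp: g_def Suc kos_def intro!: sum_in_hpolys)
    show "p = 0 \<Longrightarrow> g p q v (l, A) \<in> I" using summand by (auto simp: g_def Suc kos_def intro!: I_sum)
    show "(l, A) \<notin> idx p q \<Longrightarrow> g p q v (l, A) = 0" using summand by (auto simp: g_def Suc kos_def intro!: sum.neutral)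
  qed
qed

end

lemma nonzero_coeff: "p \<noteq> 0 \<Longrightarrow> \<exists>b. mcoeff p b \<noteq> 0"
  by (metis lookup_zero poly_mapping_eqI)

lemma kos_linear_combination:
  "kos n (\<lambda>A. \<Sum>m\<in>M. c m * y m A) B = (\<Sum>m\<in>M. c m * kos n (y m) B)"
proof -
  have "kos n (\<lambda>A. \<Sum>m\<in>M. c m * y m A) B = (\<Sum>l<n. \<Sum>m\<in>M. c m * (var l * contract l (y m) B))"
    unfolding kos_def contract_sum contract_scale by (simp add: sum_distrib_left mult.left_commute)
  also have "\<dots> = (\<Sum>m\<in>M. c m * kos n (y m) B)"
    unfolding kos_def sum_distrib_left by (rule sum.swap)
  finally show ?thesis .
qed

section \<open>Exactness in both directions\<close>

context ideal_resolution begin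

lemma single_eq_iff [simp]: "Poly_Mapping.single a c = Poly_Mapping.single a d \<longleftrightarrow> c = d"
  by (metis lookup_single_eq)

lemma free_module_slice: "v \<in> C p q \<Longrightarrow> (\<lambda>l. if l < r then v (l, A) else 0) \<in> free_module n r"
  using C_polys by (auto simp: free_module_def)

lemma mat_composition:
  assumes w: "w \<in> free_module n (rk (Suc (Suc p)))" and l: "l < rk p"
  shows "(\<Sum>m<rk (Suc p). mat p l m * (\<Sum>r<rk (Suc (Suc p)). mat (Suc p) m r * w r)) = 0"
proof (cases p)
  case 0
  have "diff_map F 0 w \<in> diff_map F 0 ` free_module n (frank F 1)" using w by (simp add: rk_def 0)
  then have "aug_map F (diff_map F 0 w) = 0" using F unfolding graded_free_resolution_def by blast
  then show ?thesis by (simp add: aug_map_def diff_map_def mat_vec_def rk_def mat_def 0)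
next
  case (Suc p')
  have "diff_map F (Suc p') w \<in> diff_map F (Suc p') ` free_module n (frank F (Suc (Suc p')))"
    using w by (simp add: rk_def Suc)
  then have "diff_map F p' (diff_map F (Suc p') w) = (\<lambda>_. 0)" using F unfolding graded_free_resolution_def by blast
  from fun_cong[OF this, of l] show ?thesis using l by (simp add: diff_map_def mat_vec_def rk_def mat_def Suc)
qed

text \<open>With S in position 0 the augmented complex has one uniform exactness statement. At
  \<open>p = 0\<close> the cycle condition is replaced by membership in \<open>I\<close>, the image
  of the augmentation.\<close>

lemma mat_exact:
  assumes v: "v \<in> free_module n (rk p)" and "p = 0 \<Longrightarrow> v 0 \<in> I"
    and "\<And>p' l. p = Suc p' \<Longrightarrow> l < rk p' \<Longrightarrow> (\<Sum>m<rk p. mat p' l m * v m) = 0"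
  obtains w where "w \<in> free_module n (rk (Suc p))" "\<And>l. l < rk p \<Longrightarrow> v l = (\<Sum>m<rk (Suc p). mat p l m * w m)"
proof (cases p)
  case 0
  then have "v 0 \<in> aug_map F ` free_module n (frank F 0)"
    using assms(2) F unfolding graded_free_resolution_def by simp
  then obtain w where "w \<in> free_module n (frank F 0)" "v 0 = aug_map F w" by blast
  then show ?thesis using that[of w] by (simp add: 0 rk_def aug_map_def mat_def)
next
  case (Suc p')
  have "v \<in> diff_map F p' ` free_module n (frank F (Suc p'))"
  proof (cases p')
    case p'0: 0
    have "aug_map F v = 0" using assms(3)[OF Suc, of 0] by (simp add: p'0 Suc rk_def mat_def aug_map_def)
    then have "v \<in> {v \<in> free_module n (frank F 0). aug_map F v = 0}" using v by (simp add: Suc p'0 rk_def)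
    then show ?thesis using F p'0 unfolding graded_free_resolution_def by simp
  next
    case p's: (Suc p'')
    have "diff_map F p'' v l = 0" for l
      using assms(3)[OF Suc, of l] by (simp add: p's Suc rk_def mat_def diff_map_def mat_vec_def)
    then have "v \<in> {v \<in> free_module n (frank F (Suc p'')). diff_map F p'' v = (\<lambda>_. 0)}"
      using v by (simp add: Suc p's rk_def fun_eq_iff)
    then show ?thesis using F p's unfolding graded_free_resolution_def by simp
  qed
  then obtain w where "w \<in> free_module n (frank F (Suc p'))" "v = diff_map F p' w" by blast
  then show ?thesis using that[of w] by (simp add: Suc rk_def mat_def diff_map_def mat_vec_def)
qed

lemma cst_sum: "cst (\<Sum>m\<in>M. c m) = (\<Sum>m\<in>M. cst (c m))"
  by (induction M rule: infinite_finite_induct) (simp_all add: single_add)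

text \<open>For \<open>q = 0\<close> this is multiplicativity of constant coefficients, for
  \<open>q > 0\<close> linearity of the Koszul differential over S.\<close>

lemma commute: "f p q (g (Suc p) q x) = g p q (f p (Suc q) x)"
proof
  fix i :: "nat \<times> nat set"
  obtain l A where i: "i = (l, A)" by (cases i)
  show "f p q (g (Suc p) q x) i = g p q (f p (Suc q) x) i"
  proof (cases q)
    case 0
    show ?thesis
      by (simp add: i 0 f_def g_def active_def matq_def coeff_mult_0 lookup_sum cst_sum cst_mult)
  next
    case (Suc q')
    show ?thesis
      by (simp add: i Suc f_def g_def active_def matq_def kos_linear_combination)
  qed
qed

lemma gg: "g p q (g p (Suc q) x) = 0"
proof
  fix i :: "nat \<times> nat set"
  obtain l A where i: "i = (l, A)" by (cases i)
  show "g p q (g p (Suc q) x) i = 0 i"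
  proof (cases q)
    case 0
    have "mcoeff (kos n z {}) 0 = 0" for z :: "nat set \<Rightarrow> 'k mpoly"
    proof -
      have "mcoeff (var j :: 'k mpoly) 0 = 0" for j by (auto simp: lookup_single when_def poly_mapping_eq_iff fun_eq_iff)
      then show ?thesis by (simp add: kos_def lookup_sum coeff_mult_0)
    qed
    then show ?thesis by (simp add: i 0 g_def)
  next
    case (Suc q')
    show ?thesis using fun_cong[OF kos_kos[of n "\<lambda>A. x (l, A)"], of A] by (simp add: i Suc g_def)
  qed
qed

text \<open>A nonzero quotient forces \<open>j < n\<close> and positive degree, so the homotopy adds
  only admissible indices; it lowers the polynomial degree by one as it raises the exterior degree
  by one, and the total degree is kept.\<close>

lemma var_quot_in_hpolys:
  assumes "p \<in> hpolys n D" "var_quot j p \<noteq> 0"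
  shows "j < n" "D \<ge> 1" "var_quot j p \<in> hpolys n (D - 1)"
proof -
  have key: "b + mvar j \<in> hmons n D" if "mcoeff (var_quot j p) b \<noteq> 0" for b
    using that assms(1) by (auto simp: coeff_var_quot hpolys_def in_keys_iff subset_iff split: if_splits)
  obtain b where "mcoeff (var_quot j p) b \<noteq> 0" using nonzero_coeff[OF assms(2)] by blast
  from key[OF this] have b: "b + mvar j \<in> monomials n" "mdeg b + 1 = D" by (auto simp: hmons_def)
  show "D \<ge> 1" using b by simp
  show "j < n"
  proof (rule ccontr)
    assume "\<not> j < n"
    then have "expo (b + mvar j) j = 0" using b(1) unfolding monomials_iff by simp
    then show False by (simp add: lookup_add)
  qed
  have "b \<in> hmons n (D - 1)" if "mcoeff (var_quot j p) b \<noteq> 0" for b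
    using key[OF that] by (auto simp: hmons_def monomials_iff lookup_add)
  then show "var_quot j p \<in> hpolys n (D - 1)" by (auto simp: hpolys_def in_keys_iff)
qed

text \<open>For positive first index the \<open>g\<close>-complex is a sum of shifted Koszul
  resolutions of K. At \<open>q = 0\<close> constants lift to constant polynomials; for
  \<open>q > 0\<close> the preimage is given by \<open>kos_htpy\<close>.\<close>

lemma col_exact:
  assumes x: "x \<in> C (Suc p) q" and gx: "0 < q \<Longrightarrow> g (Suc p) (q - 1) x = 0"
  shows "x \<in> g (Suc p) q ` C (Suc p) (Suc q)"
proof (cases q)
  case 0
  define y where "y i = (if snd i = {} then x i else 0)" for i
  have y: "y \<in> C (Suc p) (Suc q)"
  proof (rule CI)
    fix l A
    show "y (l, A) \<in> hpolys n (e - shf (Suc p) l - card A)"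
    proof (cases "A = {}")
      case True
      then show ?thesis using C_in(1)[OF x, of "(l, A)"] C_out[OF x, of "(l, A)"]
        by (cases "(l, A) \<in> idx (Suc p) q") (simp_all add: y_def)
    qed (simp add: y_def)
    show "Suc p = 0 \<Longrightarrow> y (l, A) \<in> I" by simp
    assume "(l, A) \<notin> idx (Suc p) (Suc q)"
    then have "A = {} \<Longrightarrow> (l, A) \<notin> idx (Suc p) q" by (auto simp: idx_def 0)
    then show "y (l, A) = 0" using C_out[OF x, of "(l, A)"] by (auto simp: y_def)
  qed
  have "g (Suc p) q y = x"
  proof
    fix i :: "nat \<times> nat set"
    show "g (Suc p) q y i = x i"
    proof (cases "i \<in> idx (Suc p) q")
      case True
      then have "snd i = {}" "shf (Suc p) (fst i) = e" by (auto simp: idx_def 0)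
      moreover from this have "x i \<in> hpolys n 0" using C_in(1)[OF x True] by simp
      ultimately show ?thesis using hpolys_0_eq[of "x i" n] by (simp add: g_def 0 y_def)
    next
      case False
      then have "x i = 0" by (rule C_out[OF x])
      then show ?thesis by (simp add: g_def 0 y_def)
    qed
  qed
  then show ?thesis using y by blast
next
  case (Suc q')
  define z where "z l = (\<lambda>A. x (l, A))" for l
  have z_idx: "(l, A) \<in> idx (Suc p) q" if "z l A \<noteq> 0" for l A
    using that C_out[OF x, of "(l, A)"] by (auto simp: z_def)
  define y where "y i = kos_htpy (z (fst i)) (snd i)" for i
  have y: "y \<in> C (Suc p) (Suc q)"
  proof -
    have *: "(l, A) \<in> idx (Suc p) (Suc q) \<and> y (l, A) \<in> hpolys n (e - shf (Suc p) l - card A)"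
      if nz: "y (l, A) \<noteq> 0" for l A
    proof -
      have A: "A \<noteq> {}" "var_quot (Min A) (z l (A - {Min A})) \<noteq> 0" using nz by (auto simp: y_def kos_htpy_def split: if_splits)
      then have "z l (A - {Min A}) \<noteq> 0" by auto
      then have ix: "(l, A - {Min A}) \<in> idx (Suc p) q" by (rule z_idx)
      have zh: "z l (A - {Min A}) \<in> hpolys n (e - shf (Suc p) l - card (A - {Min A}))"
        using C_in(1)[OF x ix] by (simp add: z_def)
      note v = var_quot_in_hpolys[OF zh A(2)]
      have sub: "A - {Min A} \<subseteq> {..<n}" "card (A - {Min A}) = q'" "l < rk (Suc p)"
        using ix by (auto simp: idx_def Suc)
      then have fin: "finite A" using finite_subset by fastforce
      then have "Min A \<in> A" using A(1) by simp
      then have card: "card A = Suc q'" using card_Suc_Diff1[OF fin, of "Min A"] sub(2) by simp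
      have "A \<subseteq> {..<n}" using sub(1) v(1) by auto
      then show ?thesis using sub card v(2,3) A(1) by (auto simp: idx_def Suc y_def kos_htpy_def diff_diff_left)
    qed
    show ?thesis
    proof (rule CI)
      fix l A
      show "y (l, A) \<in> hpolys n (e - shf (Suc p) l - card A)" using *[of l A] by (cases "y (l, A) = 0") auto
      show "(l, A) \<notin> idx (Suc p) (Suc q) \<Longrightarrow> y (l, A) = 0" using *[of l A] by blast
    qed simp
  qed
  have "g (Suc p) q y = x"
  proof
    fix i :: "nat \<times> nat set"
    obtain l A where i: "i = (l, A)" by (cases i)
    have out: "z l B = 0" if "\<not> B \<subseteq> {..<n}" for B
      using that z_idx[of l B] by (auto simp: idx_def Suc)
    have gx': "g (Suc p) q' x = 0" using gx Suc by simp
    \<comment> \<open>The leftover of the homotopy lives in exterior degree 0. For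
      \<open>q' = 0\<close> it is killed by the hypothesis on the augmentation to K; otherwise the
      empty set is not in the index set.\<close>
    have zero: "kos n (z l) = 0 \<and> no_vars_below n (z l {}) = 0"
    proof (cases q')
      case 0
      have "z l (insert j B) = 0" for j B
      proof (rule ccontr)
        assume "z l (insert j B) \<noteq> 0"
        then have *: "insert j B \<subseteq> {..<n}" "card (insert j B) = 0" using z_idx[of l "insert j B"] by (auto simp: idx_def Suc 0)
        then show False using finite_subset[OF *(1)] by auto
      qed
      then have "contract j (z l) B = 0" for j B by (simp add: contract_def)
      then have "kos n (z l) = 0" by (simp add: fun_eq_iff kos_def)
      moreover have "cst (mcoeff (z l {}) 0) = 0" using fun_cong[OF gx', of "(l, {})"] by (simp add: g_def 0 z_def)
      ultimately show ?thesis using no_vars_below_polys[OF C_polys[OF x]] by (simp add: z_def)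
    next
      case (Suc q'')
      have "kos n (z l) = 0" using fun_cong[OF gx'] by (auto simp: fun_eq_iff g_def Suc z_def)
      moreover have "z l {} = 0" using z_idx[of l "{}"] by (auto simp: idx_def Suc \<open>q = Suc q'\<close>)
      moreover have "no_vars_below n (0 :: 'k mpoly) = 0" by (rule poly_mapping_eqI) (simp add: coeff_no_vars_below)
      ultimately show ?thesis by simp
    qed
    have "kos n (kos_htpy (z l)) A = z l A - (if A = {} then no_vars_below n (z l {}) else 0)"
      using kos_exact[of n "z l" A] out zero by blast
    then show "g (Suc p) q y i = x i" using zero by (simp add: i g_def Suc y_def z_def)
  qed
  then show ?thesis using y by blast
qed

lemma ff_pos:
  assumes x: "x \<in> C (Suc (Suc p)) (Suc q)"
  shows "f p (Suc q) (f (Suc p) (Suc q) x) = 0"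
proof
  fix i :: "nat \<times> nat set"
  obtain l A where i: "i = (l, A)" by (cases i)
  show "f p (Suc q) (f (Suc p) (Suc q) x) i = 0 i"
    using mat_composition[OF free_module_slice[OF x, where A = A], of l]
    by (simp add: i f_def active_def matq_def)
qed

text \<open>Elements at \<open>q = 0\<close> lift along \<open>g\<close> to \<open>q = 1\<close>,
  where the composite is that of the resolution itself.\<close>

lemma ff: 
  assumes x: "x \<in> C (Suc (Suc p)) q"
  shows "f p q (f (Suc p) q x) = 0"
proof (cases q)
  case 0
  obtain y where y: "y \<in> C (Suc (Suc p)) 1" "x = g (Suc (Suc p)) 0 y"
    using col_exact[of x "Suc p" 0] x 0 by auto
  have "f p 0 (f (Suc p) 0 x) = g p 0 (f p 1 (f (Suc p) 1 y))" using y(2) commute by simp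
  also have "f p 1 (f (Suc p) 1 y) = 0" using ff_pos[of y p 0] y(1) by simp
  also have "g p 0 0 = 0" by (simp add: g_def fun_eq_iff)
  finally show ?thesis by (simp add: 0)
qed (use ff_pos x in simp)

text \<open>Exactness of the resolution is used for each index set \<open>A\<close> separately. The
  preimages need not be homogeneous, so the components of the degree prescribed by \<open>e\<close>
  are taken.\<close>

lemma row_exact:
  assumes x: "x \<in> C p (Suc q)" and fx: "0 < p \<Longrightarrow> f (p - 1) (Suc q) x = 0"
  shows "x \<in> f p (Suc q) ` C (Suc p) (Suc q)"
proof -
  have "\<exists>w. w \<in> free_module n (rk (Suc p)) \<and> (\<forall>l<rk p. x (l, A) = (\<Sum>m<rk (Suc p). mat p l m * w m))" for A
  proof -
    let ?v = "\<lambda>l. if l < rk p then x (l, A) else 0"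
    have v: "?v \<in> free_module n (rk p)" by (rule free_module_slice[OF x])
    have v0: "?v 0 \<in> I" if "p = 0"
      using C_in(2)[OF x _ that, of "(0, A)"] C_out[OF x, of "(0, A)"] I_closed(1)
      by (cases "(0, A) \<in> idx p (Suc q)") auto
    have "(\<Sum>m<rk p. mat p' l m * ?v m) = 0" if "p = Suc p'" "l < rk p'" for p' l
      using fun_cong[OF fx, of "(l, A)"] that by (simp add: f_def active_def matq_def)
    from mat_exact[OF v v0 this] obtain w where w: "w \<in> free_module n (rk (Suc p))"
      "\<And>l. l < rk p \<Longrightarrow> ?v l = (\<Sum>m<rk (Suc p). mat p l m * w m)" by blast
    have "x (l, A) = (\<Sum>m<rk (Suc p). mat p l m * w m)" if "l < rk p" for l using w(2)[OF that] that by simp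
    then show ?thesis using w(1) by blast
  qed
  then obtain w where w: "\<And>A. w A \<in> free_module n (rk (Suc p))"
    "\<And>A l. l < rk p \<Longrightarrow> x (l, A) = (\<Sum>m<rk (Suc p). mat p l m * w A m)" by metis
  define y where "y i = (if i \<in> idx (Suc p) (Suc q)
     then hom_component (e - shf (Suc p) (fst i) - card (snd i)) (w (snd i) (fst i)) else 0)" for i
  have y: "y \<in> C (Suc p) (Suc q)"
  proof (rule CI)
    fix l A assume i: "(l, A) \<in> idx (Suc p) (Suc q)"
    then have "w A l \<in> polys n" using w(1)[of A] by (auto simp: free_module_def idx_def)
    then show "y (l, A) \<in> hpolys n (e - shf (Suc p) l - card A)"
      using i hom_component_in_hpolys by (simp add: y_def)
  qed (simp_all add: y_def)
  have "f p (Suc q) y = x"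
  proof
    fix i :: "nat \<times> nat set"
    obtain l A where i: "i = (l, A)" by (cases i)
    show "f p (Suc q) y i = x i"
    proof (cases "l < rk p \<and> A \<subseteq> {..<n} \<and> card A = q")
      case True
      let ?E = "e - shf p l - card A"
      have t: "mat p l m * y (m, A) = (if shf p l + card A \<le> e then hom_component ?E (mat p l m * w A m) else 0)"
        if m: "m < rk (Suc p)" for m
      proof (cases "shf p l \<le> shf (Suc p) m")
        case le: True
        let ?D = "shf (Suc p) m - shf p l"
        have h: "mat p l m \<in> hpolys n ?D" using mat_hpolys[OF _ m le] True by simp
        show ?thesis
        proof (cases "shf (Suc p) m + q \<le> e")
          case ix: True
          then have "(m, A) \<in> idx (Suc p) (Suc q)" using True m by (auto simp: idx_def)
          then have "mat p l m * y (m, A) = mat p l m * hom_component (e - shf (Suc p) m - card A) (w A m)"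
            by (simp add: y_def)
          also have "\<dots> = hom_component (?D + (e - shf (Suc p) m - card A)) (mat p l m * w A m)"
            using hom_component_mult[OF h] by simp
          also have "?D + (e - shf (Suc p) m - card A) = ?E" using le ix True by linarith
          finally show ?thesis using le ix True by simp
        next
          case nix: False
          then have "y (m, A) = 0" by (auto simp: y_def idx_def)
          moreover have "shf p l + card A \<le> e \<Longrightarrow> ?E < ?D" using nix True le by linarith
          ultimately show ?thesis using hom_component_mult_less[OF h] by simp
        qed
      next
        case False
        then show ?thesis using mat_zero[OF _ m] True by simp
      qed
      have "f p (Suc q) y i = (\<Sum>m<rk (Suc p). mat p l m * y (m, A))"
        using True by (simp add: f_def i active_def matq_def)
      also have "\<dots> = (if shf p l + card A \<le> e then hom_component ?E (x (l, A)) else 0)"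
        using w(2)[of l A] True t by (simp add: hom_component_sum)
      also have "\<dots> = x i"
      proof (cases "shf p l + card A \<le> e")
        case le: True
        then have "(l, A) \<in> idx p (Suc q)" using True by (auto simp: idx_def)
        then have "x (l, A) \<in> hpolys n ?E" using C_in(1)[OF x] by fastforce
        then show ?thesis using le hom_component_hpolys[of "x (l, A)" n ?E ?E] by (simp add: i)
      next
        case False
        then have "(l, A) \<notin> idx p (Suc q)" using True by (auto simp: idx_def)
        then show ?thesis using C_out[OF x] False by (simp add: i)
      qed
      finally show ?thesis .
    next
      case False
      then have "x i = 0" using C_out[OF x, of i] by (auto simp: i idx_def)
      moreover have "y (m, A) = 0" if "\<not> (A \<subseteq> {..<n} \<and> card A = q)" for m
        using that by (auto simp: y_def idx_def)
      ultimately show ?thesis using False by (auto simp: f_def i active_def)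
    qed
  qed
  then show ?thesis using y by blast
qed

sublocale double_complex fscale C f g
proof (rule double_complex.intro[OF fvec.vector_space_axioms double_complex_axioms.intro], goal_cases)
  case 1 show ?case by (rule subspace_C)
next
  case 2 show ?case by (rule fin_dim_C)
next
  case 3 show ?case by (rule linear_f)
next
  case 4 show ?case by (rule linear_g)
next
  case 5 then show ?case by (rule f_in)
next
  case 6 then show ?case by (rule g_in)
next
  case 7 show ?case by (rule commute)
next
  case 8 then show ?case by (rule ff)
next
  case 9 show ?case by (rule gg)
next
  case 10 then show ?case by (rule row_exact)
next
  case 11 then show ?case by (rule col_exact)
qed

section \<open>Passage from the double complex to Tor\<close>

definition emb :: "(nat \<Rightarrow> 'k) \<Rightarrow> nat \<times> nat set \<Rightarrow> 'k mpoly" where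
  "emb c i = (if snd i = {} then cst (c (fst i)) else 0)"

lemma linear_emb: "Vector_Spaces.linear (\<lambda>c v l. c * v l) fscale emb"
  by unfold_locales (auto simp: emb_def fun_eq_iff single_add mult_single algebra_simps)

lemma emb_eq_0: "emb c = 0 \<Longrightarrow> c = 0"
proof
  fix l assume "emb c = 0"
  from fun_cong[OF this, of "(l, {})"] show "c l = 0 l" by (simp add: emb_def)
qed

lemma emb_inj: "emb c = emb c' \<longleftrightarrow> c = c'"
proof
  assume *: "emb c = emb c'"
  show "c = c'"
  proof
    fix l from fun_cong[OF *, of "(l, {})"] show "c l = c' l" by (simp add: emb_def)
  qed
qed simp

lemma emb_tensor_K: "emb ` tensor_K F p e = C (Suc p) 0"
proof (intro equalityI subsetI)
  fix v assume "v \<in> emb ` tensor_K F p e"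
  then obtain c where c: "c \<in> tensor_K F p e" "v = emb c" by blast
  show "v \<in> C (Suc p) 0"
  proof (rule CI)
    fix l A
    show "(l, A) \<in> idx (Suc p) 0 \<Longrightarrow> v (l, A) \<in> hpolys n (e - shf (Suc p) l - card A)"
      by (auto simp: c(2) emb_def idx_def)
    assume "(l, A) \<notin> idx (Suc p) 0"
    then show "v (l, A) = 0" using c(1) by (auto simp: c(2) emb_def idx_def tensor_K_def rk_def shf_def)
  qed simp
next
  fix v assume v: "v \<in> C (Suc p) 0"
  let ?c = "\<lambda>l. mcoeff (v (l, {})) 0"
  have "?c \<in> tensor_K F p e"
  proof -
    have "(l, {}) \<in> idx (Suc p) 0" if "?c l \<noteq> 0" for l
      using that C_out[OF v, of "(l, {})"] by (cases "(l, {}) \<in> idx (Suc p) 0") simp_all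
    then show ?thesis by (auto simp: tensor_K_def idx_def rk_def shf_def)
  qed
  moreover have "v = emb ?c"
  proof
    fix i :: "nat \<times> nat set"
    show "v i = emb ?c i"
    proof (cases "i \<in> idx (Suc p) 0")
      case True
      then have *: "i = (fst i, {})" "shf (Suc p) (fst i) = e" by (auto simp: idx_def)
      then have "v i \<in> hpolys n 0" using C_in(1)[OF v True] by simp
      then show ?thesis using hpolys_0_eq[of "v i" n] *(1) by (metis emb_def snd_conv)
    next
      case False
      then have "v i = 0" by (rule C_out[OF v])
      then show ?thesis by (cases i) (auto simp: emb_def)
    qed
  qed
  ultimately show "v \<in> emb ` tensor_K F p e" by blast
qed

lemma emb_tensor_K_map: "emb (tensor_K_map F p c) = f (Suc p) 0 (emb c)"
proof
  fix i :: "nat \<times> nat set"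
  show "emb (tensor_K_map F p c) i = f (Suc p) 0 (emb c) i"
    by (cases i) (simp add: emb_def f_def active_def matq_def mat_def rk_def tensor_K_map_def mat_vec_def cst_sum cst_mult)
qed

lemma emb_tor_cycles: "emb ` tor_cycles F p e = {x \<in> C (Suc p) 0. f p 0 x = 0}"
proof (cases p)
  case 0
  have "f 0 0 x = 0" for x by (simp add: f_def active_def fun_eq_iff)
  then show ?thesis using emb_tensor_K[of 0] by (simp add: 0 tor_cycles_def)
next
  case (Suc p')
  have "tensor_K_map F p' c = (\<lambda>_. 0) \<longleftrightarrow> f p 0 (emb c) = 0" for c
  proof -
    have "emb (\<lambda>_. 0) = 0" by (auto simp: emb_def fun_eq_iff)
    then show ?thesis using emb_tensor_K_map[of p' c] emb_inj[of "tensor_K_map F p' c" "\<lambda>_. 0"] Suc by auto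
  qed
  then have "tor_cycles F p e = {c \<in> tensor_K F p e. f p 0 (emb c) = 0}" by (simp add: tor_cycles_def Suc)
  then show ?thesis using emb_tensor_K[of p] by auto
qed

lemma emb_tor_boundaries: "emb ` tor_boundaries F p e = f (Suc p) 0 ` C (Suc (Suc p)) 0"
  unfolding tor_boundaries_def emb_tensor_K[symmetric] image_image emb_tensor_K_map by simp

lemma tor_dim_eq:
  "tor_dim F p e = fvec.dim {x \<in> C 0 (Suc p). g 0 p x = 0} - fvec.dim (g 0 (Suc p) ` C 0 (Suc (Suc p)))"
proof -
  have add: "tensor_K_map F m (x + y) = tensor_K_map F m x + tensor_K_map F m y" for x y m
    by (auto simp: tensor_K_map_def mat_vec_def fun_eq_iff distrib_left sum.distrib)
  have scale: "tensor_K_map F m (\<lambda>l. c * x l) = (\<lambda>l. c * tensor_K_map F m x l)" for x c m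
    by (auto simp: tensor_K_map_def mat_vec_def fun_eq_iff sum_distrib_left mult.left_commute)
  have lin: "Vector_Spaces.linear (\<lambda>c v l. c * v l) (\<lambda>c v l. c * v l) (tensor_K_map F m)" for m
    by unfold_locales (simp_all add: add scale)
  have K: "kvec.subspace (tensor_K F p e)" for p
    by (auto simp: kvec.subspace_def tensor_K_def) (metis add_0)+
  have fin: "fin_dim (\<lambda>c v l. c * v l) (tensor_K F p e)" for p
    by (rule kvec.fin_dim_subset[OF kvec_fin_dim[of "frank F p"]]) (auto simp: tensor_K_def)
  have tk0: "tensor_K_map F m 0 = 0" for m by (auto simp: tensor_K_map_def mat_vec_def fun_eq_iff)
  have cyc: "kvec.subspace (tor_cycles F p e)"
  proof (cases p)
    case (Suc m)
    have "tor_cycles F p e = {c \<in> tensor_K F p e. tensor_K_map F m c = 0}"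
      by (simp add: tor_cycles_def Suc zero_fun_def)
    then show ?thesis using K[of p] by (simp add: kvec.subspace_def add scale tk0 fun_eq_iff)
  qed (use K in \<open>simp add: tor_cycles_def\<close>)
  have cycfin: "fin_dim (\<lambda>c v l. c * v l) (tor_cycles F p e)"
    by (rule kvec.fin_dim_subset[OF fin[of p]]) (auto simp: tor_cycles_def)
  interpret tK: Vector_Spaces.linear "\<lambda>c v l. c * v l" "\<lambda>c v l. c * v l" "tensor_K_map F m" for m by (rule lin)
  have bd: "kvec.subspace (tor_boundaries F p e)"
    unfolding tor_boundaries_def by (rule tK.subspace_image[OF K])
  have bdfin: "fin_dim (\<lambda>c v l. c * v l) (tor_boundaries F p e)"
    unfolding tor_boundaries_def by (rule fin_dim_linear_image[OF lin fin])
  have "kvec.dim (tor_cycles F p e) = fvec.dim {x \<in> C (Suc p) 0. f p 0 x = 0}"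
    using dim_inj_image[OF linear_emb cyc cycfin emb_eq_0] emb_tor_cycles by simp
  moreover have "kvec.dim (tor_boundaries F p e) = fvec.dim (f (Suc p) 0 ` C (Suc (Suc p)) 0)"
    using dim_inj_image[OF linear_emb bd bdfin emb_eq_0] emb_tor_boundaries by simp
  ultimately show ?thesis unfolding tor_dim_def using left_homology_eq_bottom_homology[of p] by simp
qed

end

text \<open>\<open>V\<close> is only a space of polynomials, not an S-module; boundaries are
  computed in the whole polynomial ring. So the coefficients may be one graded piece of an ideal, or
  its restriction to a hyperplane.\<close>

definition kcycles :: "nat \<Rightarrow> nat \<Rightarrow> 'k::field mpoly set \<Rightarrow> (nat set \<Rightarrow> 'k mpoly) set" where
  "kcycles n i V = {z \<in> funs {A. A \<subseteq> {..<n} \<and> card A = i} (\<lambda>_. V). kos n z = 0}"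

lemma kos_degree_0:
  assumes "\<And>A. card A \<noteq> 0 \<or> infinite A \<Longrightarrow> z A = 0"
  shows "kos n z = 0"
proof -
  have "z (insert j B) = 0" for j B using assms[of "insert j B"] by (cases "finite B") auto
  then have "contract j z A = 0" for j A by (simp add: contract_def)
  then show ?thesis by (simp add: kos_def fun_eq_iff)
qed

lemma finite_card_subsets: "finite {A. A \<subseteq> {..<(n::nat)} \<and> card A = i}"
  by (rule finite_subset[of _ "Pow {..<n}"]) auto

lemma subspace_kcycles:
  assumes "pvec.subspace V"
  shows "fvec.subspace (kcycles n i V)"
proof -
  have "fvec.subspace (funs {A. A \<subseteq> {..<n} \<and> card A = i} (\<lambda>_. V))" by (rule subspace_funs) (rule assms)
  then show ?thesis unfolding fvec.subspace_def kcycles_def by (simp add: kos_add kos_scale fun_eq_iff)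
qed

lemma fin_dim_kcycles:
  assumes "fin_dim pscale V"
  shows "fin_dim fscale (kcycles n i V)"
  by (rule fvec.fin_dim_subset[OF fin_dim_funs[OF finite_card_subsets assms]]) (auto simp: kcycles_def)

text \<open>For \<open>e = i + d\<close> the edge complex of \<open>I\<close> has coefficients of
  degree \<open>d\<close> at the cycles and of degree \<open>d - 1\<close> one step before, where
  \<open>I\<close> vanishes. So there are no boundaries to divide out.\<close>

theorem tor_dim_lowest_strand:
  fixes I :: "'k::field mpoly set"
  assumes I: "graded_ideal n I" and F: "graded_free_resolution n I F"
    and low: "\<And>j. j < d \<Longrightarrow> I \<inter> hpolys n j = {0}"
  shows "tor_dim F i (i + d) = fvec.dim (kcycles n i (I \<inter> hpolys n d))"
proof -
  interpret ideal_resolution n I F "i + d" by unfold_locales (rule I, rule F)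
  let ?V = "I \<inter> hpolys n d"
  let ?J = "{A. A \<subseteq> {..<n} \<and> card A = i}"
  have idx0: "(l, A) \<in> idx 0 (Suc q) \<longleftrightarrow> l = 0 \<and> A \<subseteq> {..<n} \<and> card A = q \<and> q \<le> i + d" for l A q
    by (auto simp: idx_def rk_def shf_def)
  have zero: "x = 0" if x: "x \<in> C 0 (Suc (Suc i))" for x
  proof
    fix j :: "nat \<times> nat set"
    show "x j = 0 j"
    proof (cases "j \<in> idx 0 (Suc (Suc i))")
      case True
      \<comment> \<open>The inequality of the index set forces \<open>d > 0\<close>, so the
        truncated \<open>d - 1\<close> is really a smaller degree.\<close>
      then have "card (snd j) = Suc i" "Suc i \<le> i + d" "shf 0 (fst j) = 0"
        by (auto simp: idx_def shf_def)
      then have "x j \<in> I \<inter> hpolys n (d - 1)" "d - 1 < d" using C_in[OF x True] by simp_all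
      then show ?thesis using low by auto
    qed (use C_out[OF x] in simp)
  qed
  have g0: "g 0 (Suc i) 0 = 0" by (auto simp: g_def fun_eq_iff zero_fun_def)
  have "g 0 (Suc i) ` C 0 (Suc (Suc i)) = {0}"
  proof -
    have "C 0 (Suc (Suc i)) = {0}" using zero fvec.subspace_0[OF subspace_C] by blast
    then show ?thesis using g0 by simp
  qed
  then have "fvec.dim (g 0 (Suc i) ` C 0 (Suc (Suc i))) = fvec.dim (fvec.span {} :: (nat \<times> nat set \<Rightarrow> 'k mpoly) set)"
    by (simp only: fvec.span_empty)
  then have 1: "fvec.dim (g 0 (Suc i) ` C 0 (Suc (Suc i))) = 0"
    by (simp only: fvec.dim_span_eq_card_independent[OF fvec.independent_empty] card.empty)
  define t where "t z = (\<lambda>j::nat \<times> nat set. if fst j = 0 then z (snd j) else 0)" for z :: "nat set \<Rightarrow> 'k mpoly"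
  have lin: "Vector_Spaces.linear fscale fscale t"
    by (rule linear_ffI) (auto simp: t_def fun_eq_iff)
  have inj: "z = 0" if "t z = 0" for z
  proof
    fix A from fun_cong[OF that, of "(0, A)"] show "z A = 0 A" by (simp add: t_def)
  qed
  have V: "pvec.subspace ?V"
    using subspace_hpolys[of n d] I_closed cst_in_polys by (auto simp: pvec.subspace_def)
  have Vfin: "fin_dim pscale ?V" by (rule pvec.fin_dim_subset[OF fin_dim_hpolys[of n d]]) auto
  have tg: "g 0 i (t z) = 0 \<longleftrightarrow> kos n z = 0" if z: "z \<in> funs ?J (\<lambda>_. ?V)" for z
  proof (cases i)
    case 0
    have "kos n z = 0"
    proof (rule kos_degree_0)
      fix A :: "nat set" assume "card A \<noteq> 0 \<or> infinite A"
      then have "A \<notin> ?J" using 0 finite_subset[of A "{..<n}"] by auto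
      then show "z A = 0" by (rule funs_out[OF z])
    qed
    then show ?thesis by (simp add: 0 g_def fun_eq_iff)
  next
    case (Suc i')
    have "g 0 i (t z) (l, A) = (if l = 0 then kos n z A else 0)" for l A
      by (auto simp: g_def Suc t_def)
    then show ?thesis by (auto simp: fun_eq_iff)
  qed
  have tz: "t ` funs ?J (\<lambda>_. ?V) = C 0 (Suc i)"
  proof (intro equalityI subsetI)
    fix x assume "x \<in> t ` funs ?J (\<lambda>_. ?V)"
    then obtain z where z: "z \<in> funs ?J (\<lambda>_. ?V)" "x = t z" by blast
    show "x \<in> C 0 (Suc i)"
    proof (rule CI)
      fix l A
      { assume "(l, A) \<in> idx 0 (Suc i)"
        then have *: "l = 0" "A \<in> ?J" by (auto simp: idx0)
        have "z A \<in> ?V" using funs_in[OF z(1) *(2)] .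
        then show "x (l, A) \<in> hpolys n (i + d - shf 0 l - card A)" "x (l, A) \<in> I"
          using * by (auto simp: z(2) t_def shf_def) }
      assume "(l, A) \<notin> idx 0 (Suc i)"
      then have "l \<noteq> 0 \<or> A \<notin> ?J" by (auto simp: idx0)
      then show "x (l, A) = 0" using funs_out[OF z(1)] by (auto simp: z(2) t_def)
    qed
  next
    fix x assume x: "x \<in> C 0 (Suc i)"
    let ?z = "\<lambda>A. x (0, A)"
    have "?z \<in> funs ?J (\<lambda>_. ?V)"
    proof (rule funsI)
      fix A assume "A \<in> ?J"
      then have "(0, A) \<in> idx 0 (Suc i)" "card A = i" by (auto simp: idx0)
      then show "x (0, A) \<in> ?V" using C_in[OF x, of "(0, A)"] by (simp add: shf_def)
    next
      fix A assume "A \<notin> ?J"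
      then show "x (0, A) = 0" by (intro C_out[OF x]) (auto simp: idx0)
    qed
    moreover have "x = t ?z"
    proof
      fix j :: "nat \<times> nat set"
      show "x j = t ?z j"
      proof (cases "fst j = 0")
        case True
        then show ?thesis by (cases j) (simp add: t_def)
      next
        case False
        then have "j \<notin> idx 0 (Suc i)" by (cases j) (auto simp: idx0)
        then show ?thesis using C_out[OF x] False by (simp add: t_def)
      qed
    qed
    ultimately show "x \<in> t ` funs ?J (\<lambda>_. ?V)" by blast
  qed
  have "t ` kcycles n i ?V = {x \<in> C 0 (Suc i). g 0 i x = 0}"
    unfolding kcycles_def tz[symmetric] using tg by auto
  then have "fvec.dim {x \<in> C 0 (Suc i). g 0 i x = 0} = fvec.dim (kcycles n i ?V)"
    using dim_inj_image[OF lin subspace_kcycles[OF V] fin_dim_kcycles[OF Vfin] inj] by metis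
  then show ?thesis using tor_dim_eq[of i] 1 by simp
qed

section \<open>Existence of graded free resolutions\<close>

subsection \<open>Dickson's lemma\<close>

text \<open>Each index minimises \<open>h\<close> over all indices after the previous one. The next
  index was already a candidate in that minimisation, so the values do not decrease.\<close>

lemma exists_incseq_subseq:
  fixes h :: "nat \<Rightarrow> nat"
  shows "\<exists>s :: nat \<Rightarrow> nat. strict_mono s \<and> mono (h \<circ> s)"
proof -
  define s where "s = rec_nat (arg_min h (\<lambda>_. True)) (\<lambda>_ i. arg_min h (\<lambda>j. i < j))"
  have s0: "s 0 = arg_min h (\<lambda>_. True)" and s1: "s (Suc k) = arg_min h (\<lambda>j. s k < j)" for k
    by (simp_all add: s_def)
  have inc: "s k < s (Suc k)" for k
    unfolding s1 by (rule arg_min_natI[of "\<lambda>j. s k < j" "Suc (s k)"]) simp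
  have le: "h (s k) \<le> h (s (Suc k))" for k
  proof (cases k)
    case 0
    show ?thesis unfolding 0 s0 by (rule arg_min_nat_le) simp
  next
    case (Suc k')
    have "s k' < s (Suc k)" using inc[of k'] inc[of k] Suc by simp
    then show ?thesis unfolding Suc s1[of k'] by (rule arg_min_nat_le[of "\<lambda>j. s k' < j"]) 
  qed
  show ?thesis
    using inc le by (intro exI[of _ s] conjI strict_mono_Suc_iff[THEN iffD2] mono_iff_le_Suc[THEN iffD2]) simp_all
qed

lemma dickson_sequence:
  fixes h :: "nat \<Rightarrow> nat \<Rightarrow> nat"
  shows "\<exists>s :: nat \<Rightarrow> nat. strict_mono s \<and> (\<forall>i<m. mono (\<lambda>k. h (s k) i))"
proof (induction m)
  case 0
  show ?case by (rule exI[of _ "\<lambda>k. k"]) (simp add: strict_mono_def)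
next
  case (Suc m)
  then obtain s :: "nat \<Rightarrow> nat" where s: "strict_mono s" "\<And>i. i < m \<Longrightarrow> mono (\<lambda>k. h (s k) i)" by blast
  obtain t :: "nat \<Rightarrow> nat" where t: "strict_mono t" "mono ((\<lambda>k. h (s k) m) \<circ> t)" using exists_incseq_subseq by blast
  have "mono (\<lambda>k. h ((s \<circ> t) k) i)" if "i < Suc m" for i
  proof (cases "i = m")
    case True
    then show ?thesis using t(2) by (simp add: o_def)
  next
    case False
    then have "mono (\<lambda>k. h (s k) i)" using s(2) that by simp
    moreover have "mono t" using t(1) by (rule strict_mono_mono)
    ultimately show ?thesis by (auto simp: mono_def)
  qed
  moreover have "strict_mono (s \<circ> t)" using s(1) t(1) by (rule strict_mono_o)
  ultimately show ?case by blast
qed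

text \<open>If no finite subset dominates \<open>L\<close>, there is a sequence in which no pair is
  dominated by an earlier one; a subsequence with nondecreasing coordinates contradicts
  this.\<close>

lemma dickson:
  fixes L :: "(nat \<times> monomial) set"
  assumes L: "\<And>l a. (l, a) \<in> L \<Longrightarrow> l < r \<and> a \<in> monomials n"
  shows "\<exists>L0\<subseteq>L. finite L0 \<and> (\<forall>(l, a)\<in>L. \<exists>b\<in>monomials n. \<exists>a'. (l, a') \<in> L0 \<and> a = b + a')"
proof (rule ccontr)
  define dom where "dom L0 t \<longleftrightarrow> (\<exists>b\<in>monomials n. \<exists>a'. (fst t, a') \<in> L0 \<and> snd t = b + a')"
    for L0 :: "(nat \<times> monomial) set" and t :: "nat \<times> monomial"
  assume *: "\<not> ?thesis"
  have "\<exists>t\<in>L. \<not> dom L0 t" if "finite L0" "L0 \<subseteq> L" for L0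
    using * that unfolding dom_def by (auto simp: split_beta)
  then obtain pick where pick: "\<And>L0. finite L0 \<Longrightarrow> L0 \<subseteq> L \<Longrightarrow> pick L0 \<in> L \<and> \<not> dom L0 (pick L0)" by metis
  define T where "T = rec_nat {} (\<lambda>_ X. insert (pick X) X)"
  have T0: "T 0 = {}" and T1: "T (Suc k) = insert (pick (T k)) (T k)" for k by (simp_all add: T_def)
  have T: "finite (T k) \<and> T k \<subseteq> L" for k by (induction k) (use T0 T1 pick in auto)
  define t where "t k = pick (T k)" for k
  have tL: "t k \<in> L" and nd: "\<not> dom (T k) (t k)" for k using pick T by (auto simp: t_def)
  have tT: "t i \<in> T j" if "i < j" for i j using that
    by (induction j) (auto simp: T1 t_def less_Suc_eq)
  \<comment> \<open>A pair becomes \<open>n + 2\<close> numbers. The component occurs as itself and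
    subtracted from \<open>r\<close>, so that weak increase of both forces equality.\<close>
  define h where "h k i = (if i < n then expo (snd (t k)) i else if i = n then fst (t k) else r - fst (t k))" for k i
  obtain s :: "nat \<Rightarrow> nat" where s: "strict_mono s" "\<And>i. i < n + 2 \<Longrightarrow> mono (\<lambda>k. h (s k) i)"
    using dickson_sequence[of "n + 2" h] by blast
  define i j where "i = s 0" and "j = s 1"
  have ij: "i < j" using s(1) by (simp add: i_def j_def strict_mono_def)
  have le: "h i m \<le> h j m" if "m < n + 2" for m
    using s(2)[OF that] unfolding i_def j_def by (rule monoD) simp
  have ti: "fst (t i) < r" "snd (t i) \<in> monomials n" and tj: "fst (t j) < r" "snd (t j) \<in> monomials n"
    using L[of "fst (t i)" "snd (t i)"] L[of "fst (t j)" "snd (t j)"] tL by auto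
  have "fst (t i) \<le> fst (t j)" using le[of n] by (simp add: h_def)
  moreover have "r - fst (t i) \<le> r - fst (t j)" using le[of "Suc n"] by (simp add: h_def)
  ultimately have eq: "fst (t i) = fst (t j)" using ti tj by linarith
  have ex: "expo (snd (t i)) m \<le> expo (snd (t j)) m" for m
    using le[of m] ti(2) tj(2) by (cases "m < n") (auto simp: h_def monomials_iff)
  let ?b = "snd (t j) - snd (t i)"
  have "?b \<in> monomials n" using tj(2) by (simp add: monomials_iff lookup_minus)
  moreover have "snd (t j) = ?b + snd (t i)"
    using ex by (intro poly_mapping_eqI) (simp add: lookup_add lookup_minus)
  moreover have "(fst (t j), snd (t i)) \<in> T j" using tT[OF ij] eq by (metis prod.collapse)
  ultimately have "dom (T j) (t j)" unfolding dom_def by blast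
  then show False using nd by blast
qed

subsection \<open>Graded submodules of free modules\<close>

definition hpart :: "nat list \<Rightarrow> nat \<Rightarrow> (nat \<Rightarrow> 'k::field mpoly) \<Rightarrow> nat \<Rightarrow> 'k mpoly" where
  "hpart S j v l = (if l < length S \<and> S ! l \<le> j then hom_component (j - S ! l) (v l) else 0)"

definition graded_submodule :: "nat \<Rightarrow> nat list \<Rightarrow> (nat \<Rightarrow> 'k::field mpoly) set \<Rightarrow> bool" where
  "graded_submodule n S N \<longleftrightarrow> N \<subseteq> free_module n (length S) \<and> 0 \<in> N
     \<and> (\<forall>v\<in>N. \<forall>w\<in>N. v + w \<in> N) \<and> (\<forall>s\<in>polys n. \<forall>v\<in>N. (\<lambda>l. s * v l) \<in> N)
     \<and> (\<forall>v\<in>N. \<forall>j. hpart S j v \<in> N)"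

definition hvec :: "nat \<Rightarrow> nat list \<Rightarrow> nat \<Rightarrow> (nat \<Rightarrow> 'k::field mpoly) \<Rightarrow> bool" where
  "hvec n S e v \<longleftrightarrow> v \<in> free_module n (length S)
     \<and> (\<forall>l<length S. \<forall>a\<in>Poly_Mapping.keys (v l). S ! l + mdeg a = e)"

text \<open>Pairs are ordered lexicographically, component before monomial, so the maximum of this
  set is the leading term for a position-over-term order.\<close>

definition vterms :: "nat list \<Rightarrow> (nat \<Rightarrow> 'k::field mpoly) \<Rightarrow> (nat \<times> monomial) set" where
  "vterms S v = (SIGMA l:{..<length S}. Poly_Mapping.keys (v l))"

lemma finite_vterms [simp]: "finite (vterms S v)"
  by (simp add: vterms_def)

lemma vterms_iff: "(l, a) \<in> vterms S v \<longleftrightarrow> l < length S \<and> mcoeff (v l) a \<noteq> 0"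
  by (simp add: vterms_def in_keys_iff)

lemma vterms_eq_empty: "v \<in> free_module n (length S) \<Longrightarrow> vterms S v = {} \<Longrightarrow> v = 0"
proof
  fix l assume v: "v \<in> free_module n (length S)" "vterms S v = {}"
  show "v l = 0 l"
  proof (cases "l < length S")
    case True
    then show ?thesis using v(2) vterms_iff[of l _ S v] by (intro poly_mapping_eqI) auto
  qed (use v(1) in \<open>simp add: free_module_def\<close>)
qed

lemma hpart_hvec: "v \<in> free_module n (length S) \<Longrightarrow> hvec n S j (hpart S j v)"
  using hom_component_in_hpolys hpolys_subset_polys
  by (fastforce simp: hvec_def free_module_def hpart_def hpolys_def hmons_def split: if_splits)

lemma sum_hpart:
  assumes "v \<in> free_module n (length S)"
  shows "\<exists>M. v = (\<Sum>j<M. hpart S j v)"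
proof -
  have "finite ((\<lambda>(l, a). S ! l + mdeg a) ` vterms S v)" by simp
  then obtain M where "\<forall>x\<in>(\<lambda>(l, a). S ! l + mdeg a) ` vterms S v. x < M"
    using finite_nat_set_iff_bounded by blast
  then have M: "S ! l + mdeg a < M" if "l < length S" "mcoeff (v l) a \<noteq> 0" for l a
    using that vterms_iff[of l a S v] by fastforce
  have "v l = (\<Sum>j<M. hpart S j v) l" for l
  proof (cases "l < length S")
    case True
    show ?thesis
    proof (rule poly_mapping_eqI)
      fix b
      have "mcoeff ((\<Sum>j<M. hpart S j v) l) b = (\<Sum>j<M. if j = S ! l + mdeg b then mcoeff (v l) b else 0)"
        unfolding sum_fun_apply lookup_sum using True by (intro sum.cong) (auto simp: hpart_def)
      also have "\<dots> = mcoeff (v l) b" using M[OF True, of b] by auto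
      finally show "mcoeff (v l) b = mcoeff ((\<Sum>j<M. hpart S j v) l) b" ..
    qed
  next
    case False
    then show ?thesis using assms by (simp add: sum_fun_apply hpart_def free_module_def)
  qed
  then show ?thesis by (intro exI[of _ M]) (rule ext)
qed

text \<open>The scalar makes the leading coefficients cancel. Adding \<open>b\<close> respects the
  order of monomials, so no term of the subtracted multiple exceeds the leading term.\<close>

lemma hvec_reduce:
  assumes v: "hvec n S e v" "Max (vterms S v) = (l, b + a)" "vterms S v \<noteq> {}"
    and g: "hvec n S e' g" "Max (vterms S g) = (l, a)" "vterms S g \<noteq> {}"
    and b: "b \<in> monomials n"
  defines "w \<equiv> v - (\<lambda>m. Poly_Mapping.single b (mcoeff (v l) (b + a) / mcoeff (g l) a) * g m)"
  shows "hvec n S e w" "\<forall>t\<in>vterms S w. t < Max (vterms S v)"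
proof -
  let ?c = "mcoeff (v l) (b + a) / mcoeff (g l) a"
  have lv: "(l, b + a) \<in> vterms S v" using Max_in[OF finite_vterms v(3)] v(2) by simp
  have lg: "(l, a) \<in> vterms S g" using Max_in[OF finite_vterms g(3)] g(2) by simp
  have e: "S ! l + mdeg (b + a) = e" using lv v(1) unfolding hvec_def vterms_def mem_Sigma_iff lessThan_iff by metis
  have e': "S ! l + mdeg a = e'" using lg g(1) unfolding hvec_def vterms_def mem_Sigma_iff lessThan_iff by metis
  have ee: "e = mdeg b + e'" using e e' by simp
  have cg: "\<exists>m'. m = b + m' \<and> mcoeff (g k) m' \<noteq> 0" if "mcoeff (Poly_Mapping.single b ?c * g k) m \<noteq> 0" for k m
  proof (cases "\<exists>m'. m = b + m'")
    case True
    then obtain m' where m: "m = b + m'" by blast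
    then show ?thesis using that coeff_single_mult[of b ?c "g k" m'] by auto
  qed (use that coeff_single_mult_zero in blast)
  have cw: "mcoeff (v k) m \<noteq> 0 \<or> (\<exists>m'. m = b + m' \<and> mcoeff (g k) m' \<noteq> 0)" if "mcoeff (w k) m \<noteq> 0" for k m
    using that cg[of k m] by (auto simp: w_def lookup_minus)
  show "hvec n S e w"
    unfolding hvec_def
  proof (intro conjI allI impI ballI)
    have "Poly_Mapping.single b ?c * g m \<in> polys n" if "m < length S" for m
      using that g(1) b by (intro mult_in_polys single_in_polys) (auto simp: hvec_def free_module_def)
    then show "w \<in> free_module n (length S)"
      using v(1) g(1) by (auto simp: hvec_def free_module_def w_def intro: diff_in_polys)
    fix k m assume k: "k < length S" "m \<in> Poly_Mapping.keys (w k)"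
    then have "mcoeff (w k) m \<noteq> 0" by (simp add: in_keys_iff)
    from cw[OF this] show "S ! k + mdeg m = e"
    proof
      assume "mcoeff (v k) m \<noteq> 0"
      then show ?thesis using v(1) k(1) by (simp add: hvec_def in_keys_iff)
    next
      assume "\<exists>m'. m = b + m' \<and> mcoeff (g k) m' \<noteq> 0"
      then obtain m' where m': "m = b + m'" "mcoeff (g k) m' \<noteq> 0" by blast
      then have "S ! k + mdeg m' = e'" using g(1) k(1) by (simp add: hvec_def in_keys_iff)
      then show ?thesis using ee m'(1) by simp
    qed
  qed
  show "\<forall>t\<in>vterms S w. t < Max (vterms S v)"
  proof
    fix t assume t: "t \<in> vterms S w"
    obtain k m where km: "t = (k, m)" by (cases t)
    have k: "k < length S" "mcoeff (w k) m \<noteq> 0" using t km vterms_iff[of k m S w] by auto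
    have "t \<le> (l, b + a)" using cw[OF k(2)]
    proof
      assume "mcoeff (v k) m \<noteq> 0"
      then have "t \<in> vterms S v" using k km vterms_iff[of k m S v] by simp
      then show ?thesis using Max_ge[OF finite_vterms] v(2) by metis
    next
      assume "\<exists>m'. m = b + m' \<and> mcoeff (g k) m' \<noteq> 0"
      then obtain m' where m': "m = b + m'" "mcoeff (g k) m' \<noteq> 0" by blast
      then have "(k, m') \<in> vterms S g" using k vterms_iff[of k m' S g] by simp
      then have "(k, m') \<le> (l, a)" using Max_ge[OF finite_vterms] g(2) by metis
      then show ?thesis using m'(1) km by (auto simp: less_eq_prod_def)
    qed
    moreover have "t \<noteq> (l, b + a)"
    proof
      assume "t = (l, b + a)"
      then have "mcoeff (w l) (b + a) \<noteq> 0" using k km by simp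
      moreover have "mcoeff (g l) a \<noteq> 0" using lg vterms_iff[of l a S g] by simp
      ultimately show False by (simp add: w_def lookup_minus coeff_single_mult)
    qed
    ultimately show "t < Max (vterms S v)" using v(2) by simp
  qed
qed

lemma finite_hvec_positions: "finite {(l, a). l < length S \<and> a \<in> monomials n \<and> S ! l + mdeg a = e}"
proof (rule finite_subset)
  show "{(l, a). l < length S \<and> a \<in> monomials n \<and> S ! l + mdeg a = e} \<subseteq> (SIGMA l:{..<length S}. hmons n (e - S ! l))"
    by (auto simp: hmons_def)
qed simp

lemma vterms_positions:
  "hvec n S e v \<Longrightarrow> vterms S v \<subseteq> {(l, a). l < length S \<and> a \<in> monomials n \<and> S ! l + mdeg a = e}"
  by (auto simp: hvec_def vterms_def free_module_def polys_def)

text \<open>This is division with remainder by elements of \<open>Q\<close>. Homogeneity gives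
  termination, as there are only finitely many positions of a given total degree.\<close>

lemma generated_by_leading_terms:
  assumes N: "graded_submodule n S N" and Q: "0 \<in> Q" "\<And>v w. v \<in> Q \<Longrightarrow> w \<in> Q \<Longrightarrow> v + w \<in> Q"
      "\<And>s v. s \<in> polys n \<Longrightarrow> v \<in> Q \<Longrightarrow> (\<lambda>l. s * v l) \<in> Q"
    and lead: "\<And>v e. v \<in> N \<Longrightarrow> hvec n S e v \<Longrightarrow> vterms S v \<noteq> {} \<Longrightarrow>
       \<exists>g\<in>Q \<inter> N. \<exists>e' l a. \<exists>b\<in>monomials n. hvec n S e' g \<and> vterms S g \<noteq> {} \<and> Max (vterms S g) = (l, a) \<and> Max (vterms S v) = (l, b + a)"
  shows "N \<subseteq> Q"
proof -
  have hom: "v \<in> Q" if "v \<in> N" "hvec n S e v" for v e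
    using that
  \<comment> \<open>The measure counts the positions of total degree \<open>e\<close> up to the
    leading term; a reduction loses at least the leading term itself.\<close>
  proof (induction "card {t \<in> {(l, a). l < length S \<and> a \<in> monomials n \<and> S ! l + mdeg a = e}. \<exists>t'\<in>vterms S v. t \<le> t'}"
      arbitrary: v rule: less_induct)
    case less
    let ?P = "{(l, a). l < length S \<and> a \<in> monomials n \<and> S ! l + mdeg a = e}"
    show ?case
    proof (cases "vterms S v = {}")
      case True
      then have "v = 0" using vterms_eq_empty less.prems(2) by (auto simp: hvec_def)
      then show ?thesis using Q(1) by simp
    next
      case False
      obtain g e' l a b where g: "g \<in> Q" "g \<in> N" "b \<in> monomials n" "hvec n S e' g" "vterms S g \<noteq> {}"
        "Max (vterms S g) = (l, a)" "Max (vterms S v) = (l, b + a)"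
        using lead[OF less.prems False] by blast
      define s where "s = Poly_Mapping.single b (mcoeff (v l) (b + a) / mcoeff (g l) a)"
      define w where "w = v - (\<lambda>m. s * g m)"
      have w: "hvec n S e w" "\<forall>t\<in>vterms S w. t < Max (vterms S v)"
        using hvec_reduce[OF less.prems(2) g(7) False g(4,6,5,3)] unfolding w_def s_def by blast+
      have s: "s \<in> polys n" unfolding s_def using g(3) by (rule single_in_polys)
      have "w = v + (\<lambda>m. (- s) * g m)" by (simp add: w_def fun_eq_iff)
      then have wN: "w \<in> N" using N less.prems(1) g(2) uminus_in_polys[OF s] by (auto simp: graded_submodule_def)
      have "{t \<in> ?P. \<exists>t'\<in>vterms S w. t \<le> t'} \<subset> {t \<in> ?P. \<exists>t'\<in>vterms S v. t \<le> t'}"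
      proof
        have Mx: "Max (vterms S v) \<in> vterms S v" using False by simp
        show "{t \<in> ?P. \<exists>t'\<in>vterms S w. t \<le> t'} \<subseteq> {t \<in> ?P. \<exists>t'\<in>vterms S v. t \<le> t'}"
        proof
          fix t assume "t \<in> {t \<in> ?P. \<exists>t'\<in>vterms S w. t \<le> t'}"
          then obtain t' where t': "t \<in> ?P" "t' \<in> vterms S w" "t \<le> t'" by blast
          then have "t \<le> Max (vterms S v)" using w(2) by (meson less_imp_le order_trans)
          then have ex: "\<exists>t'\<in>vterms S v. t \<le> t'" using Mx by (rule bexI)
          show "t \<in> {t \<in> ?P. \<exists>t'\<in>vterms S v. t \<le> t'}" by (rule CollectI, rule conjI, rule t'(1), rule ex)
        qed
        have 1: "Max (vterms S v) \<in> {t \<in> ?P. \<exists>t'\<in>vterms S v. t \<le> t'}"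
        proof (rule CollectI, rule conjI)
          show "Max (vterms S v) \<in> ?P" by (rule subsetD[OF vterms_positions[OF less.prems(2)] Mx])
          show "\<exists>t'\<in>vterms S v. Max (vterms S v) \<le> t'" by (rule bexI[OF order_refl Mx])
        qed
        have 2: "Max (vterms S v) \<notin> {t \<in> ?P. \<exists>t'\<in>vterms S w. t \<le> t'}"
        proof
          assume "Max (vterms S v) \<in> {t \<in> ?P. \<exists>t'\<in>vterms S w. t \<le> t'}"
          then have "\<exists>t'\<in>vterms S w. Max (vterms S v) \<le> t'" by (elim CollectE conjE)
          then show False using w(2) leD by blast
        qed
        show "{t \<in> ?P. \<exists>t'\<in>vterms S w. t \<le> t'} \<noteq> {t \<in> ?P. \<exists>t'\<in>vterms S v. t \<le> t'}"
        proof
          assume eq: "{t \<in> ?P. \<exists>t'\<in>vterms S w. t \<le> t'} = {t \<in> ?P. \<exists>t'\<in>vterms S v. t \<le> t'}"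
          show False using 2 1 unfolding eq by contradiction
        qed
      qed
      then have "card {t \<in> ?P. \<exists>t'\<in>vterms S w. t \<le> t'} < card {t \<in> ?P. \<exists>t'\<in>vterms S v. t \<le> t'}"
        by (intro psubset_card_mono) (use finite_hvec_positions[of S n e] in simp_all)
      then have "w \<in> Q" using less.hyps wN w(1) by blast
      moreover have "v = w + (\<lambda>m. s * g m)" by (simp add: w_def fun_eq_iff)
      ultimately show ?thesis using Q(2)[OF _ Q(3)[OF s g(1)]] by simp
    qed
  qed
  show ?thesis
  proof
    fix v assume v: "v \<in> N"
    then have vf: "v \<in> free_module n (length S)" using N by (auto simp: graded_submodule_def)
    obtain M where M: "v = (\<Sum>j<M. hpart S j v)" using sum_hpart[OF vf] by blast
    have "hpart S j v \<in> Q" for j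
    proof (rule hom)
      show "hpart S j v \<in> N" using N v by (auto simp: graded_submodule_def)
    qed (rule hpart_hvec[OF vf])
    then have "(\<Sum>j<M. hpart S j v) \<in> Q" by (induction M) (use Q in auto)
    then show "v \<in> Q" using M by simp
  qed
qed

lemma hvec_entries: "hvec n S e v \<Longrightarrow> l < length S \<Longrightarrow> v l \<in> polys n"
  "hvec n S e v \<Longrightarrow> l < length S \<Longrightarrow> a \<in> Poly_Mapping.keys (v l) \<Longrightarrow> S ! l + mdeg a = e"
  by (auto simp: hvec_def free_module_def)

lemma graded_submodule_sum:
  assumes "graded_submodule n S N" "\<And>i. i \<in> J \<Longrightarrow> h i \<in> N"
  shows "(\<Sum>i\<in>J. h i) \<in> N"
  using assms(2) by (induction J rule: infinite_finite_induct) (use assms(1) in \<open>auto simp: graded_submodule_def\<close>)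

text \<open>By Dickson's lemma finitely many leading terms divide all leading terms of homogeneous
  elements, and elements attaining them form a homogeneous Groebner basis. Their degrees are the
  shifts \<open>E\<close>, their coordinates the columns of \<open>M\<close>.\<close>

theorem graded_submodule_finitely_generated:
  fixes N :: "(nat \<Rightarrow> 'k::field mpoly) set"
  assumes N: "graded_submodule n S N"
  shows "\<exists>E (M :: nat \<Rightarrow> nat \<Rightarrow> 'k mpoly).
    (\<forall>l<length S. \<forall>m<length E. M l m \<in> polys n \<and> (\<forall>a\<in>Poly_Mapping.keys (M l m). S ! l + mdeg a = E ! m))
    \<and> mat_vec (length S) (length E) M ` free_module n (length E) = N"
proof -
  define leads where "leads = {Max (vterms S v) |v e. v \<in> N \<and> hvec n S e v \<and> vterms S v \<noteq> {}}"
  have leads: "l < length S \<and> a \<in> monomials n" if la: "(l, a) \<in> leads" for l a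
  proof -
    obtain v e where v: "(l, a) = Max (vterms S v)" "hvec n S e v" "vterms S v \<noteq> {}" "v \<in> N"
      using la unfolding leads_def by blast
    have "(l, a) \<in> vterms S v" unfolding v(1) using v(3) by simp
    then show ?thesis using vterms_positions[OF v(2)] by blast
  qed
  have "\<exists>L0\<subseteq>leads. finite L0 \<and> (\<forall>(l, a)\<in>leads. \<exists>b\<in>monomials n. \<exists>a'. (l, a') \<in> L0 \<and> a = b + a')"
    by (rule dickson) (rule leads)
  then obtain L0 where L0: "L0 \<subseteq> leads" "finite L0"
    and dom: "\<forall>(l, a)\<in>leads. \<exists>b\<in>monomials n. \<exists>a'. (l, a') \<in> L0 \<and> a = b + a'" by (elim exE conjE)
  have L0': "\<exists>b\<in>monomials n. \<exists>a'. (l, a') \<in> L0 \<and> a = b + a'" if "(l, a) \<in> leads" for l a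
    using bspec[OF dom that] by simp
  have "\<forall>t\<in>L0. \<exists>v e. t = Max (vterms S v) \<and> v \<in> N \<and> hvec n S e v \<and> vterms S v \<noteq> {}"
    using L0(1) unfolding leads_def by blast
  then obtain G D where G: "\<And>t. t \<in> L0 \<Longrightarrow> t = Max (vterms S (G t)) \<and> G t \<in> N \<and> hvec n S (D t) (G t) \<and> vterms S (G t) \<noteq> {}"
    by metis
  obtain ts where ts: "set ts = L0" using finite_list[OF L0(2)] by blast
  define E where "E = map D ts"
  define M where "M l m = G (ts ! m) l" for l m
  let ?img = "mat_vec (length S) (length E) M"
  have GM: "G (ts ! m) \<in> N \<and> hvec n S (E ! m) (G (ts ! m))" if "m < length E" for m
    using that G[of "ts ! m"] ts nth_mem[of m ts] by (auto simp: E_def)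
  have img: "?img v = (\<Sum>m<length E. (\<lambda>l. v m * G (ts ! m) l))" for v
  proof
    fix l
    have "G (ts ! m) l = 0" if "m < length E" "\<not> l < length S" for m
      using GM[OF that(1)] that(2) by (auto simp: hvec_def free_module_def)
    then show "?img v l = (\<Sum>m<length E. (\<lambda>l. v m * G (ts ! m) l)) l"
      by (simp add: mat_vec_def sum_fun_apply M_def mult.commute)
  qed
  have "?img ` free_module n (length E) \<subseteq> N"
  proof (rule image_subsetI)
    fix v :: "nat \<Rightarrow> 'k mpoly" assume v: "v \<in> free_module n (length E)"
    have "(\<lambda>l. v m * G (ts ! m) l) \<in> N" if "m \<in> {..<length E}" for m
      using N GM[of m] v that by (auto simp: graded_submodule_def free_module_def)
    then show "?img v \<in> N" unfolding img by (rule graded_submodule_sum[OF N])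
  qed
  moreover have "N \<subseteq> ?img ` free_module n (length E)"
  proof (rule generated_by_leading_terms[OF N])
    have "?img 0 = 0" by (auto simp: mat_vec_def fun_eq_iff)
    moreover have "0 \<in> (free_module n (length E) :: (nat \<Rightarrow> 'k mpoly) set)" by (simp add: free_module_def)
    ultimately show "0 \<in> ?img ` free_module n (length E)" by (metis imageI)
  next
    fix v w assume "v \<in> ?img ` free_module n (length E)" "w \<in> ?img ` free_module n (length E)"
    then obtain v' w' where *: "v' \<in> free_module n (length E)" "w' \<in> free_module n (length E)" "v = ?img v'" "w = ?img w'" by blast
    have "v + w = ?img (v' + w')" unfolding *(3,4) by (auto simp: mat_vec_def fun_eq_iff distrib_left sum.distrib)
    moreover have "v' + w' \<in> free_module n (length E)" using *(1,2) by (auto simp: free_module_def intro: add_in_polys)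
    ultimately show "v + w \<in> ?img ` free_module n (length E)" by (rule image_eqI)
  next
    fix s :: "'k mpoly" and v assume s: "s \<in> polys n" and "v \<in> ?img ` free_module n (length E)"
    then obtain v' where *: "v' \<in> free_module n (length E)" "v = ?img v'" by blast
    have "(\<lambda>l. s * v l) = ?img (\<lambda>m. s * v' m)" unfolding *(2)
      by (auto simp: mat_vec_def fun_eq_iff sum_distrib_left mult.left_commute)
    moreover have "(\<lambda>m. s * v' m) \<in> free_module n (length E)" using *(1) s by (auto simp: free_module_def intro: mult_in_polys)
    ultimately show "(\<lambda>l. s * v l) \<in> ?img ` free_module n (length E)" by (rule image_eqI)
  next
    fix v e assume v: "v \<in> N" "hvec n S e v" "vterms S v \<noteq> {}"
    obtain l c where lc: "Max (vterms S v) = (l, c)" by (cases "Max (vterms S v)")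
    then have "(l, c) \<in> leads" unfolding leads_def using v by (metis (mono_tags, lifting) mem_Collect_eq)
    then obtain b a where b: "b \<in> monomials n" "(l, a) \<in> L0" "c = b + a" using L0'[of l c] by blast
    obtain m where m: "m < length ts" "ts ! m = (l, a)" using b(2) ts by (metis in_set_conv_nth)
    have "G (l, a) = ?img (\<lambda>i. if i = m then 1 else 0)"
      unfolding img using m by (simp add: fun_eq_iff sum_fun_apply E_def if_distrib[of "\<lambda>x. x * _"] cong: if_cong)
    moreover have "(\<lambda>i. if i = m then 1 else 0 :: 'k mpoly) \<in> free_module n (length E)"
      using m cst_in_polys[of 1 n] by (auto simp: free_module_def E_def)
    ultimately have "G (l, a) \<in> ?img ` free_module n (length E)" by (rule image_eqI)
    then show "\<exists>g\<in>?img ` free_module n (length E) \<inter> N. \<exists>e' l a. \<exists>b\<in>monomials n. hvec n S e' g \<and> vterms S g \<noteq> {}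
        \<and> Max (vterms S g) = (l, a) \<and> Max (vterms S v) = (l, b + a)"
      using G[OF b(2)] b lc by (intro bexI[of _ "G (l, a)"] exI[of _ "D (l, a)"] exI[of _ l] exI[of _ a] bexI[of _ b]) simp_all
  qed
  moreover have "M l m \<in> polys n \<and> (\<forall>a\<in>Poly_Mapping.keys (M l m). S ! l + mdeg a = E ! m)" if "l < length S" "m < length E" for l m
    using hvec_entries[of n S "E ! m" "G (ts ! m)" l] GM[OF that(2)] that(1) by (auto simp: M_def)
  ultimately show ?thesis by (intro exI[of _ E] exI[of _ M]) blast
qed

section \<open>Resolutions by iterated syzygies\<close>

lemma hpart_mat_vec:
  assumes M: "\<And>l m. l < length S \<Longrightarrow> m < length E \<Longrightarrow> M l m \<in> polys n \<and> (\<forall>a\<in>Poly_Mapping.keys (M l m). S ! l + mdeg a = E ! m)"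
  shows "hpart S j (mat_vec (length S) (length E) M w) = mat_vec (length S) (length E) M (hpart E j w)"
proof
  fix l
  have t: "M l m * hpart E j w m = (if S ! l \<le> j then hom_component (j - S ! l) (M l m * w m) else 0)"
    if l: "l < length S" and m: "m < length E" for m
  proof (cases "M l m = 0")
    case True
    then show ?thesis by simp
  next
    case False
    then obtain a where "a \<in> Poly_Mapping.keys (M l m)" by fastforce
    then have le: "S ! l \<le> E ! m" using M[OF l m] by fastforce
    have h: "M l m \<in> hpolys n (E ! m - S ! l)"
      using M[OF l m] unfolding hpolys_iff homogeneous_def by fastforce
    show ?thesis
    proof (cases "E ! m \<le> j")
      case True
      have "M l m * hpart E j w m = hom_component (E ! m - S ! l + (j - E ! m)) (M l m * w m)"
      proof -
        have "hpart E j w m = hom_component (j - E ! m) (w m)" using True m by (simp add: hpart_def)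
        then show ?thesis by (simp only: hom_component_mult[OF h])
      qed
      also have "E ! m - S ! l + (j - E ! m) = j - S ! l" using True le by linarith
      finally show ?thesis using le True by simp
    next
      case False
      then have "S ! l \<le> j \<Longrightarrow> j - S ! l < E ! m - S ! l" by linarith
      then show ?thesis using False hom_component_mult_less[OF h] by (simp add: hpart_def)
    qed
  qed
  then show "hpart S j (mat_vec (length S) (length E) M w) l = mat_vec (length S) (length E) M (hpart E j w) l"
    by (auto simp: hpart_def[of S] mat_vec_def hom_component_sum)
qed

lemma graded_submodule_kernel:
  fixes M :: "nat \<Rightarrow> nat \<Rightarrow> 'k::field mpoly"
  assumes M: "\<And>l m. l < length S \<Longrightarrow> m < length E \<Longrightarrow> M l m \<in> polys n \<and> (\<forall>a\<in>Poly_Mapping.keys (M l m). S ! l + mdeg a = E ! m)"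
  shows "graded_submodule n E {w \<in> free_module n (length E). mat_vec (length S) (length E) M w = (\<lambda>_. 0)}"
  unfolding graded_submodule_def
proof (intro conjI ballI allI)
  let ?mv = "mat_vec (length S) (length E) M"
  let ?K = "{w \<in> free_module n (length E). ?mv w = (\<lambda>_. 0)}"
  show "?K \<subseteq> free_module n (length E)" by blast
  show "0 \<in> ?K" by (auto simp: free_module_def mat_vec_def fun_eq_iff)
  fix v assume v: "v \<in> ?K"
  show "v + w \<in> ?K" if w: "w \<in> ?K" for w
  proof -
    have "?mv (v + w) = ?mv v + ?mv w" by (auto simp: mat_vec_def fun_eq_iff distrib_left sum.distrib)
    then show ?thesis using v w by (auto simp: free_module_def fun_eq_iff intro: add_in_polys)
  qed
  show "hpart E j v \<in> ?K" for j
  proof -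
    have "hpart E j v \<in> free_module n (length E)" using hpart_hvec[of v n E j] v by (auto simp: hvec_def)
    moreover have "?mv (hpart E j v) = hpart S j (\<lambda>_. 0)" using hpart_mat_vec[OF M, of j v] v by simp
    moreover have "hpart S j (\<lambda>_. 0) = (\<lambda>_. 0)" by (auto simp: hpart_def fun_eq_iff)
    ultimately show ?thesis by simp
  qed
next
  fix s :: "'k mpoly" and v assume s: "s \<in> polys n" and v: "v \<in> {w \<in> free_module n (length E). mat_vec (length S) (length E) M w = (\<lambda>_. 0)}"
  have "mat_vec (length S) (length E) M (\<lambda>l. s * v l) = (\<lambda>l. s * mat_vec (length S) (length E) M v l)"
    by (auto simp: mat_vec_def fun_eq_iff sum_distrib_left mult.left_commute)
  then show "(\<lambda>l. s * v l) \<in> {w \<in> free_module n (length E). mat_vec (length S) (length E) M w = (\<lambda>_. 0)}"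
    using v s by (auto simp: free_module_def intro: mult_in_polys)
qed

theorem graded_free_resolution_exists:
  fixes I :: "'k::field mpoly set"
  assumes I: "graded_ideal n I"
  shows "\<exists>F. graded_free_resolution n I F"
proof -
  \<comment> \<open>The ideal becomes a submodule of the free module of rank one with shift 0, so
    the augmentation is obtained like every other map.\<close>
  let ?N = "(\<lambda>p l. if l = 0 then p else 0) ` I :: (nat \<Rightarrow> 'k mpoly) set"
  have N: "graded_submodule n [0] ?N"
    unfolding graded_submodule_def
  proof (intro conjI ballI allI)
    have I': "I \<subseteq> polys n" "0 \<in> I" "\<And>p q. p \<in> I \<Longrightarrow> q \<in> I \<Longrightarrow> p + q \<in> I" "\<And>s p. s \<in> polys n \<Longrightarrow> p \<in> I \<Longrightarrow> s * p \<in> I"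
      "\<And>p j. p \<in> I \<Longrightarrow> hom_component j p \<in> I"
      using I by (auto simp: graded_ideal_def is_ideal_def)
    show "?N \<subseteq> free_module n (length [0])" using I'(1) by (auto simp: free_module_def)
    show "0 \<in> ?N" by (rule image_eqI[of _ _ 0]) (auto simp: I'(2))
    { fix v w :: "nat \<Rightarrow> 'k mpoly" assume "v \<in> ?N" "w \<in> ?N"
      then obtain p q where pq: "p \<in> I" "q \<in> I" "v = (\<lambda>l. if l = 0 then p else 0)" "w = (\<lambda>l. if l = 0 then q else 0)" by blast
      show "v + w \<in> ?N" by (rule image_eqI[of _ _ "p + q"]) (auto simp: pq I'(3)) }
    { fix s :: "'k mpoly" and v assume s: "s \<in> polys n" and "v \<in> ?N"
      then obtain p where p: "p \<in> I" "v = (\<lambda>l. if l = 0 then p else 0)" by blast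
      show "(\<lambda>l. s * v l) \<in> ?N" by (rule image_eqI[of _ _ "s * p"]) (auto simp: p s I'(4)) }
    { fix v :: "nat \<Rightarrow> 'k mpoly" and j assume "v \<in> ?N"
      then obtain p where p: "p \<in> I" "v = (\<lambda>l. if l = 0 then p else 0)" by blast
      show "hpart [0] j v \<in> ?N" by (rule image_eqI[of _ _ "hom_component j p"]) (auto simp: p I'(5) hpart_def) }
  qed
  define P where "P x \<longleftrightarrow> (case x of (S, E, M) \<Rightarrow>
      \<forall>l<length S. \<forall>m<length E. M l m \<in> polys n \<and> (\<forall>a\<in>Poly_Mapping.keys (M l m). S ! l + mdeg a = E ! m))"
    for x :: "nat list \<times> nat list \<times> (nat \<Rightarrow> nat \<Rightarrow> 'k mpoly)"
  define im where "im x = (case x of (S, E, M) \<Rightarrow> mat_vec (length S) (length E) M ` free_module n (length E))"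
    for x :: "nat list \<times> nat list \<times> (nat \<Rightarrow> nat \<Rightarrow> 'k mpoly)"
  define ker where "ker x = (case x of (S, E, M) \<Rightarrow> {w \<in> free_module n (length E). mat_vec (length S) (length E) M w = (\<lambda>_. 0)})"
    for x :: "nat list \<times> nat list \<times> (nat \<Rightarrow> nat \<Rightarrow> 'k mpoly)"
  have gen: "\<exists>y. P y \<and> fst y = S \<and> im y = N'" if N': "graded_submodule n S N'" for S and N' :: "(nat \<Rightarrow> 'k mpoly) set"
  proof -
    obtain E M where "\<forall>l<length S. \<forall>m<length E. M l m \<in> polys n \<and> (\<forall>a\<in>Poly_Mapping.keys (M l m). S ! l + mdeg a = E ! m)"
      "mat_vec (length S) (length E) M ` free_module n (length E) = N'"
      using graded_submodule_finitely_generated[OF N'] by blast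
    then show ?thesis by (intro exI[of _ "(S, E, M)"]) (simp add: P_def im_def)
  qed
  have ker: "graded_submodule n (fst (snd x)) (ker x)" if "P x" for x
  proof -
    obtain S E M where x: "x = (S, E, M)" by (cases x)
    show ?thesis unfolding ker_def x using that
      by (simp add: x P_def graded_submodule_kernel)
  qed
  \<comment> \<open>A stage records the row shifts, the column shifts and the matrix of a map. The
    next stage has the kernel of the present one as its image, so its row shifts are the present
    column shifts.\<close>
  have "\<exists>h. \<forall>i. (P (h i) \<and> (i = 0 \<longrightarrow> fst (h i) = [0] \<and> im (h i) = ?N)) \<and> (fst (h (Suc i)) = fst (snd (h i)) \<and> im (h (Suc i)) = ker (h i))"
  proof (rule dependent_nat_choice)
    show "\<exists>x. P x \<and> (0 = (0::nat) \<longrightarrow> fst x = [0] \<and> im x = ?N)" using gen[OF N] by simp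
    fix x :: "nat list \<times> nat list \<times> (nat \<Rightarrow> nat \<Rightarrow> 'k mpoly)" and i :: nat
    assume "P x \<and> (i = 0 \<longrightarrow> fst x = [0] \<and> im x = ?N)"
    then have "P x" by simp
    from gen[OF ker[OF this]] show "\<exists>y. (P y \<and> (Suc i = 0 \<longrightarrow> fst y = [0] \<and> im y = ?N)) \<and> (fst y = fst (snd x) \<and> im y = ker x)"
      by simp
  qed
  then obtain h where hh: "\<forall>i. (P (h i) \<and> (i = 0 \<longrightarrow> fst (h i) = [0] \<and> im (h i) = ?N)) \<and> (fst (h (Suc i)) = fst (snd (h i)) \<and> im (h (Suc i)) = ker (h i))"
    by (elim exE)
  have h: "P (h i)" "fst (h 0) = [0]" "im (h 0) = ?N" "fst (h (Suc i)) = fst (snd (h i))" "im (h (Suc i)) = ker (h i)" for i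
    using hh[rule_format, of i] hh[rule_format, of 0] by simp_all
  define E where "E i = fst (snd (h i))" for i
  define M where "M i = snd (snd (h i))" for i
  have h0: "h 0 = ([0], E 0, M 0)" using h(2) by (simp add: E_def M_def prod_eq_iff)
  have hS: "h (Suc i) = (E i, E (Suc i), M (Suc i))" for i using h(4) by (simp add: E_def M_def prod_eq_iff)
  define F where "F = \<lparr>shifts = E, aug = M 0 0, diff = (\<lambda>i. M (Suc i))\<rparr>"
  have fr: "frank F i = length (E i)" for i by (simp add: frank_def F_def)
  have aug: "mat_vec (length [0::nat]) (length (E 0)) (M 0) v = (\<lambda>l. if l = 0 then aug_map F v else 0)" for v
  proof -
    have "aug F = M 0 0" by (simp add: F_def)
    then show ?thesis by (auto simp: mat_vec_def aug_map_def fr fun_eq_iff)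
  qed
  have dm: "diff_map F i v = mat_vec (length (E i)) (length (E (Suc i))) (M (Suc i)) v" for i v
  proof -
    have "diff F i = M (Suc i)" by (simp add: F_def)
    then show ?thesis by (simp add: diff_map_def fr)
  qed
  have "graded_free_resolution n I F"
    unfolding graded_free_resolution_def
  proof (intro conjI)
    show "\<forall>m<frank F 0. aug F m \<in> polys n \<and> homogeneous (shifts F 0 ! m) (aug F m)"
      using h(1)[of 0] unfolding fr by (simp add: h0 P_def F_def homogeneous_def)
    show "\<forall>i. \<forall>l<frank F i. \<forall>m<frank F (Suc i). diff F i l m \<in> polys n \<and>
        (\<forall>a\<in>Poly_Mapping.keys (diff F i l m). shifts F i ! l + mdeg a = shifts F (Suc i) ! m)"
      using h(1)[of "Suc _"] unfolding fr by (simp add: hS P_def F_def)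
    have a0: "(\<lambda>l. if l = 0 then p else 0) = (\<lambda>l. if l = (0::nat) then q else 0) \<longleftrightarrow> p = q" for p q :: "'k mpoly"
      by (metis (full_types))
    have "(\<lambda>p l. if l = 0 then p else 0) ` aug_map F ` free_module n (frank F 0) = ?N"
      using h(3) unfolding im_def h0 prod.case aug fr image_image .
    moreover have "inj (\<lambda>p l. if l = (0::nat) then p else (0 :: 'k mpoly))" using a0 by (auto simp: inj_def)
    ultimately show "aug_map F ` free_module n (frank F 0) = I" by (simp add: inj_image_eq_iff)
    have "ker (h 0) = {v \<in> free_module n (frank F 0). aug_map F v = 0}"
    proof -
      have "(\<lambda>l. if l = (0::nat) then aug_map F v else 0) = (\<lambda>_. 0) \<longleftrightarrow> aug_map F v = 0" for v
        using a0[of "aug_map F v" 0] by simp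
      then show ?thesis unfolding ker_def h0 prod.case aug fr by simp
    qed
    moreover have "im (h (Suc i)) = diff_map F i ` free_module n (frank F (Suc i))" for i
      unfolding im_def hS prod.case fr by (simp add: dm)
    moreover have "ker (h (Suc i)) = {v \<in> free_module n (frank F (Suc i)). diff_map F i v = (\<lambda>_. 0)}" for i
      unfolding ker_def hS prod.case fr by (simp add: dm)
    ultimately show "{v \<in> free_module n (frank F 0). aug_map F v = 0} = diff_map F 0 ` free_module n (frank F 1)"
      "\<forall>i. {v \<in> free_module n (frank F (Suc i)). diff_map F i v = (\<lambda>_. 0)} =
       diff_map F (Suc i) ` free_module n (frank F (Suc (Suc i)))"
      using h(5) by (metis One_nat_def)+
  qed
  then show ?thesis by blast
qed

section \<open>Restriction to hyperplanes\<close>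

subsection \<open>Substituting a linear form for the last variable\<close>

definition linform :: "nat \<Rightarrow> (nat \<Rightarrow> 'k::field) \<Rightarrow> 'k mpoly" where
  "linform n c = (\<Sum>j<n. cst (c j) * var j)"

definition drop_var :: "nat \<Rightarrow> monomial \<Rightarrow> monomial" where
  "drop_var n a = a - Poly_Mapping.single n (expo a n)"

text \<open>\<open>subst_last n c\<close> restricts a polynomial in \<open>x\<^sub>0, \<dots>, x\<^sub>n\<close> to the hyperplane \<open>x\<^sub>n = \<Sum>\<^sub>j c\<^sub>j x\<^sub>j\<close>.\<close>

definition subst_last :: "nat \<Rightarrow> (nat \<Rightarrow> 'k::field) \<Rightarrow> 'k mpoly \<Rightarrow> 'k mpoly" where
  "subst_last n c p = (\<Sum>a\<in>Poly_Mapping.keys p. Poly_Mapping.single (drop_var n a) (Poly_Mapping.lookup p a) * linform n c ^ expo a n)"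

lemma expo_drop_var: "expo (drop_var n a) l = (if l = n then 0 else expo a l)"
  by (simp add: drop_var_def lookup_minus lookup_single when_def)

lemma drop_var_add: "drop_var n (a + b) = drop_var n a + drop_var n b"
  by (rule poly_mapping_eqI) (simp add: expo_drop_var lookup_add)

lemma drop_var_decomp: "a = drop_var n a + Poly_Mapping.single n (expo a n)"
  by (rule poly_mapping_eqI) (simp add: expo_drop_var lookup_add lookup_single when_def)

lemma drop_var_monomials: "a \<in> monomials n \<Longrightarrow> drop_var n a = a"
  by (rule poly_mapping_eqI) (auto simp: expo_drop_var monomials_iff)

lemma drop_var_hmons: "a \<in> hmons (Suc n) d \<Longrightarrow> drop_var n a \<in> hmons n (d - expo a n) \<and> expo a n \<le> d"
proof -
  assume a: "a \<in> hmons (Suc n) d"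
  have "d = mdeg (drop_var n a) + expo a n"
    using a drop_var_decomp[of a n] by (metis (mono_tags, lifting) hmons_def mdeg_add mdeg_single mem_Collect_eq)
  moreover have "drop_var n a \<in> monomials n" using a by (auto simp: monomials_iff expo_drop_var hmons_def)
  ultimately show ?thesis by (simp add: hmons_def)
qed

lemma subst_last_superset:
  assumes "finite A" "Poly_Mapping.keys p \<subseteq> A"
  shows "subst_last n c p = (\<Sum>a\<in>A. Poly_Mapping.single (drop_var n a) (Poly_Mapping.lookup p a) * linform n c ^ expo a n)"
  unfolding subst_last_def by (rule sum.mono_neutral_left) (use assms in \<open>auto simp: in_keys_iff\<close>)

lemma subst_last_add: "subst_last n c (p + q) = subst_last n c p + subst_last n c q"
proof -
  let ?A = "Poly_Mapping.keys p \<union> Poly_Mapping.keys q"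
  have "subst_last n c (p + q) = (\<Sum>a\<in>?A. Poly_Mapping.single (drop_var n a) (Poly_Mapping.lookup (p + q) a) * linform n c ^ expo a n)"
    by (rule subst_last_superset) (simp_all add: keys_add)
  moreover have "subst_last n c p = (\<Sum>a\<in>?A. Poly_Mapping.single (drop_var n a) (Poly_Mapping.lookup p a) * linform n c ^ expo a n)"
    by (rule subst_last_superset) simp_all
  moreover have "subst_last n c q = (\<Sum>a\<in>?A. Poly_Mapping.single (drop_var n a) (Poly_Mapping.lookup q a) * linform n c ^ expo a n)"
    by (rule subst_last_superset) simp_all
  ultimately show ?thesis by (simp add: lookup_add single_add distrib_right sum.distrib)
qed

lemma subst_last_zero [simp]: "subst_last n c 0 = 0"
  by (simp add: subst_last_def)

lemma subst_last_single: "subst_last n c (Poly_Mapping.single a x) = Poly_Mapping.single (drop_var n a) x * linform n c ^ expo a n"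
  by (subst subst_last_superset[of "{a}"]) simp_all

lemma subst_last_mult: "subst_last n c (p * q) = subst_last n c p * subst_last n c q"
proof -
  have s: "subst_last n c (Poly_Mapping.single a x * Poly_Mapping.single b y)
     = subst_last n c (Poly_Mapping.single a x) * subst_last n c (Poly_Mapping.single b y)" for a b x y
  proof -
    have "Poly_Mapping.single (drop_var n a + drop_var n b) (x * y)
      = Poly_Mapping.single (drop_var n a) x * Poly_Mapping.single (drop_var n b) y" by (simp add: mult_single)
    then show ?thesis
      unfolding mult_single[of a x b y] subst_last_single drop_var_add lookup_add power_add
      by (simp only: mult_ac)
  qed
  have "subst_last n c (Poly_Mapping.single a x * q) = subst_last n c (Poly_Mapping.single a x) * subst_last n c q" for a x
    by (induction q rule: poly_induct_sum) (simp_all only: s subst_last_add distrib_left mult_zero_right subst_last_zero)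
  then show ?thesis
    by (induction p rule: poly_induct_sum) (simp_all only: subst_last_add distrib_right mult_zero_left subst_last_zero)
qed

lemma subst_last_polys: "p \<in> polys n \<Longrightarrow> subst_last n c p = p"
proof -
  assume p: "p \<in> polys n"
  have "subst_last n c p = (\<Sum>a\<in>Poly_Mapping.keys p. Poly_Mapping.single a (Poly_Mapping.lookup p a))"
    unfolding subst_last_def
  proof (rule sum.cong[OF refl])
    fix a assume "a \<in> Poly_Mapping.keys p"
    then have "a \<in> monomials n" using p by (auto simp: polys_def)
    then show "Poly_Mapping.single (drop_var n a) (Poly_Mapping.lookup p a) * linform n c ^ expo a n = Poly_Mapping.single a (Poly_Mapping.lookup p a)"
      by (simp add: drop_var_monomials monomials_iff)
  qed
  then show ?thesis using poly_eq_sum_single[of p] by simp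
qed

lemma subst_last_scale: "subst_last n c (cst x * p) = cst x * subst_last n c p"
  by (simp add: subst_last_mult subst_last_polys)

lemma subst_last_diff: "subst_last n c (p - q) = subst_last n c p - subst_last n c q"
proof -
  have "subst_last n c p = subst_last n c (p - q) + subst_last n c q" unfolding subst_last_add[symmetric] by simp
  then show ?thesis by simp
qed

lemma linear_subst_last: "Vector_Spaces.linear pscale pscale (subst_last n c)"
  by (rule linear_pfI) (simp_all only: subst_last_add subst_last_scale)

lemma linform_in_hpolys: "linform n c \<in> hpolys n 1"
  unfolding linform_def by (intro sum_in_hpolys cst_mult_in_hpolys var_in_hpolys) simp

lemma power_in_hpolys: "p \<in> hpolys n 1 \<Longrightarrow> p ^ e \<in> hpolys n e"
proof (induction e)
  case 0
  show ?case using cst_in_hpolys[of 1 n] by simp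
next
  case (Suc e)
  then show ?case using mult_in_hpolys[of p n 1 "p ^ e" e] by simp
qed

lemma hpolys_mono: "p \<in> hpolys n d \<Longrightarrow> p \<in> hpolys (Suc n) d"
  by (auto simp: hpolys_def hmons_def monomials_iff)

lemma subst_last_in_hpolys: "p \<in> hpolys (Suc n) d \<Longrightarrow> subst_last n c p \<in> hpolys n d"
  unfolding subst_last_def
proof (rule sum_in_hpolys)
  fix a assume "p \<in> hpolys (Suc n) d" "a \<in> Poly_Mapping.keys p"
  then have a: "a \<in> hmons (Suc n) d" by (auto simp: hpolys_def)
  have "Poly_Mapping.single (drop_var n a) (Poly_Mapping.lookup p a) * linform n c ^ expo a n \<in> hpolys n (d - expo a n + expo a n)"
    using drop_var_hmons[OF a] by (intro mult_in_hpolys single_in_hpolys power_in_hpolys linform_in_hpolys) auto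
  then show "Poly_Mapping.single (drop_var n a) (Poly_Mapping.lookup p a) * linform n c ^ expo a n \<in> hpolys n d"
    using drop_var_hmons[OF a] by simp
qed

text \<open>The equation of the hyperplane; having coefficient 1 at the last variable, it is nonzero
  for every \<open>c\<close>.\<close>

definition hyper :: "nat \<Rightarrow> (nat \<Rightarrow> 'k::field) \<Rightarrow> 'k mpoly" where
  "hyper n c = var n - linform n c"

lemma subst_last_var: "subst_last n c (var n) = linform n c"
proof -
  have "drop_var n (mvar n) = 0" by (rule poly_mapping_eqI) (simp add: expo_drop_var)
  then show ?thesis by (simp add: subst_last_single)
qed

lemma subst_last_hyper [simp]: "subst_last n c (hyper n c) = 0"
  unfolding hyper_def subst_last_diff subst_last_var
  by (simp add: subst_last_polys[OF hpolys_subset_polys[OF linform_in_hpolys]])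

lemma hyper_in_hpolys: "hyper n c \<in> hpolys (Suc n) 1"
  unfolding hyper_def
  by (rule pvec.subspace_diff[OF subspace_hpolys]) (simp_all add: var_in_hpolys hpolys_mono linform_in_hpolys del: One_nat_def)

lemma coeff_linform_out: "mcoeff (linform n c) (mvar n) = 0"
proof -
  have "mvar n \<notin> hmons n 1" by (auto simp: hmons_def monomials_iff)
  then show ?thesis using linform_in_hpolys[of n c] by (auto simp: hpolys_def in_keys_iff)
qed

lemma hyper_nonzero: "hyper n c \<noteq> 0"
proof
  assume "hyper n c = 0"
  then have "mcoeff (hyper n c) (mvar n) = 0" by simp
  then show False by (simp add: hyper_def lookup_minus coeff_linform_out)
qed

text \<open>On each term this is the divisibility of a difference of equal powers by the difference
  of the bases. Hence a form of positive degree that vanishes on the hyperplane is a multiple of its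
  equation.\<close>

lemma hyper_divides:
  assumes "p \<in> hpolys (Suc n) (Suc d)"
  shows "\<exists>q\<in>hpolys (Suc n) d. p - subst_last n c p = hyper n c * q"
proof -
  let ?P = "\<lambda>p. \<exists>q\<in>hpolys (Suc n) d. p - subst_last n c p = hyper n c * q"
  have "?P (Poly_Mapping.single a x)" if a: "a \<in> hmons (Suc n) (Suc d)" for a x
  proof (cases "expo a n")
    case 0
    then have "a \<in> monomials n" using drop_var_hmons[OF a] drop_var_decomp[of a n] by (simp add: hmons_def)
    then have "subst_last n c (Poly_Mapping.single a x) = Poly_Mapping.single a x"
      by (intro subst_last_polys single_in_polys)
    then show ?thesis by (intro bexI[of _ 0]) simp_all
  next
    case (Suc e)
    define b where "b = drop_var n a"
    have b: "b \<in> hmons n (d - e)" "e \<le> d" using drop_var_hmons[OF a] Suc by (simp_all add: b_def)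
    have pow: "var n ^ k = Poly_Mapping.single (Poly_Mapping.single n k) (1 :: 'a)" for k
      by (induction k) (simp_all add: mult_single mvar_def single_add[symmetric])
    have "Poly_Mapping.single a x = Poly_Mapping.single b x * var n ^ Suc e"
      unfolding pow mult_single using drop_var_decomp[of a n] Suc by (simp add: b_def)
    then have "Poly_Mapping.single a x - subst_last n c (Poly_Mapping.single a x) = Poly_Mapping.single b x * (var n ^ Suc e - linform n c ^ Suc e)"
      unfolding subst_last_single Suc b_def[symmetric] by (simp only: right_diff_distrib)
    also have "\<dots> = hyper n c * (Poly_Mapping.single b x * (\<Sum>i<Suc e. linform n c ^ (Suc e - Suc i) * var n ^ i))"
      unfolding power_diff_sumr2[of "var n" "Suc e" "linform n c"] hyper_def by (simp only: mult_ac)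
    finally have eq: "Poly_Mapping.single a x - subst_last n c (Poly_Mapping.single a x)
       = hyper n c * (Poly_Mapping.single b x * (\<Sum>i<Suc e. linform n c ^ (Suc e - Suc i) * var n ^ i))" .
    have "(\<Sum>i<Suc e. linform n c ^ (Suc e - Suc i) * var n ^ i) \<in> hpolys (Suc n) e"
    proof (rule sum_in_hpolys)
      fix i assume "i \<in> {..<Suc e}"
      then have "Suc e - Suc i + i = e" by simp
      moreover have "linform n c ^ (Suc e - Suc i) * var n ^ i \<in> hpolys (Suc n) (Suc e - Suc i + i)"
        by (intro mult_in_hpolys power_in_hpolys hpolys_mono linform_in_hpolys var_in_hpolys) simp
      ultimately show "linform n c ^ (Suc e - Suc i) * var n ^ i \<in> hpolys (Suc n) e" by simp
    qed
    then have "Poly_Mapping.single b x * (\<Sum>i<Suc e. linform n c ^ (Suc e - Suc i) * var n ^ i) \<in> hpolys (Suc n) (d - e + e)"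
      by (rule mult_in_hpolys[OF hpolys_mono[OF single_in_hpolys[OF b(1)]]])
    then have mem: "Poly_Mapping.single b x * (\<Sum>i<Suc e. linform n c ^ (Suc e - Suc i) * var n ^ i) \<in> hpolys (Suc n) d"
      using b(2) by simp
    show ?thesis by (rule bexI, rule eq, rule mem)
  qed
  moreover have "a \<in> hmons (Suc n) (Suc d)" if "a \<in> Poly_Mapping.keys p" for a using that assms by (auto simp: hpolys_def)
  ultimately have step: "?P (Poly_Mapping.single a (Poly_Mapping.lookup p a))" if "a \<in> Poly_Mapping.keys p" for a
    using that by blast
  have "?P (\<Sum>a\<in>B. Poly_Mapping.single a (Poly_Mapping.lookup p a))" if B: "finite B" "B \<subseteq> Poly_Mapping.keys p" for B
    using B
  proof (induction B rule: finite_induct)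
    case empty
    show ?case by (intro bexI[of _ 0]) simp_all
  next
    case (insert a B)
    obtain q where q: "q \<in> hpolys (Suc n) d" "(\<Sum>a\<in>B. Poly_Mapping.single a (Poly_Mapping.lookup p a))
       - subst_last n c (\<Sum>a\<in>B. Poly_Mapping.single a (Poly_Mapping.lookup p a)) = hyper n c * q"
      using insert.IH insert.prems by auto
    obtain q' where q': "q' \<in> hpolys (Suc n) d" "Poly_Mapping.single a (Poly_Mapping.lookup p a)
       - subst_last n c (Poly_Mapping.single a (Poly_Mapping.lookup p a)) = hyper n c * q'"
      using step[of a] insert.prems by auto
    show ?case
    proof (intro bexI)
      show "q' + q \<in> hpolys (Suc n) d" using q q' add_in_hpolys by blast
      show "(\<Sum>a\<in>insert a B. Poly_Mapping.single a (Poly_Mapping.lookup p a))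
       - subst_last n c (\<Sum>a\<in>insert a B. Poly_Mapping.single a (Poly_Mapping.lookup p a)) = hyper n c * (q' + q)"
        unfolding sum.insert[OF insert.hyps] subst_last_add distrib_left q(2)[symmetric] q'(2)[symmetric] by simp
    qed
  qed
  from this[OF finite_keys order_refl] show ?thesis using poly_eq_sum_single[of p] by simp
qed

lemma linear_mult: "Vector_Spaces.linear pscale pscale (\<lambda>q. (p :: 'k::field mpoly) * q)"
  by (rule linear_pfI) (simp_all add: distrib_left mult.left_commute)

lemma dim_mult_image:
  fixes p :: "'k::field mpoly"
  assumes "p \<noteq> 0" "pvec.subspace U" "fin_dim pscale U"
  shows "pvec.dim ((\<lambda>q. p * q) ` U) = pvec.dim U"
  by (rule dim_inj_image[OF linear_mult assms(2,3)]) (use assms(1) in simp)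

subsection \<open>Generic rank\<close>

text \<open>Line-open sets play the role of Zariski open sets.\<close>

definition line_open :: "(nat \<Rightarrow> 'k::field) set \<Rightarrow> bool" where
  "line_open X \<longleftrightarrow> (\<forall>c\<in>X. \<forall>v. finite {t. (\<lambda>j. c j + t * v j) \<notin> X})"

lemma line_open_Int:
  fixes X Y :: "(nat \<Rightarrow> 'k::field) set"
  shows "line_open X \<Longrightarrow> line_open Y \<Longrightarrow> line_open (X \<inter> Y)"
  unfolding line_open_def
proof (intro ballI allI)
  fix c :: "nat \<Rightarrow> 'k" and v
  assume X: "\<forall>c\<in>X. \<forall>v. finite {t. (\<lambda>j. c j + t * v j) \<notin> X}" and Y: "\<forall>c\<in>Y. \<forall>v. finite {t. (\<lambda>j. c j + t * v j) \<notin> Y}"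
    and c: "c \<in> X \<inter> Y"
  have "{t. (\<lambda>j. c j + t * v j) \<notin> X \<inter> Y} = {t. (\<lambda>j. c j + t * v j) \<notin> X} \<union> {t. (\<lambda>j. c j + t * v j) \<notin> Y}" by auto
  then show "finite {t. (\<lambda>j. c j + t * v j) \<notin> X \<inter> Y}" using X Y c by simp
qed

text \<open>On the line through \<open>p\<close> and \<open>q\<close>, all but finitely many
  parameters lead into \<open>X\<close>, as seen from \<open>p\<close>, and into \<open>Y\<close>,
  as seen from \<open>q\<close> with the parameter reversed. The infinite field supplies a parameter
  outside both exceptional sets.\<close>

lemma line_open_Int_nonempty:
  fixes X Y :: "(nat \<Rightarrow> 'k::field) set"
  assumes inf: "infinite (UNIV :: 'k set)" and X: "line_open X" "p \<in> X" and Y: "line_open Y" "q \<in> Y"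
  shows "\<exists>c. c \<in> X \<inter> Y"
proof -
  let ?A = "{t. (\<lambda>j. p j + t * (q j - p j)) \<notin> X}"
  let ?B = "{t. (\<lambda>j. q j + t * (p j - q j)) \<notin> Y}"
  have A: "finite ?A" and B: "finite ?B" using X Y unfolding line_open_def by auto
  obtain t where t: "t \<notin> ?A \<union> (\<lambda>t. 1 - t) ` ?B"
    using ex_new_if_finite[OF inf, of "?A \<union> (\<lambda>t. 1 - t) ` ?B"] A B by auto
  have "1 - t \<notin> ?B"
  proof
    assume "1 - t \<in> ?B"
    then have "1 - (1 - t) \<in> (\<lambda>t. 1 - t) ` ?B" by (rule imageI)
    then show False using t by simp
  qed
  then have "(\<lambda>j. q j + (1 - t) * (p j - q j)) \<in> Y" by simp
  moreover have "(\<lambda>j. q j + (1 - t) * (p j - q j)) = (\<lambda>j. p j + t * (q j - p j))"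
    by (simp add: fun_eq_iff algebra_simps)
  ultimately show ?thesis using t by auto
qed

text \<open>Fraction-free Gaussian elimination: the last vector has an entry that is nonzero at
  \<open>t0\<close> and so has finitely many roots; away from them, independence follows from that
  of the other \<open>r\<close> vectors with this column cleared. Using one pivot at a time allows
  infinitely many entries.\<close>

lemma independent_open:
  fixes Q :: "nat \<Rightarrow> 'b \<Rightarrow> 'k::field poly"
  defines "ind \<equiv> \<lambda>r (Q :: nat \<Rightarrow> 'b \<Rightarrow> 'k poly) t. \<forall>\<alpha>. (\<forall>b. (\<Sum>i<r. \<alpha> i * poly (Q i b) t) = 0) \<longrightarrow> (\<forall>i<r. \<alpha> i = 0)"
  assumes "ind r Q t0"
  shows "finite {t. \<not> ind r Q t}"
  using assms(2)
proof (induction r arbitrary: Q)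
  case 0
  show ?case by (simp add: ind_def)
next
  case (Suc r)
  have "\<exists>b. poly (Q r b) t0 \<noteq> 0"
  proof (rule ccontr)
    assume *: "\<not> ?thesis"
    define \<delta> where "\<delta> i = (if i = r then 1 else 0 :: 'k)" for i
    have z: "\<forall>b. (\<Sum>i<Suc r. \<delta> i * poly (Q i b) t0) = 0" using * by (simp add: \<delta>_def)
    have "\<forall>i<Suc r. \<delta> i = 0" by (rule mp[OF spec[OF Suc.prems[unfolded ind_def], of \<delta>] z])
    then have "\<delta> r = 0" by simp
    then show False by (simp add: \<delta>_def)
  qed
  then obtain b where b: "poly (Q r b) t0 \<noteq> 0" by blast
  define Q' where "Q' i b' = Q r b * Q i b' - Q i b * Q r b'" for i b'
  have eval: "(\<Sum>i<r. \<alpha> i * poly (Q' i b') t) = (\<Sum>i<r. (\<alpha> i * poly (Q r b) t) * poly (Q i b') t)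
      + (- (\<Sum>i<r. \<alpha> i * poly (Q i b) t)) * poly (Q r b') t" for \<alpha> b' t
    by (simp add: Q'_def algebra_simps sum_subtractf sum_distrib_left)
  have "ind r Q' t0"
    unfolding ind_def
  proof (intro allI impI)
    fix \<alpha> i assume z: "\<forall>b'. (\<Sum>i<r. \<alpha> i * poly (Q' i b') t0) = 0" and i: "i < r"
    define \<beta> where "\<beta> i = (if i < r then \<alpha> i * poly (Q r b) t0 else - (\<Sum>i<r. \<alpha> i * poly (Q i b) t0))" for i
    have "(\<Sum>i<Suc r. \<beta> i * poly (Q i b') t0) = 0" for b'
      using z[rule_format, of b'] unfolding eval by (simp add: \<beta>_def)
    then have z': "\<forall>b'. (\<Sum>i<Suc r. \<beta> i * poly (Q i b') t0) = 0" by (rule allI)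
    have "\<forall>i<Suc r. \<beta> i = 0" by (rule mp[OF spec[OF Suc.prems[unfolded ind_def], of \<beta>] z'])
    then have "\<beta> i = 0" using i by simp
    then show "\<alpha> i = 0" using i b by (simp add: \<beta>_def)
  qed
  then have fin: "finite {t. \<not> ind r Q' t}" by (rule Suc.IH)
  have "Q r b \<noteq> 0" using b by auto
  then have fin2: "finite {t. poly (Q r b) t = 0}" by (rule poly_roots_finite)
  have "ind (Suc r) Q t" if t: "ind r Q' t" "poly (Q r b) t \<noteq> 0" for t
    unfolding ind_def
  proof (intro allI impI)
    fix \<alpha> i assume z: "\<forall>b'. (\<Sum>i<Suc r. \<alpha> i * poly (Q i b') t) = 0" and i: "i < Suc r"
    have s: "(\<Sum>i<r. \<alpha> i * poly (Q i b') t) = - (\<alpha> r * poly (Q r b') t)" for b'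
      using z[rule_format, of b'] by (simp add: eq_neg_iff_add_eq_0)
    have "(\<Sum>i<r. \<alpha> i * poly (Q' i b') t) = 0" for b'
    proof -
      have "(\<Sum>i<r. (\<alpha> i * poly (Q r b) t) * poly (Q i b') t) = poly (Q r b) t * (\<Sum>i<r. \<alpha> i * poly (Q i b') t)"
        by (simp add: sum_distrib_left mult_ac)
      then show ?thesis unfolding eval s by (simp add: mult_ac)
    qed
    then have z': "\<forall>b'. (\<Sum>i<r. \<alpha> i * poly (Q' i b') t) = 0" by (rule allI)
    have "\<forall>i<r. \<alpha> i = 0" by (rule mp[OF spec[OF t(1)[unfolded ind_def], of \<alpha>] z'])
    then have 0: "\<alpha> i = 0" if "i < r" for i using that by simp
    then have "\<alpha> r * poly (Q r b) t = 0" using s[of b] by simp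
    then have "\<alpha> r = 0" using t(2) by simp
    then show "\<alpha> i = 0" using 0 i by (cases "i = r") auto
  qed
  then have "{t. \<not> ind (Suc r) Q t} \<subseteq> {t. \<not> ind r Q' t} \<union> {t. poly (Q r b) t = 0}" by blast
  then show ?case using fin fin2 finite_subset by blast
qed

lemma subst_last_poly_family:
  fixes c v :: "nat \<Rightarrow> 'k::field"
  shows "\<exists>P. \<forall>t. subst_last n (\<lambda>j. c j + t * v j) u = poly P (cst t)"
proof -
  let ?l = "\<Sum>j<n. [:cst (c j) * var j, cst (v j) * var j:]"
  have l: "linform n (\<lambda>j. c j + t * v j) = poly ?l (cst t)" for t
    unfolding poly_sum linform_def
    by (rule sum.cong[OF refl])
      (simp only: poly_pCons poly_0 single_add cst_mult distrib_right mult_zero_right add_0_right mult.assoc)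
  let ?P = "\<Sum>a\<in>Poly_Mapping.keys u. [:Poly_Mapping.single (drop_var n a) (Poly_Mapping.lookup u a):] * ?l ^ expo a n"
  have "subst_last n (\<lambda>j. c j + t * v j) u = poly ?P (cst t)" for t
    unfolding subst_last_def l by (simp add: poly_sum)
  then show ?thesis by blast
qed

lemma coeff_poly_cst:
  fixes P :: "'k::field mpoly poly"
  shows "\<exists>Q. \<forall>t. Poly_Mapping.lookup (poly P (cst t)) b = poly Q t"
proof (induction P)
  case 0
  show ?case by (rule exI[of _ 0]) simp
next
  case (pCons p P)
  then obtain Q where Q: "\<And>t. Poly_Mapping.lookup (poly P (cst t)) b = poly Q t" by blast
  have "Poly_Mapping.lookup (poly (pCons p P) (cst t)) b = poly (pCons (Poly_Mapping.lookup p b) Q) t" for t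
    by (simp add: lookup_add Q)
  then show ?case by blast
qed

text \<open>An indexed family witnesses a lower bound of the dimension in a form that can be
  deformed with a parameter.\<close>

lemma dim_ge_iff_independent_family:
  fixes W :: "'k::field mpoly set"
  assumes W: "fin_dim pscale W"
  shows "r \<le> pvec.dim W \<longleftrightarrow> (\<exists>w. (\<forall>i<r. w i \<in> W) \<and> (\<forall>\<alpha>. (\<Sum>i<r. cst (\<alpha> i) * w i) = 0 \<longrightarrow> (\<forall>i<r. \<alpha> i = 0)))"
proof
  assume r: "r \<le> pvec.dim W"
  obtain B where B: "B \<subseteq> W" "pvec.independent B" "W \<subseteq> pvec.span B" "card B = pvec.dim W"
    using pvec.basis_exists by blast
  have fB: "finite B" by (rule pvec.independent_finite_fin_dim[OF W B(1,2)])
  obtain w where w: "bij_betw w {..<card B} B" using ex_bij_betw_nat_finite[OF fB] by (auto simp: atLeast0LessThan)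
  have inj: "inj_on w {..<r}" using bij_betw_imp_inj_on[OF w] r B(4) by (auto intro: inj_on_subset)
  have sub: "w ` {..<r} \<subseteq> B" using bij_betw_imp_surj_on[OF w] r B(4) by auto
  show "\<exists>w. (\<forall>i<r. w i \<in> W) \<and> (\<forall>\<alpha>. (\<Sum>i<r. cst (\<alpha> i) * w i) = 0 \<longrightarrow> (\<forall>i<r. \<alpha> i = 0))"
  proof (intro exI[of _ w] conjI allI impI)
    fix i assume "i < r" then show "w i \<in> W" using sub B(1) by auto
  next
    fix \<alpha> i assume z: "(\<Sum>i<r. cst (\<alpha> i) * w i) = 0" and i: "i < r"
    define u where "u x = \<alpha> (the_inv_into {..<r} w x)" for x
    have "(\<Sum>x\<in>w ` {..<r}. cst (u x) * x) = (\<Sum>i<r. cst (\<alpha> i) * w i)"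
      unfolding sum.reindex[OF inj] by (rule sum.cong) (simp_all add: u_def the_inv_into_f_f[OF inj])
    then have "u (w i) = 0"
      using pvec.independentD[OF B(2) _ sub, of u "w i"] z i by simp
    then show "\<alpha> i = 0" using the_inv_into_f_f[OF inj, of i] i by (simp add: u_def)
  qed
next
  assume "\<exists>w. (\<forall>i<r. w i \<in> W) \<and> (\<forall>\<alpha>. (\<Sum>i<r. cst (\<alpha> i) * w i) = 0 \<longrightarrow> (\<forall>i<r. \<alpha> i = 0))"
  then obtain w where w: "\<And>i. i < r \<Longrightarrow> w i \<in> W" "\<And>\<alpha> i. (\<Sum>i<r. cst (\<alpha> i) * w i) = 0 \<Longrightarrow> i < r \<Longrightarrow> \<alpha> i = 0" by blast
  have inj: "inj_on w {..<r}"
  proof (rule inj_onI, rule ccontr)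
    fix i j assume ij: "i \<in> {..<r}" "j \<in> {..<r}" "w i = w j" "i \<noteq> j"
    let ?\<alpha> = "\<lambda>m. (if m = i then 1 else 0) + (if m = j then -1 else 0) :: 'k"
    have "(\<Sum>m<r. cst (?\<alpha> m) * w m) = (\<Sum>m<r. if m = i then w m else 0) + (\<Sum>m<r. if m = j then - w m else 0)"
      unfolding sum.distrib[symmetric] by (rule sum.cong) (auto simp: single_uminus)
    also have "\<dots> = 0" using ij by simp
    finally have "?\<alpha> i = 0" using w(2)[of ?\<alpha> i] ij(1) by simp
    then show False using ij(4) by simp
  qed
  have "pvec.independent (w ` {..<r})"
  proof (rule pvec.independent_if_scalars_zero)
    fix f :: "'k mpoly \<Rightarrow> 'k" and x
    assume z: "(\<Sum>x\<in>w ` {..<r}. cst (f x) * x) = 0" and x: "x \<in> w ` {..<r}"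
    then obtain i where i: "i < r" "x = w i" by auto
    have "(\<Sum>i<r. cst (f (w i)) * w i) = 0" using z unfolding sum.reindex[OF inj] by (simp add: o_def)
    then show "f x = 0" using w(2)[of "\<lambda>i. f (w i)" i] i by simp
  qed simp
  then have "card (w ` {..<r}) \<le> pvec.dim W" by (intro pvec.card_independent_le_dim[OF W]) (use w(1) in auto)
  then show "r \<le> pvec.dim W" by (simp add: card_image[OF inj])
qed

lemma fin_dim_subst_last: "fin_dim pscale U \<Longrightarrow> fin_dim pscale (subst_last n c ` U)"
  by (rule fin_dim_linear_image[OF linear_subst_last])

text \<open>This is lower semicontinuity of the rank. The preimages \<open>u i\<close> of an
  independent family stay fixed while the hyperplane moves; the coefficients of their restrictions
  are polynomials in \<open>t\<close>, and independence at \<open>t = 0\<close> persists for almost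
  all \<open>t\<close>.\<close>

lemma line_open_rank:
  fixes U :: "'k::field mpoly set"
  assumes U: "fin_dim pscale U"
  shows "line_open {c. r \<le> pvec.dim (subst_last n c ` U)}"
  unfolding line_open_def
proof (intro ballI allI)
  fix c v :: "nat \<Rightarrow> 'k" assume "c \<in> {c. r \<le> pvec.dim (subst_last n c ` U)}"
  then have "r \<le> pvec.dim (subst_last n c ` U)" by simp
  from iffD1[OF dim_ge_iff_independent_family[OF fin_dim_subst_last[OF U]] this]
  obtain w where w1: "\<forall>i<r. w i \<in> subst_last n c ` U"
    and w2: "\<forall>\<alpha>. (\<Sum>i<r. cst (\<alpha> i) * w i) = 0 \<longrightarrow> (\<forall>i<r. \<alpha> i = 0)" by (elim exE conjE)
  from w1 have "\<forall>i. \<exists>u. i < r \<longrightarrow> u \<in> U \<and> w i = subst_last n c u" by blast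
  then obtain u where u: "\<And>i. i < r \<Longrightarrow> u i \<in> U \<and> w i = subst_last n c (u i)" by metis
  have "\<forall>i. \<exists>P. \<forall>t. subst_last n (\<lambda>j. c j + t * v j) (u i) = poly P (cst t)"
    by (rule allI) (rule subst_last_poly_family)
  from choice[OF this] obtain P where "\<forall>i t. subst_last n (\<lambda>j. c j + t * v j) (u i) = poly (P i) (cst t)"
    by (elim exE)
  then have P: "subst_last n (\<lambda>j. c j + t * v j) (u i) = poly (P i) (cst t)" for i t by simp
  have "\<forall>x. \<exists>Q. \<forall>t. Poly_Mapping.lookup (poly (P (fst x)) (cst t)) (snd x) = poly Q t"
    by (rule allI) (rule coeff_poly_cst)
  from choice[OF this] obtain Q0 where Q0: "\<forall>x t. Poly_Mapping.lookup (poly (P (fst x)) (cst t)) (snd x) = poly (Q0 x) t"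
    by (elim exE)
  define Q where "Q i b = Q0 (i, b)" for i b
  have Q: "Poly_Mapping.lookup (poly (P i) (cst t)) b = poly (Q i b) t" for i b t
    using spec[OF spec[OF Q0, of "(i, b)"], of t] by (simp add: Q_def)
  have lin: "(\<Sum>i<r. cst (\<alpha> i) * subst_last n (\<lambda>j. c j + t * v j) (u i)) = 0 \<longleftrightarrow> (\<forall>b. (\<Sum>i<r. \<alpha> i * poly (Q i b) t) = 0)" for \<alpha> t
    unfolding P poly_mapping_eq_iff by (simp add: fun_eq_iff lookup_sum Q)
  have "\<forall>\<alpha>. (\<forall>b. (\<Sum>i<r. \<alpha> i * poly (Q i b) 0) = 0) \<longrightarrow> (\<forall>i<r. \<alpha> i = 0)"
  proof (intro allI impI)
    fix \<alpha> i assume *: "\<forall>b. (\<Sum>i<r. \<alpha> i * poly (Q i b) 0) = 0" and i: "i < r"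
    have "(\<Sum>i<r. cst (\<alpha> i) * w i) = (\<Sum>i<r. cst (\<alpha> i) * subst_last n (\<lambda>j. c j + 0 * v j) (u i))"
      by (rule sum.cong) (simp_all add: u)
    moreover have "(\<Sum>i<r. cst (\<alpha> i) * subst_last n (\<lambda>j. c j + 0 * v j) (u i)) = 0" by (rule iffD2[OF lin *])
    ultimately show "\<alpha> i = 0" using mp[OF spec[OF w2, of \<alpha>]] i by simp
  qed
  from independent_open[OF this]
  have "finite {t. \<not> (\<forall>\<alpha>. (\<forall>b. (\<Sum>i<r. \<alpha> i * poly (Q i b) t) = 0) \<longrightarrow> (\<forall>i<r. \<alpha> i = 0))}" .
  moreover have "r \<le> pvec.dim (subst_last n (\<lambda>j. c j + t * v j) ` U)"
    if "\<forall>\<alpha>. (\<forall>b. (\<Sum>i<r. \<alpha> i * poly (Q i b) t) = 0) \<longrightarrow> (\<forall>i<r. \<alpha> i = 0)" for t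
    unfolding dim_ge_iff_independent_family[OF fin_dim_subst_last[OF U]]
    using that u unfolding lin[symmetric] by (intro exI[of _ "\<lambda>i. subst_last n (\<lambda>j. c j + t * v j) (u i)"]) blast
  ultimately show "finite {t. (\<lambda>j. c j + t * v j) \<notin> {c. r \<le> pvec.dim (subst_last n c ` U)}}"
    by (elim rev_finite_subset) blast
qed

section \<open>Green's restriction theorem\<close>

subsection \<open>The lexicographic order\<close>

text \<open>The first exponent that differs decides. Within one degree \<open>b < a\<close>
  therefore agrees with \<open>lex_greater a b\<close>.\<close>

lemma less_monomial_iff:
  "(a :: monomial) < b \<longleftrightarrow> (\<exists>k. expo a k < expo b k \<and> (\<forall>k'<k. expo a k' = expo b k'))"
  by (simp add: less_poly_mapping.rep_eq less_fun_def)

lemma mdeg_split: "mdeg a = (\<Sum>s\<le>j. expo a s) + (\<Sum>s\<in>Poly_Mapping.keys a \<inter> {j<..}. expo a s)"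
proof -
  have "mdeg a = (\<Sum>s\<in>Poly_Mapping.keys a \<inter> {..j}. expo a s) + (\<Sum>s\<in>Poly_Mapping.keys a \<inter> {j<..}. expo a s)"
    unfolding mdeg_def by (subst sum.union_disjoint[symmetric]) (auto intro: sum.cong)
  also have "(\<Sum>s\<in>Poly_Mapping.keys a \<inter> {..j}. expo a s) = (\<Sum>s\<le>j. expo a s)"
    by (rule sum.mono_neutral_left) (auto simp: in_keys_iff)
  finally show ?thesis .
qed

lemma sum_expo_le_mdeg: "(\<Sum>s\<le>j. expo a s) \<le> mdeg a"
  using mdeg_split[of a j] by simp

lemma sum_expo_less_mdeg: "j < r \<Longrightarrow> expo a r > 0 \<Longrightarrow> (\<Sum>s\<le>j. expo a s) < mdeg a"
proof -
  assume r: "j < r" "expo a r > 0"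
  have "expo a r \<le> (\<Sum>s\<in>Poly_Mapping.keys a \<inter> {j<..}. expo a s)"
    by (rule member_le_sum) (use r in \<open>auto simp: in_keys_iff\<close>)
  then show ?thesis using mdeg_split[of a j] r(2) by simp
qed

text \<open>
  In the next two lemmas \<open>x\<^sub>j\<close> is a variable of index at least that of every variable of \<open>m\<close>.
\<close>

lemma less_add_var:
  assumes m: "m \<in> monomials (Suc j)" and y: "mdeg y = mdeg m" and less: "m < y" and jk: "j \<le> k"
  shows "m + mvar j < y + mvar k"
proof (cases "j = k")
  case True
  then show ?thesis using less by simp
next
  case False
  then have jk: "j < k" using jk by simp
  obtain r where r: "expo m r < expo y r" "\<And>s. s < r \<Longrightarrow> expo m s = expo y s"
    using less unfolding less_monomial_iff by blast
  have dm: "(\<Sum>s\<le>j. expo m s) = mdeg m" using mdeg_eq_sum[OF m] by (simp add: lessThan_Suc_atMost)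
  show ?thesis
  proof (cases "r < j")
    case True
    then show ?thesis using r jk unfolding less_monomial_iff by (intro exI[of _ r]) (simp add: lookup_add)
  next
    case nl: False
    \<comment> \<open>The variables up to \<open>x_j\<close> carry the whole degree of
      \<open>m\<close>. With a later first difference \<open>y\<close> would have the same exponents
      there and more beyond, hence a larger degree.\<close>
    have "r \<le> j"
    proof (rule ccontr)
      assume "\<not> r \<le> j"
      then have "(\<Sum>s\<le>j. expo y s) = (\<Sum>s\<le>j. expo m s)" using r(2) by (intro sum.cong) auto
      moreover have "(\<Sum>s\<le>j. expo y s) < mdeg y" using \<open>\<not> r \<le> j\<close> r(1) by (intro sum_expo_less_mdeg[of _ r]) auto
      ultimately show False using dm y by simp
    qed
    then have rj: "r = j" using nl by simp
    \<comment> \<open>Equality would give \<open>y\<close> a degree above that of \<open>m\<close>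
      already in the variables up to \<open>x_j\<close>.\<close>
    have "expo m j + 1 \<noteq> expo y j"
    proof
      assume e: "expo m j + 1 = expo y j"
      have "(\<Sum>s\<le>j. expo y s) = (\<Sum>s\<le>j. expo m s) + 1"
        using e r(2) rj by (simp add: lessThan_Suc_atMost[symmetric])
      then show False using sum_expo_le_mdeg[of y j] dm y by simp
    qed
    then have "expo m j + 1 < expo y j" using r(1) rj by simp
    then show ?thesis using r rj jk unfolding less_monomial_iff
      by (intro exI[of _ j]) (simp add: lookup_add)
  qed
qed

lemma less_add_var_cancel:
  assumes m: "m \<in> monomials (Suc j)" and y: "mdeg y = mdeg m" and less: "m + mvar j < y + mvar k" and jk: "j \<le> k"
  shows "m < y"
proof (cases "j = k")
  case True
  then show ?thesis using less by simp
next
  case False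
  then have jk: "j < k" using jk by simp
  obtain r where r: "expo (m + mvar j) r < expo (y + mvar k) r" "\<And>s. s < r \<Longrightarrow> expo (m + mvar j) s = expo (y + mvar k) s"
    using less unfolding less_monomial_iff by blast
  have dm: "(\<Sum>s\<le>j. expo m s) = mdeg m" using mdeg_eq_sum[OF m] by (simp add: lessThan_Suc_atMost)
  have "r \<le> j"
  proof (rule ccontr)
    assume "\<not> r \<le> j"
    then have "(\<Sum>s\<le>j. expo (m + mvar j) s) = (\<Sum>s\<le>j. expo (y + mvar k) s)" using r(2) by (intro sum.cong) auto
    then have "(\<Sum>s\<le>j. expo m s) + 1 = (\<Sum>s\<le>j. expo y s)" using jk by (simp add: lookup_add sum.distrib)
    then show False using sum_expo_le_mdeg[of y j] dm y by simp
  qed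
  then have "expo m r < expo y r" using r(1) jk by (auto simp: lookup_add split: if_splits)
  moreover have "expo m s = expo y s" if "s < r" for s
    using r(2)[OF that] that \<open>r \<le> j\<close> jk by (auto simp: lookup_add split: if_splits)
  ultimately show ?thesis unfolding less_monomial_iff by blast
qed

text \<open>A lex-segment as an upward closed set of monomials of one degree; this admits the empty
  segment and names no last monomial.\<close>

definition lex_closed :: "nat \<Rightarrow> nat \<Rightarrow> monomial set \<Rightarrow> bool" where
  "lex_closed n d L \<longleftrightarrow> L \<subseteq> hmons n d \<and> (\<forall>a\<in>L. \<forall>b\<in>hmons n d. a < b \<longrightarrow> b \<in> L)"

lemma exists_elem_with_card_greater:
  fixes X :: "'a::linorder set"
  assumes "finite X" "a < card X"
  shows "\<exists>m\<in>X. card {x \<in> X. m < x} = a"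
  using assms
proof (induction a arbitrary: X)
  case 0
  then have "X \<noteq> {}" by auto
  then have "{x \<in> X. Max X < x} = {}" using 0 Max_ge by fastforce
  then show ?case using Max_in[OF 0(1) \<open>X \<noteq> {}\<close>] by (metis card.empty)
next
  case (Suc a)
  then have ne: "X \<noteq> {}" by auto
  let ?Y = "X - {Max X}"
  have "card ?Y = card X - 1" using Max_in[OF Suc.prems(1) ne] by simp
  then have "a < card ?Y" using Suc.prems(2) by simp
  then have "\<exists>m\<in>?Y. card {x \<in> ?Y. m < x} = a" by (intro Suc.IH) (use Suc.prems(1) in simp)
  then obtain m where m: "m \<in> ?Y" "card {x \<in> ?Y. m < x} = a" by (elim bexE)
  have "m < Max X" using m(1) Suc.prems(1) Max_ge[of X m] by (metis DiffE insertCI le_neq_trans)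
  then have "{x \<in> X. m < x} = insert (Max X) {x \<in> ?Y. m < x}" using Max_in[OF Suc.prems(1) ne] by auto
  then have "card {x \<in> X. m < x} = Suc a" using m(2) Suc.prems(1) by simp
  then show ?case using m(1) by blast
qed

lemma nonzero_coeff_keys: "m \<noteq> 0 \<Longrightarrow> Poly_Mapping.keys m \<noteq> {}"
  using poly_mapping_eqI[of m 0] by (auto simp: in_keys_iff)

lemma hmons_mono: "a \<in> hmons n d \<Longrightarrow> a \<in> hmons (Suc n) d"
  by (auto simp: hmons_def monomials_iff)

lemma hmons_Suc_iff: "a \<in> hmons n d \<longleftrightarrow> a \<in> hmons (Suc n) d \<and> expo a n = 0"
  by (auto simp: hmons_def monomials_iff le_less_Suc_eq) (metis le_antisym not_less_eq_eq)

lemma hmons_add_mvar: "a \<in> hmons n d \<Longrightarrow> l < n \<Longrightarrow> a + mvar l \<in> hmons n (Suc d)"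
  by (auto simp: hmons_def monomials_iff lookup_add)

lemma hmons_minus_mvar: "a \<in> hmons n (Suc d) \<Longrightarrow> expo a l > 0 \<Longrightarrow> a - mvar l \<in> hmons n d \<and> a - mvar l + mvar l = a"
proof -
  assume a: "a \<in> hmons n (Suc d)" "expo a l > 0"
  have e: "a - mvar l + mvar l = a" by (rule monomial_minus_var'[OF a(2)])
  have "mdeg (a - mvar l) + 1 = mdeg a" using arg_cong[OF e, of mdeg] by simp
  then show ?thesis using a e by (auto simp: hmons_def monomials_iff lookup_minus)
qed

subsection \<open>The restriction theorem\<close>

text \<open>The elements of \<open>V\<close> that vanish on the hyperplane are the products of its
  equation with the elements of \<open>U\<close>, and multiplication by the equation is
  injective.\<close>

lemma hyper_quotient_dim:
  fixes V :: "'k::field mpoly set" and c :: "nat \<Rightarrow> 'k"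
  assumes V: "pvec.subspace V" "V \<subseteq> hpolys (Suc n) (Suc d)"
  defines "U \<equiv> {u \<in> hpolys (Suc n) d. hyper n c * u \<in> V}"
  shows "pvec.subspace U" "pvec.dim V = pvec.dim U + pvec.dim (subst_last n c ` V)"
proof -
  have Vfin: "fin_dim pscale V" by (rule pvec.fin_dim_subset[OF fin_dim_hpolys V(2)])
  show U: "pvec.subspace U"
    unfolding pvec.subspace_def
  proof (intro conjI ballI allI)
    show "0 \<in> U" using pvec.subspace_0[OF V(1)] by (simp add: U_def)
    show "x + y \<in> U" if "x \<in> U" "y \<in> U" for x y
      using that add_in_hpolys[of x "Suc n" d y] pvec.subspace_add[OF V(1), of "hyper n c * x" "hyper n c * y"]
      by (simp add: U_def distrib_left)
    show "cst a * x \<in> U" if "x \<in> U" for a x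
      using that cst_mult_in_hpolys[of x "Suc n" d a] pvec.subspace_scale[OF V(1), of "hyper n c * x" a] by (simp add: U_def mult.left_commute)
  qed
  have Ufin: "fin_dim pscale U" by (rule pvec.fin_dim_subset[OF fin_dim_hpolys[of "Suc n" d]]) (auto simp: U_def)
  have "{x \<in> V. subst_last n c x = 0} = (\<lambda>u. hyper n c * u) ` U"
  proof (intro equalityI subsetI)
    fix x assume x: "x \<in> {x \<in> V. subst_last n c x = 0}"
    then have "x \<in> hpolys (Suc n) (Suc d)" using V(2) by auto
    from hyper_divides[OF this, of c] obtain q where "q \<in> hpolys (Suc n) d" "x = hyper n c * q" using x by auto
    then show "x \<in> (\<lambda>u. hyper n c * u) ` U" using x by (auto simp: U_def)
  next
    fix x assume "x \<in> (\<lambda>u. hyper n c * u) ` U"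
    then show "x \<in> {x \<in> V. subst_last n c x = 0}" by (auto simp: U_def subst_last_mult)
  qed
  then have "pvec.dim {x \<in> V. subst_last n c x = 0} = pvec.dim U"
    using dim_mult_image[OF hyper_nonzero U Ufin, of n c] by simp
  then show "pvec.dim V = pvec.dim U + pvec.dim (subst_last n c ` V)"
    using rank_nullity[OF linear_subst_last V(1) Vfin, of n c] by simp
qed

text \<open>A twofold restriction depends only on the resulting subspace of codimension two, and the
  hypothesis says that both first hyperplanes lead to the same one.\<close>

lemma subst_last_subst_last_eq:
  assumes "subst_last n t (linform (Suc n) c) = subst_last n t (linform (Suc n) c')"
  shows "subst_last n t (subst_last (Suc n) c p) = subst_last n t (subst_last (Suc n) c' p)"
proof -
  have pow: "subst_last n t (q ^ e) = subst_last n t q ^ e" for q :: "'a mpoly" and e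
  proof (induction e)
    case 0
    have "subst_last n t (cst 1) = cst (1 :: 'a)" by (rule subst_last_polys[OF cst_in_polys])
    then show ?case by simp
  qed (simp add: subst_last_mult)
  show ?thesis
    by (induction p rule: poly_induct_sum) (simp_all add: subst_last_add subst_last_single subst_last_mult pow assms)
qed

lemma linform_add: "linform n (\<lambda>j. c j + v j) = linform n c + linform n v"
  by (simp add: linform_def single_add distrib_right sum.distrib)

text \<open>The proof is by induction on the number of variables and, within it, on the degree.
  Suppose that the best restriction, to the hyperplane of \<open>c\<close> with equation
  \<open>?h\<close>, has too small a dimension \<open>a\<close>. The degree induction, applied to
  the quotient \<open>U\<close> of \<open>V\<close> by \<open>?h\<close>, gives a bound
  \<open>r1\<close>; the other induction, applied to the restriction of \<open>V\<close>, gives a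
  bound \<open>r2\<close> in codimension two. A common hyperplane realises both bounds, and they add
  up to more than \<open>a\<close>.\<close>

theorem restriction_theorem:
  fixes V :: "'k::field mpoly set"
  assumes inf: "infinite (UNIV :: 'k set)"
  shows "pvec.subspace V \<Longrightarrow> V \<subseteq> hpolys (Suc n) d \<Longrightarrow> lex_closed (Suc n) d L \<Longrightarrow> card L \<le> pvec.dim V
    \<Longrightarrow> \<exists>c. card (L \<inter> hmons n d) \<le> pvec.dim (subst_last n c ` V)"
proof (induction n arbitrary: d V L)
  case (0 d)
  show ?case
  proof (cases d)
    case 0
    have "subst_last 0 c ` V = V" for c
    proof -
      have "subst_last 0 c v = v" if "v \<in> V" for v
        using that "0.prems"(2) hpolys_0_eq[of v "Suc 0"] 0 cst_in_polys by (metis subsetD subst_last_polys)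
      then show ?thesis by simp
    qed
    moreover have "card (L \<inter> hmons 0 d) \<le> card L"
      using "0.prems"(3) finite_subset[OF _ finite_hmons] by (intro card_mono) (auto simp: lex_closed_def)
    ultimately show ?thesis using "0.prems"(4) by (metis order_trans)
  next
    case (Suc d')
    have "hmons 0 (Suc d') = {}"
    proof -
      have "a = 0" if "a \<in> monomials 0" for a using that by (intro poly_mapping_eqI) (simp add: monomials_iff)
      then have "mdeg a = 0" if "a \<in> monomials 0" for a using that by simp
      then show ?thesis unfolding hmons_def by fastforce
    qed
    then show ?thesis by (simp add: Suc)
  qed
next
  case (Suc n)
  note outer = Suc.IH
  from Suc.prems show ?case
  proof (induction d arbitrary: V L)
    case 0
    have "subst_last (Suc n) c ` V = V" for c
    proof -
      have "subst_last (Suc n) c v = v" if "v \<in> V" for v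
        using that "0.prems"(2) hpolys_0_eq[of v "Suc (Suc n)"] cst_in_polys by (metis subsetD subst_last_polys)
      then show ?thesis by simp
    qed
    moreover have "card (L \<inter> hmons (Suc n) 0) \<le> card L"
      using "0.prems"(3) finite_subset[OF _ finite_hmons] by (intro card_mono) (auto simp: lex_closed_def)
    ultimately show ?case using "0.prems"(4) by (metis order_trans)
  next
    case (Suc d)
    let ?M = "L \<inter> hmons (Suc n) (Suc d)"
    have V: "pvec.subspace V" "V \<subseteq> hpolys (Suc (Suc n)) (Suc d)" using Suc.prems by auto
    have Vfin: "fin_dim pscale V" by (rule pvec.fin_dim_subset[OF fin_dim_hpolys V(2)])
    have L: "L \<subseteq> hmons (Suc (Suc n)) (Suc d)" "\<And>a b. a \<in> L \<Longrightarrow> b \<in> hmons (Suc (Suc n)) (Suc d) \<Longrightarrow> a < b \<Longrightarrow> b \<in> L"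
      using Suc.prems(3) by (auto simp: lex_closed_def)
    show ?case
    proof (rule ccontr)
      assume "\<not> ?case"
      then have small: "pvec.dim (subst_last (Suc n) c ` V) < card ?M" for c by (meson not_le)
      define R where "R = range (\<lambda>c. pvec.dim (subst_last (Suc n) c ` V))"
      have Rfin: "finite R" using small by (auto simp: R_def intro!: finite_subset[of _ "{..<card ?M}"])
      have "R \<noteq> {}" by (simp add: R_def)
      define a where "a = Max R"
      have "a \<in> R" using Max_in[OF Rfin \<open>R \<noteq> {}\<close>] by (simp add: a_def)
      then obtain c where c: "pvec.dim (subst_last (Suc n) c ` V) = a" by (auto simp: R_def)
      have le_a: "pvec.dim (subst_last (Suc n) c' ` V) \<le> a" for c'
        unfolding a_def by (rule Max_ge[OF Rfin]) (simp add: R_def)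
      have Mfin: "finite ?M" by simp
      have "a < card ?M" using small[of c] c by simp
      \<comment> \<open>\<open>m\<close> comes right after the \<open>a\<close> largest elements of
        \<open>?M\<close>, which exists as \<open>a\<close> is too small. The monomials above it
        form a lex-segment \<open>?L2\<close> of the same size as the best restriction.\<close>
      from exists_elem_with_card_greater[OF Mfin this]
      obtain m where m: "m \<in> ?M" "card {x \<in> ?M. m < x} = a" by blast
      let ?L2 = "{x \<in> hmons (Suc n) (Suc d). m < x}"
      have "?L2 = {x \<in> ?M. m < x}" using L(2) m(1) hmons_mono by auto
      then have cardL2: "card ?L2 = a" using m(2) by simp
      have mh: "m \<in> hmons (Suc n) (Suc d)" "m \<in> L" using m(1) by auto
      have "m \<noteq> 0" using mh(1) by (auto simp: hmons_def)
      define j where "j = Max (Poly_Mapping.keys m)"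
      have kne: "Poly_Mapping.keys m \<noteq> {}" using nonzero_coeff_keys[OF \<open>m \<noteq> 0\<close>] .
      have j: "expo m j > 0" using Max_in[OF finite_keys kne] by (simp add: j_def in_keys_iff)
      have mj: "m \<in> monomials (Suc j)" unfolding monomials_iff
      proof (intro allI impI, rule ccontr)
        fix l assume l: "Suc j \<le> l" "expo m l \<noteq> 0"
        then have "l \<le> j" unfolding j_def by (intro Max_ge) (simp_all add: in_keys_iff)
        then show False using l(1) by simp
      qed
      have jn: "j \<le> n" using j mh(1) by (auto simp: hmons_def monomials_iff not_less_eq_eq[symmetric])
      \<comment> \<open>Removing the last variable \<open>x_j\<close> of \<open>m\<close> transfers
        comparisons with \<open>m\<close> to degree \<open>d\<close>: for \<open>k \<ge> j\<close>,
        a monomial \<open>y\<close> of degree \<open>d\<close> exceeds \<open>m'\<close> exactly if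
        \<open>y\<close> times \<open>x_k\<close> exceeds \<open>m\<close>.\<close>
      define m' where "m' = m - mvar j"
      have m': "m' \<in> hmons (Suc n) d" "m' + mvar j = m"
        using hmons_minus_mvar[OF mh(1) j] by (simp_all add: m'_def)
      have m'j: "m' \<in> monomials (Suc j)" using mj by (simp add: m'_def monomials_iff lookup_minus)
      let ?L1 = "{y \<in> hmons (Suc (Suc n)) d. m' \<le> y}"
      let ?h = "hyper (Suc n) c"
      define U where "U = {u \<in> hpolys (Suc (Suc n)) d. ?h * u \<in> V}"
      have U: "pvec.subspace U" "pvec.dim V = pvec.dim U + a"
        using hyper_quotient_dim[OF V, of c] c unfolding U_def by simp_all
      have Usub: "U \<subseteq> hpolys (Suc (Suc n)) d" by (auto simp: U_def)
      have Ufin: "fin_dim pscale U" by (rule pvec.fin_dim_subset[OF fin_dim_hpolys Usub])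
      \<comment> \<open>\<open>L\<close> contains \<open>m\<close>, the monomials above
        \<open>m\<close> without the last variable, and those above \<open>m'\<close> times the last
        variable; these are disjoint. As \<open>dim V = dim U + a\<close>, what is left for
        \<open>U\<close> suffices for the degree induction.\<close>
      have "a + card ?L1 \<le> card L"
      proof -
        let ?f = "\<lambda>y. y + mvar (Suc n)"
        let ?Y = "{y \<in> hmons (Suc (Suc n)) d. m' < y}"
        have "?L1 = insert m' ?Y" using hmons_mono[OF m'(1)] by auto
        then have cL1: "card ?L1 = Suc (card ?Y)" by simp
        have sub: "insert m (?L2 \<union> ?f ` ?Y) \<subseteq> L"
        proof
          fix x assume "x \<in> insert m (?L2 \<union> ?f ` ?Y)"
          then consider "x = m" | "x \<in> ?L2" | y where "y \<in> ?Y" "x = ?f y" by blast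
          then show "x \<in> L"
          proof cases
            case 1 then show ?thesis using mh(2) by simp
          next
            case 2 then show ?thesis using L(2)[OF mh(2)] hmons_mono by blast
          next
            case (3 y)
            have "mdeg y = mdeg m'" using 3(1) m'(1) by (simp add: hmons_def)
            from less_add_var[OF m'j this, of "Suc n"] have "m < x" using 3 m'(2) jn by simp
            moreover have "x \<in> hmons (Suc (Suc n)) (Suc d)" using 3 hmons_add_mvar[of y "Suc (Suc n)" d "Suc n"] by simp
            ultimately show ?thesis using L(2)[OF mh(2)] by blast
          qed
        qed
        have L2n: "x \<notin> ?f ` ?Y" if "x \<in> hmons (Suc n) (Suc d)" for x
        proof
          assume "x \<in> ?f ` ?Y"
          then have "expo x (Suc n) > 0" by (auto simp: lookup_add)
          then show False using that by (simp add: hmons_def monomials_iff)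
        qed
        have "card (insert m (?L2 \<union> ?f ` ?Y)) = Suc (card (?L2 \<union> ?f ` ?Y))"
          using L2n[OF mh(1)] by (subst card_insert_disjoint) auto
        also have "card (?L2 \<union> ?f ` ?Y) = card ?L2 + card (?f ` ?Y)"
          using L2n by (intro card_Un_disjoint) auto
        also have "card (?f ` ?Y) = card ?Y" by (rule card_image) (simp add: inj_on_def)
        finally have "card (insert m (?L2 \<union> ?f ` ?Y)) = a + card ?L1" using cL1 cardL2 by simp
        then show ?thesis using card_mono[OF finite_subset[OF L(1) finite_hmons] sub] by simp
      qed
      then have "card ?L1 \<le> pvec.dim U" using Suc.prems(4) U(2) by simp
      moreover have "lex_closed (Suc (Suc n)) d ?L1" by (auto simp: lex_closed_def)
      ultimately obtain c1 where c1: "card (?L1 \<inter> hmons (Suc n) d) \<le> pvec.dim (subst_last (Suc n) c1 ` U)"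
        using Suc.IH[OF U(1) Usub] by blast
      define r1 where "r1 = card (?L1 \<inter> hmons (Suc n) d)"
      let ?W = "subst_last (Suc n) c ` V"
      interpret sl: Vector_Spaces.linear pscale pscale "subst_last n' c'" for n' and c' :: "nat \<Rightarrow> 'k" by (rule linear_subst_last)
      have W: "pvec.subspace ?W" "?W \<subseteq> hpolys (Suc n) (Suc d)"
        by (rule sl.subspace_image[OF V(1)], rule image_subsetI, rule subst_last_in_hpolys, rule subsetD[OF V(2)])
      have "lex_closed (Suc n) (Suc d) ?L2" by (auto simp: lex_closed_def)
      then obtain t where t: "card (?L2 \<inter> hmons n (Suc d)) \<le> pvec.dim (subst_last n t ` ?W)"
        using outer[OF W, of ?L2] cardL2 c by auto
      define r2 where "r2 = card (?L2 \<inter> hmons n (Suc d))"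
      \<comment> \<open>An element of \<open>?L2\<close> either avoids \<open>x_n\<close> or is
        \<open>x_n\<close> times a monomial above \<open>m'\<close>; the extra 1 stands for
        \<open>m'\<close> itself.\<close>
      have r12: "a + 1 \<le> r1 + r2"
      proof -
        let ?Y = "{y \<in> hmons (Suc n) d. m' < y}"
        have "?L1 \<inter> hmons (Suc n) d = insert m' ?Y" using m'(1) hmons_mono by auto
        then have r1: "r1 = Suc (card ?Y)" by (simp add: r1_def)
        have "?L2 \<subseteq> (?L2 \<inter> hmons n (Suc d)) \<union> (\<lambda>y. y + mvar n) ` ?Y"
        proof
          fix x assume x: "x \<in> ?L2"
          show "x \<in> (?L2 \<inter> hmons n (Suc d)) \<union> (\<lambda>y. y + mvar n) ` ?Y"
          proof (cases "expo x n = 0")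
            case True
            then show ?thesis using x hmons_Suc_iff[of x n "Suc d"] by auto
          next
            case False
            then have y: "x - mvar n \<in> hmons (Suc n) d" "x - mvar n + mvar n = x"
              using hmons_minus_mvar[of x "Suc n" d n] x by auto
            have "mdeg (x - mvar n) = mdeg m'" using y(1) m'(1) by (simp add: hmons_def)
            moreover have "m' + mvar j < (x - mvar n) + mvar n" using x y(2) m'(2) by simp
            ultimately have "m' < x - mvar n" using less_add_var_cancel[OF m'j] jn by blast
            then show ?thesis using y by (intro UnI2 image_eqI[of _ _ "x - mvar n"]) auto
          qed
        qed
        then have "card ?L2 \<le> card ((?L2 \<inter> hmons n (Suc d)) \<union> (\<lambda>y. y + mvar n) ` ?Y)" by (intro card_mono) auto
        also have "\<dots> \<le> r2 + card ((\<lambda>y. y + mvar n) ` ?Y)" unfolding r2_def by (rule card_Un_le)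
        also have "\<dots> \<le> r2 + card ?Y" by (intro add_left_mono card_image_le) simp
        finally show ?thesis using r1 cardL2 by simp
      qed
      \<comment> \<open>The coefficients are chosen so that \<open>?h\<close> restricts to minus
        \<open>hyper n t\<close>. The hyperplanes of \<open>c\<close> and \<open>c2\<close> thus
        have the same intersection, cut out on each of them by \<open>hyper n t\<close>.\<close>
      define c2 where "c2 j = c j + (if j < n then t j else if j = n then -1 else 0)" for j
      let ?S = "hpolys (Suc (Suc n)) d :: 'k mpoly set"
      let ?S' = "hpolys (Suc n) d :: 'k mpoly set"
      let ?N = "pvec.dim ?S'"
      let ?X = "{x + y |x y. x \<in> V \<and> y \<in> (\<lambda>s. ?h * s) ` ?S}"
      have hS: "pvec.subspace ((\<lambda>s. ?h * s) ` ?S)" "(\<lambda>s. ?h * s) ` ?S \<subseteq> hpolys (Suc (Suc n)) (Suc d)"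
      proof -
        interpret mh: Vector_Spaces.linear pscale pscale "\<lambda>s. ?h * s" by (rule linear_mult)
        show "pvec.subspace ((\<lambda>s. ?h * s) ` ?S)" by (rule mh.subspace_image[OF subspace_hpolys])
        have "?h * s \<in> hpolys (Suc (Suc n)) (1 + d)" if "s \<in> ?S" for s
          using mult_in_hpolys[OF hyper_in_hpolys that] .
        then show "(\<lambda>s. ?h * s) ` ?S \<subseteq> hpolys (Suc (Suc n)) (Suc d)" by auto
      qed
      have X: "pvec.subspace ?X" "?X \<subseteq> hpolys (Suc (Suc n)) (Suc d)"
        using pvec.subspace_sums[OF V(1) hS(1)] V(2) hS(2) add_in_hpolys by blast+
      have Xfin: "fin_dim pscale ?X" by (rule pvec.fin_dim_subset[OF fin_dim_hpolys X(2)])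
      have VX: "V \<subseteq> ?X"
      proof
        fix v assume "v \<in> V"
        then have "v + ?h * 0 \<in> ?X" using zero_in_hpolys by blast
        then show "v \<in> ?X" by simp
      qed
      have hX: "?h * s \<in> ?X" if "s \<in> ?S" for s
      proof -
        have "0 + ?h * s \<in> ?X" using that pvec.subspace_0[OF V(1)] by blast
        then show ?thesis by simp
      qed
      have lin2: "linform (Suc n) c2 = linform (Suc n) c - hyper n t"
      proof -
        have "linform (Suc n) (\<lambda>j. if j < n then t j else if j = n then -1 else 0) = linform n t - var n"
          by (simp add: linform_def single_uminus)
        then show ?thesis unfolding c2_def linform_add hyper_def by simp
      qed
      have sh: "subst_last (Suc n) c2 ?h = - hyper n t"
        unfolding hyper_def[of "Suc n" c] subst_last_diff subst_last_var lin2
        by (simp add: subst_last_polys[OF hpolys_subset_polys[OF linform_in_hpolys]])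
      have same: "subst_last n t (subst_last (Suc n) c2 p) = subst_last n t (subst_last (Suc n) c p)" for p
        by (rule subst_last_subst_last_eq) (simp add: lin2 subst_last_diff)
      \<comment> \<open>Restricted by \<open>c2\<close>, \<open>?X\<close> contains all multiples of
        \<open>hyper n t\<close>, which account for \<open>?N\<close>; its further restriction by
        \<open>t\<close> contains the twofold restriction of \<open>V\<close>, which accounts for
        \<open>r2\<close>.\<close>
      have Om2: "?N + r2 \<le> pvec.dim (subst_last (Suc n) c2 ` ?X)"
      proof -
        let ?Y = "subst_last (Suc n) c2 ` ?X"
        have Y: "pvec.subspace ?Y" "fin_dim pscale ?Y"
          using sl.subspace_image[OF X(1)] fin_dim_subst_last[OF Xfin] by auto
        have "pvec.dim ((\<lambda>s. hyper n t * s) ` ?S') \<le> pvec.dim {y \<in> ?Y. subst_last n t y = 0}"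
        proof (rule pvec.dim_mono_fin_dim)
          show "fin_dim pscale {y \<in> ?Y. subst_last n t y = 0}" by (rule pvec.fin_dim_subset[OF Y(2)]) auto
          show "(\<lambda>s. hyper n t * s) ` ?S' \<subseteq> {y \<in> ?Y. subst_last n t y = 0}"
          proof (rule image_subsetI)
            fix s assume s: "s \<in> ?S'"
            have eq: "subst_last (Suc n) c2 (?h * (- s)) = hyper n t * s"
              unfolding subst_last_mult sh subst_last_polys[OF uminus_in_polys[OF hpolys_subset_polys[OF s]]] by simp
            have "- s \<in> ?S" by (rule pvec.subspace_neg[OF subspace_hpolys hpolys_mono[OF s]])
            then have "subst_last (Suc n) c2 (?h * (- s)) \<in> ?Y" by (rule imageI[OF hX])
            then have "hyper n t * s \<in> ?Y" unfolding eq .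
            then show "hyper n t * s \<in> {y \<in> ?Y. subst_last n t y = 0}" by (simp add: subst_last_mult)
          qed
        qed
        moreover have "pvec.dim ((\<lambda>s. hyper n t * s) ` ?S') = ?N"
          by (rule dim_mult_image[OF hyper_nonzero subspace_hpolys fin_dim_hpolys])
        moreover have "pvec.dim (subst_last n t ` ?W) \<le> pvec.dim (subst_last n t ` ?Y)"
        proof (rule pvec.dim_mono_fin_dim[OF fin_dim_subst_last[OF Y(2)]])
          have "subst_last n t ` ?W = subst_last n t ` subst_last (Suc n) c2 ` V" unfolding image_image same ..
          then show "subst_last n t ` ?W \<subseteq> subst_last n t ` ?Y" using VX by (simp add: image_mono)
        qed
        ultimately show ?thesis using rank_nullity[OF linear_subst_last Y, of n t] t unfolding r2_def by linarith
      qed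
      have h1: "pvec.dim (subst_last (Suc n) c' ` pvec.span {?h}) \<ge> 1 \<longleftrightarrow> subst_last (Suc n) c' ?h \<noteq> 0" for c'
      proof -
        have "subst_last (Suc n) c' ` pvec.span {?h} = pvec.span {subst_last (Suc n) c' ?h}"
          using sl.span_image[of "Suc n" c' "{?h}"] by simp
        moreover have "pvec.dim (pvec.span {0 :: 'k mpoly}) = 0"
          using pvec.dim_span_eq_card_independent[OF pvec.independent_empty] pvec.span_insert_0[of "{}"] by simp
        ultimately show ?thesis using pvec.dim_span_singleton[of "subst_last (Suc n) c' ?h"] by (cases "subst_last (Suc n) c' ?h = 0") auto
      qed
      let ?O1 = "{c. r1 \<le> pvec.dim (subst_last (Suc n) c ` U)}"
      let ?O2 = "{c. ?N + r2 \<le> pvec.dim (subst_last (Suc n) c ` ?X)}"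
      let ?O3 = "{c. 1 \<le> pvec.dim (subst_last (Suc n) c ` pvec.span {?h})}"
      have o: "line_open ?O1" "line_open ?O2" "line_open ?O3"
        by (rule line_open_rank[OF Ufin], rule line_open_rank[OF Xfin], rule line_open_rank[OF pvec.fin_dim_span]) simp
      have "c2 \<in> ?O2 \<inter> ?O3" using Om2 h1[of c2] sh hyper_nonzero[of n t] by simp
      moreover have "c1 \<in> ?O1" using c1 by (simp add: r1_def)
      \<comment> \<open>\<open>c1\<close> shows that the first condition can be met,
        \<open>c2\<close> that the other two can be met together; all three are line-open.\<close>
      ultimately obtain c' where c': "c' \<in> ?O1 \<inter> (?O2 \<inter> ?O3)"
        using line_open_Int_nonempty[OF inf o(1) _ line_open_Int[OF o(2,3)]] by blast
      let ?H = "subst_last (Suc n) c' ?h"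
      have H: "?H \<noteq> 0" using c' h1 by blast
      let ?A = "subst_last (Suc n) c' ` V"
      let ?B = "(\<lambda>s. ?H * s) ` ?S'"
      have A: "pvec.subspace ?A" "fin_dim pscale ?A" using sl.subspace_image[OF V(1)] fin_dim_subst_last[OF Vfin] by auto
      have B: "pvec.subspace ?B" "fin_dim pscale ?B" "pvec.dim ?B = ?N"
      proof -
        interpret mh: Vector_Spaces.linear pscale pscale "\<lambda>s. ?H * s" by (rule linear_mult)
        show "pvec.subspace ?B" by (rule mh.subspace_image[OF subspace_hpolys])
        show "fin_dim pscale ?B" by (rule fin_dim_linear_image[OF linear_mult fin_dim_hpolys])
        show "pvec.dim ?B = ?N" by (rule dim_mult_image[OF H subspace_hpolys fin_dim_hpolys])
      qed
      have "subst_last (Suc n) c' ` ?X \<subseteq> {x + y |x y. x \<in> ?A \<and> y \<in> ?B}"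
      proof (rule image_subsetI)
        fix x assume "x \<in> ?X"
        then obtain v s where vs: "v \<in> V" "s \<in> ?S" "x = v + ?h * s" by blast
        have "subst_last (Suc n) c' x = subst_last (Suc n) c' v + ?H * subst_last (Suc n) c' s"
          by (simp add: vs(3) subst_last_add subst_last_mult)
        moreover have "subst_last (Suc n) c' s \<in> ?S'" by (rule subst_last_in_hpolys[OF vs(2)])
        ultimately show "subst_last (Suc n) c' x \<in> {x + y |x y. x \<in> ?A \<and> y \<in> ?B}" using vs(1) by blast
      qed
      then have "pvec.dim (subst_last (Suc n) c' ` ?X) \<le> pvec.dim {x + y |x y. x \<in> ?A \<and> y \<in> ?B}"
        by (rule pvec.dim_mono_fin_dim[OF pvec.fin_dim_sums[OF A(2) B(2)]])
      moreover have "?N + r2 \<le> pvec.dim (subst_last (Suc n) c' ` ?X)" using c' by blast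
      moreover have "r1 \<le> pvec.dim (?A \<inter> ?B)"
      proof -
        have "pvec.dim ((\<lambda>u. ?H * u) ` subst_last (Suc n) c' ` U) = pvec.dim (subst_last (Suc n) c' ` U)"
          by (rule dim_mult_image[OF H sl.subspace_image[OF U(1)] fin_dim_subst_last[OF Ufin]])
        moreover have "pvec.dim ((\<lambda>u. ?H * u) ` subst_last (Suc n) c' ` U) \<le> pvec.dim (?A \<inter> ?B)"
        proof (rule pvec.dim_mono_fin_dim)
          show "fin_dim pscale (?A \<inter> ?B)" by (rule pvec.fin_dim_subset[OF A(2)]) auto
          show "(\<lambda>u. ?H * u) ` subst_last (Suc n) c' ` U \<subseteq> ?A \<inter> ?B"
          proof
            fix x assume "x \<in> (\<lambda>u. ?H * u) ` subst_last (Suc n) c' ` U"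
            then obtain u where u: "u \<in> U" "x = ?H * subst_last (Suc n) c' u" by blast
            have "x = subst_last (Suc n) c' (?h * u)" by (simp add: u(2) subst_last_mult)
            moreover have "?h * u \<in> V" using u(1) by (simp add: U_def)
            moreover have "subst_last (Suc n) c' u \<in> ?S'" using u(1) Usub by (intro subst_last_in_hpolys) auto
            ultimately show "x \<in> ?A \<inter> ?B" using u(2) by blast
          qed
        qed
        moreover have "r1 \<le> pvec.dim (subst_last (Suc n) c' ` U)" using c' by blast
        ultimately show ?thesis by simp
      qed
      \<comment> \<open>The sum of \<open>?A\<close> and \<open>?B\<close> has dimension at least
        \<open>?N + r2\<close>, their intersection at least \<open>r1\<close>, and \<open>?B\<close>
        has dimension \<open>?N\<close>. So \<open>?A\<close> has dimension at least
        \<open>r1 + r2\<close>, which exceeds \<open>a\<close>.\<close>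
      ultimately have "?N + r2 + r1 \<le> pvec.dim ?A + ?N"
        using pvec.dim_sums_plus_dim_Int[OF A(1) B(1) A(2) B(2)] B(3) by simp
      then show False using r12 le_a[of c'] by simp
    qed
  qed
qed

section \<open>Koszul cycles of spaces of forms\<close>

lemma ksign_mult_in_subspace:
  assumes "pvec.subspace V" "p \<in> V"
  shows "ksign j A * p \<in> V"
proof -
  consider "ksign j A = (1 :: 'a mpoly)" | "ksign j A = (- 1 :: 'a mpoly)" using ksign_cases by blast
  then show ?thesis
  proof cases
    case 2
    show ?thesis unfolding 2 using pvec.subspace_neg[OF assms] by simp
  qed (use assms in simp)
qed

lemma subst_last_ksign: "subst_last n c (ksign j A * p) = ksign j A * subst_last n c p"
proof -
  consider "ksign j A = (1 :: 'a mpoly)" | "ksign j A = (- 1 :: 'a mpoly)" using ksign_cases by blast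
  then show ?thesis
  proof cases
    case 2
    have "subst_last n c (- p) = - subst_last n c p" using subst_last_diff[of n c 0 p] by simp
    then show ?thesis unfolding 2 by simp
  qed simp
qed

lemma kos_Suc: "kos (Suc n) z A = kos n z A + var n * contract n z A"
  by (simp add: kos_def)

lemma subst_last_kos: "subst_last n c (kos n z A) = kos n (\<lambda>A. subst_last n c (z A)) A"
proof -
  have sum: "subst_last n c (sum f J) = (\<Sum>i\<in>J. subst_last n c (f i))" for f :: "nat \<Rightarrow> 'a mpoly" and J
    by (induction J rule: infinite_finite_induct) (simp_all add: subst_last_add)
  have "subst_last n c (var l * contract l z A) = var l * contract l (\<lambda>A. subst_last n c (z A)) A" if "l < n" for l
  proof -
    have "subst_last n c (var l) = var l"
      by (rule subst_last_polys[OF hpolys_subset_polys[OF var_in_hpolys[OF that]]])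
    moreover have "subst_last n c (contract l z A) = contract l (\<lambda>A. subst_last n c (z A)) A"
      by (simp add: contract_def subst_last_ksign)
    ultimately show ?thesis by (simp only: subst_last_mult)
  qed
  then show ?thesis unfolding kos_def sum by (intro sum.cong) auto
qed

abbreviation (input) ksets :: "nat \<Rightarrow> nat \<Rightarrow> nat set set" where
  "ksets n i \<equiv> {A. A \<subseteq> {..<n} \<and> card A = i}"

lemma card_ksets: "card (ksets n i) = n choose i"
  using n_subsets[of "{..<n}" i] by simp

lemma ksets_D: "A \<in> ksets n i \<Longrightarrow> finite A \<and> n \<notin> A"
  using finite_subset[of A "{..<n}"] by auto

lemma dim_funs_ksets:
  assumes "pvec.subspace V" "fin_dim pscale V"
  shows "fvec.dim (funs (ksets n i) (\<lambda>_. V)) = (n choose i) * pvec.dim V"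
  using dim_funs[OF finite_card_subsets assms, of n i] card_ksets[of n i] by simp

lemma kcycles_funs: "z \<in> kcycles n i V \<Longrightarrow> z \<in> funs (ksets n i) (\<lambda>_. V)" "z \<in> kcycles n i V \<Longrightarrow> kos n z = 0"
  by (simp_all add: kcycles_def)

text \<open>
  After the change of basis \<open>e\<^sub>n \<mapsto> e\<^sub>n - \<Sum>\<^sub>j c\<^sub>j e\<^sub>j\<close> of \<open>K\<^sup>n\<^sup>+\<^sup>1\<close>, a cycle is determined by its part
  \<open>g\<close> without \<open>e\<^sub>n\<close>, and the restriction of \<open>g\<close> to the hyperplane is a cycle in one variable less.
\<close>

lemma dim_kcycles_le_restriction:
  fixes V :: "'k::field mpoly set"
  assumes V: "pvec.subspace V" "V \<subseteq> hpolys (Suc n) d"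
  shows "fvec.dim (kcycles (Suc n) i V)
    \<le> (n choose i) * (pvec.dim V - pvec.dim (subst_last n c ` V)) + fvec.dim (kcycles n i (subst_last n c ` V))"
proof -
  let ?s = "subst_last n c"
  have Vfin: "fin_dim pscale V" by (rule pvec.fin_dim_subset[OF fin_dim_hpolys V(2)])
  interpret s: Vector_Spaces.linear pscale pscale "subst_last n c" by (rule linear_subst_last)
  \<comment> \<open>The middle term removes the part of \<open>z\<close> that contains e_n; the sum
    puts it back with e_n replaced by the combination of the other basis vectors with coefficients
    \<open>c j\<close>.\<close>
  define g where "g z A = z A - wedge n (contract n z) A + (\<Sum>j<n. cst (c j) * wedge j (contract n z) A)"
    for z :: "nat set \<Rightarrow> 'k mpoly" and A
  have contract_wedge_add: "wedge j (contract n (x + y)) A = wedge j (contract n x) A + wedge j (contract n y) A" for j x y and A :: "nat set"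
    by (simp add: contract_add wedge_def distrib_left)
  have contract_wedge_scale: "wedge j (contract n (\<lambda>A. cst a * x A)) A = cst a * wedge j (contract n x) A" for j a x and A :: "nat set"
    by (simp add: contract_scale wedge_def mult.left_commute)
  have lin_g: "Vector_Spaces.linear fscale fscale g"
    by (rule linear_ffI)
      (simp_all add: fun_eq_iff g_def contract_wedge_add contract_wedge_scale distrib_left sum.distrib
        right_diff_distrib sum_distrib_left mult.left_commute)
  have lin_T: "Vector_Spaces.linear fscale fscale (\<lambda>z A. ?s (z A))"
    by (rule linear_ffI) (simp_all add: fun_eq_iff subst_last_add subst_last_scale)
  define T where "T = (\<lambda>z A. ?s (z A)) \<circ> g"
  have lin: "Vector_Spaces.linear fscale fscale T"
    unfolding T_def by (rule Vector_Spaces.linear_compose[OF lin_g lin_T])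
  have g_in: "g z \<in> funs (ksets n i) (\<lambda>_. V)" if z: "z \<in> kcycles (Suc n) i V" for z
  proof -
    note zf = kcycles_funs(1)[OF z]
    have zV: "z A \<in> V" for A
      using funs_in[OF zf, of A] funs_out[OF zf, of A] pvec.subspace_0[OF V(1)] by (cases "A \<in> ksets (Suc n) i") simp_all
    have wV: "wedge j (contract n z) A \<in> V" for j A
      using ksign_mult_in_subspace[OF V(1)] zV pvec.subspace_0[OF V(1)] by (simp add: wedge_def contract_def)
    show ?thesis
    proof (rule funsI)
      fix A show "g z A \<in> V" unfolding g_def
        by (intro pvec.subspace_add[OF V(1)] pvec.subspace_diff[OF V(1)] pvec.subspace_sum[OF V(1)] pvec.subspace_scale[OF V(1)] zV wV)
    next
      fix A assume A: "A \<notin> ksets n i"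
      show "g z A = 0"
      proof (cases "n \<in> A")
        case True
        have "wedge n (contract n z) A = z A"
          using True by (simp add: wedge_def contract_def ksign_remove insert_absorb)
        moreover have "wedge j (contract n z) A = 0" if "j < n" for j
          using True that by (simp add: wedge_def contract_def)
        ultimately show ?thesis by (simp add: g_def)
      next
        case False
        have out: "z B = 0" if "\<not> (B \<subseteq> {..<Suc n} \<and> card B = i)" for B
          using funs_out[OF zf, of B] that by blast
        have zA: "z A = 0"
        proof (rule out, rule notI)
          assume "A \<subseteq> {..<Suc n} \<and> card A = i"
          then have "A \<in> ksets n i" using False by (auto simp: less_Suc_eq)
          then show False using A by simp
        qed
        have "wedge j (contract n z) A = 0" if j: "j < n" for j
        proof (cases "j \<in> A")
          case True
          have "z (insert n (A - {j})) = 0"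
          proof (rule out, rule notI)
            assume *: "insert n (A - {j}) \<subseteq> {..<Suc n} \<and> card (insert n (A - {j})) = i"
            have "finite (insert n (A - {j}))" by (rule finite_subset[OF conjunct1[OF *] finite_lessThan])
            then have fin: "finite A" by simp
            have "card (insert n (A - {j})) = Suc (card (A - {j}))" using fin False by simp
            also have "\<dots> = card A" by (rule card_Suc_Diff1[OF fin True])
            finally have "card (insert n (A - {j})) = card A" .
            moreover have "A \<subseteq> {..<n}" using * False j by (auto simp: less_Suc_eq)
            ultimately show False using * A by simp
          qed
          then show ?thesis by (simp add: wedge_def contract_def)
        qed (simp add: wedge_def)
        moreover have "wedge n (contract n z) A = 0" using False by (simp add: wedge_def)
        ultimately show ?thesis using zA by (simp add: g_def)
      qed
    qed
  qed
  \<comment> \<open>\<open>z\<close> differs from \<open>g z\<close> by the wedge of e_n minus that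
    combination with the cycle \<open>contract n z\<close>, and \<open>z\<close> itself is a cycle.
    The result vanishes on the hyperplane; as S is a domain, it also recovers
    \<open>contract n z\<close> from \<open>g z\<close>.\<close>
  have kos_g: "kos (Suc n) (g z) A = - (hyper n c * contract n z A)" if z: "z \<in> kcycles (Suc n) i V" for z A
  proof -
    let ?b = "contract n z"
    have kz: "kos (Suc n) z = 0" by (rule kcycles_funs(2)[OF z])
    have kb: "kos (Suc n) ?b = 0" by (rule ext) (simp add: kos_contract kz, simp add: contract_def)
    have kw: "kos (Suc n) (wedge j ?b) A = var j * ?b A" if "j < Suc n" for j
    proof -
      have "wedge j (kos (Suc n) ?b) A = 0" unfolding kb by (simp add: wedge_def)
      then show ?thesis using kos_wedge[of "Suc n" j ?b A] that by simp
    qed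
    have g_alt: "g z = z + ((\<lambda>A. - 1 * wedge n ?b A) + (\<lambda>A. \<Sum>j<n. cst (c j) * wedge j ?b A))"
      by (simp add: fun_eq_iff g_def)
    have "kos (Suc n) (g z) A = kos (Suc n) z A + (- 1 * kos (Suc n) (wedge n ?b) A + (\<Sum>j<n. cst (c j) * kos (Suc n) (wedge j ?b) A))"
      unfolding g_alt kos_add plus_fun_apply kos_scale[of "Suc n" "- 1"]
      by (simp only: kos_linear_combination)
    also have "\<dots> = - (hyper n c * ?b A)"
      using kw by (simp add: kz hyper_def linform_def left_diff_distrib sum_distrib_right mult.assoc)
    finally show ?thesis .
  qed
  have T_in: "T z \<in> kcycles n i (?s ` V)" if z: "z \<in> kcycles (Suc n) i V" for z
  proof -
    note gf = g_in[OF z]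
    have "T z \<in> funs (ksets n i) (\<lambda>_. ?s ` V)"
    proof (rule funsI)
      show "T z A \<in> ?s ` V" if "A \<in> ksets n i" for A using funs_in[OF gf that] by (simp add: T_def)
      show "T z A = 0" if "A \<notin> ksets n i" for A using funs_out[OF gf that] by (simp add: T_def)
    qed
    moreover have "kos n (T z) A = 0" for A
    proof -
      have "insert n A \<notin> ksets n i" using ksets_D by blast
      then have "contract n (g z) A = 0" using funs_out[OF gf] by (simp add: contract_def)
      then have "kos n (g z) A = - (hyper n c * contract n z A)" using kos_g[OF z, of A] by (simp add: kos_Suc)
      moreover have "?s (- (hyper n c * contract n z A)) = 0"
        using subst_last_diff[of n c 0 "hyper n c * contract n z A"] by (simp add: subst_last_mult)
      ultimately have "?s (kos n (g z) A) = 0" by simp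
      then show ?thesis unfolding subst_last_kos by (simp add: T_def o_def)
    qed
    ultimately show ?thesis unfolding kcycles_def by (simp add: fun_eq_iff)
  qed
  let ?Z = "kcycles (Suc n) i V"
  have Z: "fvec.subspace ?Z" "fin_dim fscale ?Z" by (rule subspace_kcycles[OF V(1)], rule fin_dim_kcycles[OF Vfin])
  interpret T: Vector_Spaces.linear fscale fscale T by (rule lin)
  let ?K = "{z \<in> ?Z. T z = 0}"
  have K: "fvec.subspace ?K" using Z(1) by (simp add: fvec.subspace_def T.add T.scale T.zero flip: zero_fun_def)
  have Kfin: "fin_dim fscale ?K" by (rule fvec.fin_dim_subset[OF Z(2)]) auto
  let ?V0 = "{v \<in> V. ?s v = 0}"
  have V0: "pvec.subspace ?V0" using V(1) by (simp add: pvec.subspace_def subst_last_add subst_last_scale)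
  have V0fin: "fin_dim pscale ?V0" by (rule pvec.fin_dim_subset[OF Vfin]) auto
  \<comment> \<open>In the kernel of \<open>T\<close> all coefficients of \<open>g z\<close> vanish
    on the hyperplane, and \<open>g\<close> is injective on cycles by the formula for the
    boundary.\<close>
  have "fvec.dim ?K \<le> fvec.dim (funs (ksets n i) (\<lambda>_. ?V0))"
  proof (rule dim_le_of_inj[OF lin_g K Kfin])
    fix z assume z: "z \<in> ?K" "g z = 0"
    have b: "contract n z A = 0" for A
    proof -
      have "hyper n c * contract n z A = 0" using kos_g[of z A] z by simp
      then show ?thesis using hyper_nonzero[of n c] by (metis mult_eq_0_iff)
    qed
    show "z = 0"
    proof
      fix A
      have "wedge j (contract n z) A = 0" for j by (simp add: wedge_def b)
      then have "g z A = z A" by (simp add: g_def)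
      then show "z A = 0 A" using z(2) by simp
    qed
  next
    show "g ` ?K \<subseteq> funs (ksets n i) (\<lambda>_. ?V0)"
    proof (rule image_subsetI, rule funsI)
      fix z A assume z: "z \<in> ?K"
      then have gf: "g z \<in> funs (ksets n i) (\<lambda>_. V)" using g_in by blast
      show "A \<notin> ksets n i \<Longrightarrow> g z A = 0" by (rule funs_out[OF gf])
      assume A: "A \<in> ksets n i"
      have "T z A = 0" using z by simp
      then show "g z A \<in> ?V0" using funs_in[OF gf A] by (simp add: T_def)
    qed
    show "fin_dim fscale (funs (ksets n i) (\<lambda>_. ?V0))" by (rule fin_dim_funs[OF finite_card_subsets V0fin])
  qed
  also have "\<dots> = (n choose i) * pvec.dim ?V0" by (rule dim_funs_ksets[OF V0 V0fin])
  also have "pvec.dim ?V0 = pvec.dim V - pvec.dim (?s ` V)"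
    using rank_nullity[OF linear_subst_last V(1) Vfin, of n c] by simp
  finally have 1: "fvec.dim ?K \<le> (n choose i) * (pvec.dim V - pvec.dim (?s ` V))" .
  have "fvec.dim (T ` ?Z) \<le> fvec.dim (kcycles n i (?s ` V))"
    by (rule fvec.dim_mono_fin_dim[OF fin_dim_kcycles[OF fin_dim_subst_last[OF Vfin]]]) (use T_in in blast)
  then show ?thesis using 1 rank_nullity[OF lin Z] by simp
qed

text \<open>Reduce coefficients modulo \<open>W\<close>: the cycles that become 0 are those over
  \<open>W\<close>, and the images lie in \<open>n choose i\<close> copies of the quotient.\<close>

lemma dim_kcycles_mono:
  fixes V :: "'k::field mpoly set"
  assumes V: "pvec.subspace V" "fin_dim pscale V" and W: "pvec.subspace W" "W \<subseteq> V"
  shows "fvec.dim (kcycles n i V) \<le> fvec.dim (kcycles n i W) + (n choose i) * (pvec.dim V - pvec.dim W)"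
proof -
  obtain q where q: "Vector_Spaces.linear pscale pscale q" "\<And>x. q x = 0 \<longleftrightarrow> x \<in> W"
    using pvec.exists_linear_with_kernel[OF W(1)] by blast
  interpret q: Vector_Spaces.linear pscale pscale q by fact
  have lin: "Vector_Spaces.linear fscale fscale (\<lambda>z A. q (z A))"
    by (rule linear_ffI) (simp_all add: fun_eq_iff q.add q.scale)
  have "{x \<in> V. q x = 0} = W" using q(2) W(2) by blast
  then have qV: "pvec.dim (q ` V) = pvec.dim V - pvec.dim W" using rank_nullity[OF q(1) V] by simp
  let ?Z = "kcycles n i V"
  have "{z \<in> ?Z. (\<lambda>A. q (z A)) = 0} = kcycles n i W"
  proof (intro equalityI subsetI)
    fix z assume z: "z \<in> {z \<in> ?Z. (\<lambda>A. q (z A)) = 0}"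
    then have zf: "z \<in> funs (ksets n i) (\<lambda>_. V)" "kos n z = 0" using kcycles_funs by blast+
    have "q (z A) = 0" for A using z by (auto dest: fun_cong)
    then have "z \<in> funs (ksets n i) (\<lambda>_. W)" using q(2) funs_out[OF zf(1)] by (intro funsI) blast+
    then show "z \<in> kcycles n i W" using zf(2) by (simp add: kcycles_def)
  next
    fix z assume z: "z \<in> kcycles n i W"
    note zf = kcycles_funs[OF z]
    have "z A \<in> W" for A
      using funs_in[OF zf(1), of A] funs_out[OF zf(1), of A] pvec.subspace_0[OF W(1)] by (cases "A \<in> ksets n i") simp_all
    moreover have "z \<in> funs (ksets n i) (\<lambda>_. V)"
    proof (rule funsI)
      show "z A \<in> V" if "A \<in> ksets n i" for A using funs_in[OF zf(1) that] W(2) by blast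
      show "z A = 0" if "A \<notin> ksets n i" for A by (rule funs_out[OF zf(1) that])
    qed
    ultimately show "z \<in> {z \<in> ?Z. (\<lambda>A. q (z A)) = 0}" using zf(2) q(2) by (simp add: kcycles_def fun_eq_iff)
  qed
  moreover have "fvec.dim ((\<lambda>z A. q (z A)) ` ?Z) \<le> fvec.dim (funs (ksets n i) (\<lambda>_. q ` V))"
  proof (rule fvec.dim_mono_fin_dim)
    show "fin_dim fscale (funs (ksets n i) (\<lambda>_. q ` V))"
      by (rule fin_dim_funs[OF finite_card_subsets fin_dim_linear_image[OF q(1) V(2)]])
    show "(\<lambda>z A. q (z A)) ` ?Z \<subseteq> funs (ksets n i) (\<lambda>_. q ` V)"
    proof (rule image_subsetI, rule funsI)
      fix z A assume z: "z \<in> ?Z"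
      note zf = kcycles_funs(1)[OF z]
      show "q (z A) \<in> q ` V" if "A \<in> ksets n i" using funs_in[OF zf that] by simp
      show "q (z A) = 0" if "A \<notin> ksets n i" using funs_out[OF zf that] q.zero by simp
    qed
  qed
  moreover have "fvec.dim (funs (ksets n i) (\<lambda>_. q ` V)) = (n choose i) * pvec.dim (q ` V)"
    by (rule dim_funs_ksets[OF q.subspace_image[OF V(1)] fin_dim_linear_image[OF q(1) V(2)]])
  ultimately show ?thesis
    using rank_nullity[OF lin subspace_kcycles[OF V(1)] fin_dim_kcycles[OF V(2)], of n i] qV by simp
qed

section \<open>Lex-segments\<close>

lemma subspace_mspan: "pvec.subspace (mspan L)"
  unfolding mspan_eq_span by (rule pvec.subspace_span)

lemma dim_mspan: "pvec.dim (mspan L :: 'k::field mpoly set) = card L"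
  unfolding mspan_eq_span by (rule dim_span_monomials)

lemma mspan_hmons: "L \<subseteq> hmons n d \<Longrightarrow> mspan L \<subseteq> hpolys n d"
  by (auto simp: mspan_def hpolys_def)

lemma mspan_mono: "L \<subseteq> L' \<Longrightarrow> mspan L \<subseteq> mspan L'"
  by (auto simp: mspan_def)

section \<open>Setting the last variable to zero\<close>

lemma coeff_subst_last_zero:
  assumes "p \<in> hpolys (Suc n) d"
  shows "mcoeff (subst_last n (\<lambda>_. 0) p) a = (if expo a n = 0 then mcoeff p a else 0)"
proof -
  have "linform n (\<lambda>_. 0 :: 'a) = 0" by (simp add: linform_def)
  then have "mcoeff (Poly_Mapping.single (drop_var n b) x * linform n (\<lambda>_. 0) ^ expo b n) a
     = (if b = a \<and> expo a n = 0 then x else 0)" for b and x :: 'a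
  proof (cases "expo b n")
    case 0
    have "drop_var n b = b" using 0 by (intro poly_mapping_eqI) (simp add: expo_drop_var)
    then show ?thesis using 0 by (auto simp: lookup_single when_def)
  next
    case (Suc e)
    then show ?thesis using \<open>linform n (\<lambda>_. 0 :: 'a) = 0\<close> by auto
  qed
  then have "mcoeff (subst_last n (\<lambda>_. 0) p) a = (\<Sum>b\<in>Poly_Mapping.keys p. if b = a then (if expo a n = 0 then mcoeff p a else 0) else 0)"
    unfolding subst_last_def lookup_sum by (intro sum.cong) auto
  also have "\<dots> = (if expo a n = 0 then mcoeff p a else 0)" by (simp add: in_keys_iff)
  finally show ?thesis .
qed

lemma subst_last_zero_mspan:
  assumes L: "L \<subseteq> hmons (Suc n) d"
  shows "subst_last n (\<lambda>_. 0) ` mspan L = (mspan (L \<inter> hmons n d) :: 'k::field mpoly set)"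
proof (intro equalityI subsetI)
  fix q :: "'k mpoly" assume "q \<in> subst_last n (\<lambda>_. 0) ` mspan L"
  then obtain p where p: "p \<in> mspan L" "q = subst_last n (\<lambda>_. 0) p" by blast
  have ph: "p \<in> hpolys (Suc n) d" using p(1) mspan_hmons[OF L] by blast
  have "a \<in> L \<inter> hmons n d" if "a \<in> Poly_Mapping.keys q" for a
  proof -
    have "expo a n = 0 \<and> mcoeff p a \<noteq> 0"
      using that coeff_subst_last_zero[OF ph, of a] by (simp add: p(2) in_keys_iff split: if_splits)
    moreover from this have "a \<in> L" using p(1) by (auto simp: mspan_def in_keys_iff)
    ultimately show ?thesis using L hmons_Suc_iff[of a n d] by blast
  qed
  then show "q \<in> mspan (L \<inter> hmons n d)" by (auto simp: mspan_def)
next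
  fix q :: "'k mpoly" assume q: "q \<in> mspan (L \<inter> hmons n d)"
  then have "q \<in> hpolys n d" using mspan_hmons[of "L \<inter> hmons n d" n d] by blast
  then have "subst_last n (\<lambda>_. 0) q = q" by (rule subst_last_polys[OF hpolys_subset_polys])
  moreover have "q \<in> mspan L" using q mspan_mono[of "L \<inter> hmons n d" L] by blast
  ultimately show "q \<in> subst_last n (\<lambda>_. 0) ` mspan L" by (metis imageI)
qed

definition div_var :: "nat \<Rightarrow> 'k::field mpoly \<Rightarrow> 'k mpoly" where
  "div_var n p = Poly_Mapping.map_key (\<lambda>b. b + mvar n) p"

lemma coeff_div_var: "mcoeff (div_var n p) b = mcoeff p (b + mvar n)"
proof -
  have "inj (\<lambda>b. b + mvar n)" by (rule injI) simp
  then show ?thesis by (simp add: div_var_def map_key.rep_eq)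
qed

lemma var_mult_div_var:
  assumes "\<And>a. expo a n = 0 \<Longrightarrow> mcoeff p a = 0"
  shows "var n * div_var n p = p"
  by (rule poly_mapping_eqI) (use assms in \<open>simp add: coeff_var_mult coeff_div_var monomial_minus_var'\<close>)

text \<open>\<open>a\<close> arises from the given monomial by exchanging one \<open>x_n\<close> for
  the earlier \<open>x_l\<close>, which enlarges it: lex-segments are strongly stable.\<close>

lemma lex_closed_exchange:
  assumes L: "lex_closed (Suc n) d L" and l: "l < n" and a: "a + mvar n - mvar l \<in> L" "expo a l > 0"
  shows "a \<in> L"
proof -
  let ?b = "a + mvar n - mvar l"
  have b: "?b \<in> hmons (Suc n) d" using L a(1) by (auto simp: lex_closed_def)
  have "?b + mvar l = a + mvar n" using a(2) by (intro monomial_minus_var') (simp add: lookup_add)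
  then have "mdeg ?b + 1 = mdeg a + 1" by (metis mdeg_add mdeg_mvar)
  moreover have "expo a k = 0" if "Suc n \<le> k" for k
  proof -
    have "expo ?b k = 0" using b that by (simp add: hmons_def monomials_iff)
    then show ?thesis using that l by (simp add: lookup_minus lookup_add)
  qed
  ultimately have "a \<in> hmons (Suc n) d" using b by (simp add: hmons_def monomials_iff)
  moreover have "?b < a" unfolding less_monomial_iff
    using l a(2) by (intro exI[of _ l]) (auto simp: lookup_minus lookup_add)
  ultimately show ?thesis using L a(1) by (auto simp: lex_closed_def)
qed

text \<open>A family \<open>w\<close> without the index \<open>n\<close> whose restriction is a
  cycle lifts to a cycle: its boundary is divisible by \<open>x_n\<close>, and a multiple of e_n
  with the quotient as coefficient corrects it. Strong stability keeps the quotient in the span of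
  \<open>L\<close>.\<close>

lemma restriction_le_dim_kcycles_mspan:
  assumes L: "lex_closed (Suc n) d L"
  shows "(n choose i) * (card L - card (L \<inter> hmons n d)) + fvec.dim (kcycles n i (mspan (L \<inter> hmons n d) :: 'k::field mpoly set))
    \<le> fvec.dim (kcycles (Suc n) i (mspan L :: 'k mpoly set))"
proof -
  let ?s = "subst_last n (\<lambda>_. 0 :: 'k)"
  let ?V = "mspan L :: 'k mpoly set"
  let ?Vr = "mspan (L \<inter> hmons n d) :: 'k mpoly set"
  have Lh: "L \<subseteq> hmons (Suc n) d" using L by (simp add: lex_closed_def)
  have Vh: "?V \<subseteq> hpolys (Suc n) d" by (rule mspan_hmons[OF Lh])
  have V: "pvec.subspace ?V" by (rule subspace_mspan)
  have Vfin: "fin_dim pscale ?V" by (rule pvec.fin_dim_subset[OF fin_dim_hpolys Vh])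
  have sV: "?s ` ?V = ?Vr" by (rule subst_last_zero_mspan[OF Lh])
  interpret s: Vector_Spaces.linear pscale pscale ?s by (rule linear_subst_last)
  let ?R = "\<lambda>z A. ?s (z A)"
  have lin: "Vector_Spaces.linear fscale fscale ?R"
    by (rule linear_ffI) (simp_all add: fun_eq_iff subst_last_add subst_last_scale)
  \<comment> \<open>The families that will be lifted. The image of \<open>?R\<close> on them
    contains the cycles over \<open>?Vr\<close>, and its kernel consists of all families over
    \<open>?W\<close>.\<close>
  define X where "X = {w \<in> funs (ksets n i) (\<lambda>_. ?V). kos n (?R w) = 0}"
  have Fsub: "fvec.subspace (funs (ksets n i) (\<lambda>_. ?V))" by (rule subspace_funs[OF V])
  have Ffin: "fin_dim fscale (funs (ksets n i) (\<lambda>_. ?V))" by (rule fin_dim_funs[OF finite_card_subsets Vfin])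
  have R_add: "?R (x + y) = ?R x + ?R y" for x y by (simp add: fun_eq_iff subst_last_add)
  have R_scale: "?R (\<lambda>A. cst a * x A) = (\<lambda>A. cst a * ?R x A)" for a x by (simp add: subst_last_scale)
  have R_zero: "?R 0 = 0" by (simp add: fun_eq_iff)
  have X: "fvec.subspace X"
    unfolding fvec.subspace_def
  proof (intro conjI ballI allI)
    show "0 \<in> X" using fvec.subspace_0[OF Fsub] R_zero by (simp add: X_def zero_fun_def[symmetric])
    show "x + y \<in> X" if "x \<in> X" "y \<in> X" for x y
    proof -
      have "kos n (?R (x + y)) = kos n (?R x) + kos n (?R y)" by (simp only: R_add kos_add)
      then show ?thesis using that fvec.subspace_add[OF Fsub, of x y] by (simp add: X_def)
    qed
    show "(\<lambda>A. cst a * x A) \<in> X" if "x \<in> X" for a x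
    proof -
      have "kos n (?R (\<lambda>A. cst a * x A)) = (\<lambda>A. cst a * kos n (?R x) A)" by (simp only: R_scale kos_scale)
      then show ?thesis using that fvec.subspace_scale[OF Fsub, of x a] by (simp add: X_def fun_eq_iff)
    qed
  qed
  have Xfin: "fin_dim fscale X" by (rule fvec.fin_dim_subset[OF Ffin]) (auto simp: X_def)
  let ?W = "{v \<in> ?V. ?s v = 0}"
  have W: "pvec.subspace ?W" using V by (simp add: pvec.subspace_def subst_last_add subst_last_scale)
  have Wfin: "fin_dim pscale ?W" by (rule pvec.fin_dim_subset[OF Vfin]) auto
  have Wdim: "pvec.dim ?W = card L - card (L \<inter> hmons n d)"
    using rank_nullity[OF linear_subst_last V Vfin, of n "\<lambda>_. 0"] sV dim_mspan[of L, where 'k = 'k]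
      dim_mspan[of "L \<inter> hmons n d", where 'k = 'k] by simp
  have "fvec.dim X = fvec.dim {w \<in> X. ?R w = 0} + fvec.dim (?R ` X)" by (rule rank_nullity[OF lin X Xfin])
  moreover have "{w \<in> X. ?R w = 0} = funs (ksets n i) (\<lambda>_. ?W)"
  proof (intro equalityI subsetI)
    fix w assume w: "w \<in> {w \<in> X. ?R w = 0}"
    then have wf: "w \<in> funs (ksets n i) (\<lambda>_. ?V)" by (simp add: X_def)
    have "?s (w A) = 0" for A using w by (auto dest: fun_cong)
    then show "w \<in> funs (ksets n i) (\<lambda>_. ?W)"
      using funs_in[OF wf] funs_out[OF wf] by (intro funsI) blast+
  next
    fix w assume w: "w \<in> funs (ksets n i) (\<lambda>_. ?W)"
    have s0: "?s (w A) = 0" for A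
      using funs_in[OF w, of A] funs_out[OF w, of A] by (cases "A \<in> ksets n i") simp_all
    then have "?R w = 0" by (simp add: fun_eq_iff)
    moreover have "w \<in> funs (ksets n i) (\<lambda>_. ?V)"
      using funs_in[OF w] funs_out[OF w] by (intro funsI) blast+
    ultimately show "w \<in> {w \<in> X. ?R w = 0}" unfolding X_def by simp
  qed
  moreover have "fvec.dim (funs (ksets n i) (\<lambda>_. ?W)) = (n choose i) * pvec.dim ?W" by (rule dim_funs_ksets[OF W Wfin])
  moreover have "kcycles n i ?Vr \<subseteq> ?R ` X"
  proof
    fix z assume z: "z \<in> kcycles n i ?Vr"
    note zf = kcycles_funs[OF z]
    have zV0: "z A \<in> ?Vr" for A
      using funs_in[OF zf(1), of A] funs_out[OF zf(1), of A] pvec.subspace_0[OF subspace_mspan, of "L \<inter> hmons n d"]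
      by (cases "A \<in> ksets n i") simp_all
    have zh: "z A \<in> hpolys n d" for A using zV0[of A] mspan_hmons[of "L \<inter> hmons n d" n d] by blast
    have Rz: "?R z = z" by (rule ext) (rule subst_last_polys[OF hpolys_subset_polys[OF zh]])
    have "?Vr \<subseteq> ?V" by (rule mspan_mono) simp
    then have "z \<in> funs (ksets n i) (\<lambda>_. ?V)"
      using zV0 funs_out[OF zf(1)] by (intro funsI) blast+
    then have "z \<in> X" unfolding X_def using Rz zf(2) by simp
    then show "z \<in> ?R ` X" using Rz by (metis imageI)
  qed
  then have "fvec.dim (kcycles n i ?Vr) \<le> fvec.dim (?R ` X)"
    by (rule fvec.dim_mono_fin_dim[OF fin_dim_linear_image[OF lin Xfin]])
  ultimately have low: "(n choose i) * (card L - card (L \<inter> hmons n d)) + fvec.dim (kcycles n i ?Vr) \<le> fvec.dim X"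
    using Wdim by simp
  \<comment> \<open>With this sign the boundary of \<open>wedge n (b w)\<close>, which is
    \<open>x_n\<close> times \<open>b w\<close>, cancels that of \<open>w\<close>.\<close>
  define b where "b w A = - div_var n (kos n w A)" for w :: "nat set \<Rightarrow> 'k mpoly" and A
  define E where "E w A = w A + wedge n (b w) A" for w :: "nat set \<Rightarrow> 'k mpoly" and A
  have div_add: "div_var n (x + y) = div_var n x + div_var n y" for x y :: "'k mpoly"
    by (rule poly_mapping_eqI) (simp add: coeff_div_var lookup_add)
  have div_scale: "div_var n (cst a * x) = cst a * div_var n x" for a and x :: "'k mpoly"
    by (rule poly_mapping_eqI) (simp add: coeff_div_var)
  have "E (x + y) A = E x A + E y A" for x y A
    by (simp add: E_def b_def wedge_def kos_add div_add algebra_simps)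
  moreover have "E (\<lambda>A. cst a * x A) A = cst a * E x A" for a x A
    by (simp add: E_def b_def wedge_def kos_scale div_scale distrib_left mult.left_commute)
  ultimately have linE: "Vector_Spaces.linear fscale fscale E" by (intro linear_ffI) (simp_all add: fun_eq_iff)
  have "fvec.dim X \<le> fvec.dim (kcycles (Suc n) i ?V)"
  proof (rule dim_le_of_inj[OF linE X Xfin])
    fix w assume w: "w \<in> X" "E w = 0"
    then have wf: "w \<in> funs (ksets n i) (\<lambda>_. ?V)" by (simp add: X_def)
    show "w = 0"
    proof
      fix A
      show "w A = 0 A"
      proof (cases "n \<in> A")
        case True
        then have "A \<notin> ksets n i" using ksets_D by blast
        then show ?thesis using funs_out[OF wf] by simp
      next
        case False
        then have "E w A = w A" by (simp add: E_def wedge_def)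
        then show ?thesis using w(2) by simp
      qed
    qed
  next
    show "E ` X \<subseteq> kcycles (Suc n) i ?V"
    proof (rule image_subsetI)
      fix w assume w: "w \<in> X"
      then have wf: "w \<in> funs (ksets n i) (\<lambda>_. ?V)" and Rw: "kos n (?R w) = 0" by (simp_all add: X_def)
      have out: "w B = 0" if "n \<in> B" for B using funs_out[OF wf, of B] ksets_D[of B n i] that by blast
      have wV: "w A \<in> ?V" for A
        using funs_in[OF wf, of A] funs_out[OF wf, of A] pvec.subspace_0[OF V] by (cases "A \<in> ksets n i") simp_all
      have kh: "kos n w A \<in> hpolys (Suc n) (Suc d)" for A
      proof -
        have "contract l w A \<in> hpolys (Suc n) d" for l
        proof -
          have "w (insert l A) \<in> hpolys (Suc n) d" using wV Vh by blast
          then show ?thesis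
            using ksign_mult_in_subspace[OF subspace_hpolys, of "w (insert l A)" "Suc n" d l A] by (simp add: contract_def)
        qed
        then have "var l * contract l w A \<in> hpolys (Suc n) (1 + d)" if "l < n" for l
          using that by (intro mult_in_hpolys var_in_hpolys) auto
        then show ?thesis unfolding kos_def by (intro sum_in_hpolys) auto
      qed
      have vb: "var n * b w A = - kos n w A" for A
      proof -
        have "mcoeff (kos n w A) a = 0" if "expo a n = 0" for a
        proof -
          have "?s (kos n w A) = 0" unfolding subst_last_kos using fun_cong[OF Rw, of A] by simp
          then show ?thesis using coeff_subst_last_zero[OF kh, of A a] that by simp
        qed
        then show ?thesis by (simp add: b_def var_mult_div_var)
      qed
      \<comment> \<open>A monomial of \<open>b w A\<close> comes from a monomial of a coefficient of
        \<open>w\<close>, which lies in \<open>L\<close>, by multiplication with some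
        \<open>x_l\<close>, where \<open>l < n\<close>, and division by \<open>x_n\<close>.\<close>
      have bV: "b w A \<in> ?V" for A
        unfolding mspan_def
      proof (intro CollectI subsetI)
        fix a assume "a \<in> Poly_Mapping.keys (b w A)"
        then have "mcoeff (kos n w A) (a + mvar n) \<noteq> 0" by (simp add: in_keys_iff b_def coeff_div_var)
        then have "(\<Sum>l<n. mcoeff (var l * contract l w A) (a + mvar n)) \<noteq> 0" by (simp add: kos_def lookup_sum)
        then obtain l where l: "l < n" "mcoeff (var l * contract l w A) (a + mvar n) \<noteq> 0"
          by (metis (no_types, lifting) lessThan_iff sum.neutral)
        then have al: "expo (a + mvar n) l \<noteq> 0" "mcoeff (contract l w A) (a + mvar n - mvar l) \<noteq> 0"
          by (auto simp: coeff_var_mult split: if_splits)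
        have "contract l w A \<in> ?V" using wV ksign_mult_in_subspace[OF V] pvec.subspace_0[OF V] by (simp add: contract_def)
        then have "a + mvar n - mvar l \<in> L" using al(2) by (auto simp: mspan_def in_keys_iff)
        moreover have "expo a l > 0" using al(1) l(1) by (simp add: lookup_add)
        ultimately show "a \<in> L" using lex_closed_exchange[OF L l(1)] by blast
      qed
      have "contract l w A = 0" if "n \<in> A" for l A using out[of "insert l A"] that by (simp add: contract_def)
      then have kn: "kos n w A = 0" if "n \<in> A" for A using that by (simp add: kos_def)
      have bn: "b w A = 0" if "n \<in> A" for A
        unfolding b_def kn[OF that] by (simp add: poly_mapping_eq_iff fun_eq_iff coeff_div_var)
      have kb: "kos (Suc n) (b w) = 0"
      proof
        fix A
        have "var n * kos n (b w) A = kos n (\<lambda>A. var n * b w A) A" by (simp add: kos_scale)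
        also have "(\<lambda>A. var n * b w A) = (\<lambda>A. - 1 * kos n w A)" by (simp add: vb)
        also have "kos n (\<lambda>A. - 1 * kos n w A) A = - 1 * kos n (kos n w) A" by (simp only: kos_scale)
        also have "\<dots> = 0" by (simp add: kos_kos)
        finally have "var n * kos n (b w) A = 0" .
        moreover have "var n \<noteq> (0 :: 'k mpoly)"
        proof
          assume "var n = (0 :: 'k mpoly)"
          then have "mcoeff (var n :: 'k mpoly) (mvar n) = 0" by (simp only: lookup_zero)
          then show False by simp
        qed
        ultimately have "kos n (b w) A = 0" by simp
        moreover have "contract n (b w) A = 0" using bn by (simp add: contract_def)
        ultimately show "kos (Suc n) (b w) A = 0 A" by (simp add: kos_Suc)
      qed
      have "kos (Suc n) (E w) A = 0" for A
      proof -
        have "E w = w + wedge n (b w)" by (simp add: E_def fun_eq_iff)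
        then have "kos (Suc n) (E w) A = kos (Suc n) w A + kos (Suc n) (wedge n (b w)) A" by (simp add: kos_add)
        moreover have "kos (Suc n) (wedge n (b w)) A = var n * b w A"
        proof -
          have "wedge n (kos (Suc n) (b w)) A = 0" unfolding kb by (simp add: wedge_def)
          then show ?thesis using kos_wedge[of "Suc n" n "b w" A] by simp
        qed
        moreover have "kos (Suc n) w A = kos n w A" using out by (simp add: kos_Suc contract_def)
        ultimately show ?thesis using vb by simp
      qed
      moreover have "E w \<in> funs (ksets (Suc n) i) (\<lambda>_. ?V)"
      proof (rule funsI)
        fix A
        have "wedge n (b w) A \<in> ?V" using bV ksign_mult_in_subspace[OF V] pvec.subspace_0[OF V] by (simp add: wedge_def)
        then show "E w A \<in> ?V" unfolding E_def by (rule pvec.subspace_add[OF V wV])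
      next
        fix A assume A: "A \<notin> ksets (Suc n) i"
        then have "A \<notin> ksets n i" by auto
        then have "w A = 0" by (rule funs_out[OF wf])
        moreover have "wedge n (b w) A = 0"
        proof (cases "n \<in> A")
          case True
          have "contract l w (A - {n}) = 0" if l: "l < n" for l
          proof (cases "l \<in> A")
            case False
            have "insert l (A - {n}) \<notin> ksets n i"
            proof
              assume *: "insert l (A - {n}) \<in> ksets n i"
              then have "finite (insert l (A - {n}))" by (rule conjunct1[OF ksets_D])
              then have fin: "finite A" by simp
              have "card (insert l (A - {n})) = Suc (card (A - {n}))" using False fin by simp
              also have "\<dots> = card A" using True fin by (simp only: card_Suc_Diff1)
              finally have "card A = i" using * by simp
              moreover have "A \<subseteq> {..<Suc n}" using * by auto
              ultimately show False using A by simp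
            qed
            then show ?thesis using funs_out[OF wf] by (simp add: contract_def)
          qed (use l in \<open>simp add: contract_def\<close>)
          then have "kos n w (A - {n}) = 0" by (simp add: kos_def)
          then have "b w (A - {n}) = 0" by (simp add: b_def poly_mapping_eq_iff fun_eq_iff coeff_div_var)
          then show ?thesis by (simp add: wedge_def)
        qed (simp add: wedge_def)
        ultimately show "E w A = 0" by (simp add: E_def)
      qed
      ultimately show "E w \<in> kcycles (Suc n) i ?V" by (simp add: kcycles_def fun_eq_iff)
    qed
    show "fin_dim fscale (kcycles (Suc n) i ?V)" by (rule fin_dim_kcycles[OF Vfin])
  qed
  then show ?thesis using low by simp
qed

section \<open>Comparison with lex-segments\<close>

lemma exists_lex_closed:
  assumes "a \<le> card (hmons n d)"
  shows "\<exists>L. lex_closed n d L \<and> card L = a"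
proof (cases "a = card (hmons n d)")
  case True
  then show ?thesis by (intro exI[of _ "hmons n d"]) (simp add: lex_closed_def)
next
  case False
  then have "a < card (hmons n d)" using assms by simp
  from exists_elem_with_card_greater[OF finite_hmons this] obtain m where "card {x \<in> hmons n d. m < x} = a" by blast
  then show ?thesis by (intro exI[of _ "{x \<in> hmons n d. m < x}"]) (auto simp: lex_closed_def)
qed

text \<open>Upward closed subsets of a linear order are nested, so cardinality decides.\<close>

lemma lex_closed_subset:
  assumes L: "lex_closed n d L" and L': "lex_closed n d L'" and card: "card L \<le> card L'"
  shows "L \<subseteq> L'"
proof (rule ccontr)
  assume "\<not> L \<subseteq> L'"
  then obtain a where a: "a \<in> L" "a \<notin> L'" by blast
  have fin: "finite L" using L finite_subset[OF _ finite_hmons] by (auto simp: lex_closed_def)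
  have "b \<in> L" if b: "b \<in> L'" for b
  proof -
    have h: "a \<in> hmons n d" "b \<in> hmons n d" using L L' a b by (auto simp: lex_closed_def)
    have "\<not> b < a" using L' b a(2) h by (auto simp: lex_closed_def)
    then have "a < b" using a(2) b by (metis neqE)
    then show ?thesis using L a(1) h by (auto simp: lex_closed_def)
  qed
  then have "L' \<subset> L" using a by blast
  then show False using psubset_card_mono[OF fin] card by (metis leD)
qed

text \<open>The induction hypothesis compares the restriction \<open>?W\<close> with the lex-segment
  \<open>L1\<close> of the same size. Passing from \<open>?L0\<close> to \<open>L1\<close> costs
  \<open>n choose i\<close> cycles per monomial, and together with the term for the kernel of the
  restriction this amounts to \<open>?k - ?m\<close>, as in the bound for \<open>L\<close>.\<close>

theorem dim_kcycles_le_lex: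
  fixes V :: "'k::field mpoly set"
  assumes inf: "infinite (UNIV :: 'k set)"
  shows "pvec.subspace V \<Longrightarrow> V \<subseteq> hpolys n d \<Longrightarrow> lex_closed n d L \<Longrightarrow> card L = pvec.dim V
    \<Longrightarrow> fvec.dim (kcycles n i V) \<le> fvec.dim (kcycles n i (mspan L :: 'k mpoly set))"
proof (induction n arbitrary: V L)
  case 0
  have kc: "kcycles 0 i W = funs (ksets 0 i) (\<lambda>_. W)" for W :: "'k mpoly set"
    by (simp add: kcycles_def kos_def fun_eq_iff)
  have "fin_dim pscale V" by (rule pvec.fin_dim_subset[OF fin_dim_hpolys "0.prems"(2)])
  then have "fvec.dim (kcycles 0 i V) = (0 choose i) * pvec.dim V"
    unfolding kc by (rule dim_funs_ksets[OF "0.prems"(1)])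
  moreover have "fin_dim pscale (mspan L :: 'k mpoly set)"
    using "0.prems"(3) by (intro pvec.fin_dim_subset[OF fin_dim_hpolys mspan_hmons]) (auto simp: lex_closed_def)
  then have "fvec.dim (kcycles 0 i (mspan L :: 'k mpoly set)) = (0 choose i) * pvec.dim (mspan L :: 'k mpoly set)"
    unfolding kc by (rule dim_funs_ksets[OF subspace_mspan])
  ultimately show ?case using "0.prems"(4) dim_mspan[of L, where 'k = 'k] by simp
next
  case (Suc n)
  let ?L0 = "L \<inter> hmons n d"
  have L: "L \<subseteq> hmons (Suc n) d" using Suc.prems(3) by (simp add: lex_closed_def)
  obtain c where c: "card ?L0 \<le> pvec.dim (subst_last n c ` V)"
    using restriction_theorem[OF inf Suc.prems(1-3)] Suc.prems(4) by auto
  let ?W = "subst_last n c ` V"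
  have Vfin: "fin_dim pscale V" by (rule pvec.fin_dim_subset[OF fin_dim_hpolys Suc.prems(2)])
  interpret s: Vector_Spaces.linear pscale pscale "subst_last n c" by (rule linear_subst_last)
  have W: "pvec.subspace ?W" "?W \<subseteq> hpolys n d"
    by (rule s.subspace_image[OF Suc.prems(1)], rule image_subsetI, rule subst_last_in_hpolys, rule subsetD[OF Suc.prems(2)])
  have "pvec.dim ?W \<le> pvec.dim (hpolys n d :: 'k mpoly set)" by (rule pvec.dim_mono_fin_dim[OF fin_dim_hpolys W(2)])
  also have "\<dots> = card (hmons n d)" unfolding hpolys_eq_span by (rule dim_span_monomials)
  finally obtain L1 where L1: "lex_closed n d L1" "card L1 = pvec.dim ?W" using exists_lex_closed by blast
  have L0: "lex_closed n d ?L0" using Suc.prems(3) hmons_mono by (auto simp: lex_closed_def)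
  have "?L0 \<subseteq> L1" using lex_closed_subset[OF L0 L1(1)] c L1(2) by simp
  then have sub: "mspan ?L0 \<subseteq> (mspan L1 :: 'k mpoly set)" by (rule mspan_mono)
  have fin1: "fin_dim pscale (mspan L1 :: 'k mpoly set)"
    using L1(1) by (intro pvec.fin_dim_subset[OF fin_dim_hpolys mspan_hmons]) (auto simp: lex_closed_def)
  let ?k = "card L" and ?a = "pvec.dim ?W" and ?m = "card ?L0"
  let ?z0 = "fvec.dim (kcycles n i (mspan ?L0 :: 'k mpoly set))"
  have "fvec.dim (kcycles (Suc n) i V) \<le> (n choose i) * (?k - ?a) + fvec.dim (kcycles n i ?W)"
    using dim_kcycles_le_restriction[OF Suc.prems(1,2), of i c] Suc.prems(4) by simp
  also have "fvec.dim (kcycles n i ?W) \<le> fvec.dim (kcycles n i (mspan L1 :: 'k mpoly set))"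
    by (rule Suc.IH[OF W L1])
  also have "\<dots> \<le> ?z0 + (n choose i) * (?a - ?m)"
    using dim_kcycles_mono[OF subspace_mspan fin1 subspace_mspan sub, of n i] L1(2)
      dim_mspan[of L1, where 'k = 'k] dim_mspan[of ?L0, where 'k = 'k] by simp
  finally have "fvec.dim (kcycles (Suc n) i V) \<le> (n choose i) * (?k - ?a) + (?z0 + (n choose i) * (?a - ?m))" by simp
  also have "\<dots> = (n choose i) * (?k - ?a + (?a - ?m)) + ?z0" by (simp add: distrib_left)
  also have "?k - ?a + (?a - ?m) = ?k - ?m"
  proof -
    have "?a \<le> ?k" using rank_nullity[OF linear_subst_last Suc.prems(1) Vfin, of n c] Suc.prems(4) by simp
    then show ?thesis using c by linarith
  qed
  also have "(n choose i) * (?k - ?m) + ?z0 \<le> fvec.dim (kcycles (Suc n) i (mspan L :: 'k mpoly set))"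
    by (rule restriction_le_dim_kcycles_mspan[OF Suc.prems(3)])
  finally show ?case .
qed

subsection \<open>The lex-segment ideal\<close>

lemma lex_segment_eq: "a \<in> hmons n d \<Longrightarrow> lex_segment n a = {b \<in> hmons n d. a \<le> b}"
  unfolding lex_segment_def lex_greater_def hmons_def less_monomial_iff order_le_less
  by (auto simp: eq_commute)

definition monomial_ideal :: "nat \<Rightarrow> monomial set \<Rightarrow> 'k::field mpoly set" where
  "monomial_ideal n L = mspan {b + m |b m. b \<in> L \<and> m \<in> monomials n}"

text \<open>Membership in \<open>monomial_ideal\<close> is decided term by term, so gradedness is
  immediate and products need to be checked on monomials only.\<close>

lemma ideal_of_monomials:
  assumes L: "L \<subseteq> monomials n"
  shows "ideal_of n ((\<lambda>b. Poly_Mapping.single b 1) ` L) = (monomial_ideal n L :: 'k::field mpoly set)"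
    and "graded_ideal n (monomial_ideal n L :: 'k mpoly set)"
proof -
  let ?G = "(\<lambda>b. Poly_Mapping.single b (1::'k)) ` L"
  let ?M = "{b + m |b m. b \<in> L \<and> m \<in> monomials n}"
  let ?T = "monomial_ideal n L :: 'k mpoly set"
  have mono_add: "m + m' \<in> monomials n" if "m \<in> monomials n" "m' \<in> monomials n" for m m'
    using that by (simp add: monomials_iff lookup_add)
  have ideal: "is_ideal n ?T"
    unfolding is_ideal_def
  proof (intro conjI ballI)
    have "?M \<subseteq> monomials n"
    proof
      fix a assume "a \<in> ?M"
      then obtain b m where "a = b + m" "b \<in> L" "m \<in> monomials n" by (elim CollectE exE conjE)
      then show "a \<in> monomials n" using mono_add[of b m] subsetD[OF L] by simp
    qed
    then have "mspan ?M \<subseteq> (mspan (monomials n) :: 'k mpoly set)" by (rule mspan_mono)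
    then show "?T \<subseteq> polys n" by (simp add: monomial_ideal_def mspan_def polys_def)
    show "0 \<in> ?T" by (simp add: monomial_ideal_def mspan_def)
    show "p + q \<in> ?T" if "p \<in> ?T" "q \<in> ?T" for p q
      using that pvec.subspace_add[OF subspace_mspan] by (simp add: monomial_ideal_def)
    show "s * p \<in> ?T" if "s \<in> polys n" "p \<in> ?T" for s p
      unfolding monomial_ideal_def mspan_def
    proof (rule CollectI, rule keys_mult_subset)
      fix a b assume ab: "a \<in> Poly_Mapping.keys s" "b \<in> Poly_Mapping.keys p"
      have "b \<in> ?M" using that(2) ab(2) by (auto simp: monomial_ideal_def mspan_def)
      then obtain b' m where b: "b = b' + m" "b' \<in> L" "m \<in> monomials n" by blast
      have "a \<in> monomials n" using that(1) ab(1) by (auto simp: polys_def)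
      moreover have "a + b = b' + (a + m)" by (simp add: b(1) add_ac)
      ultimately show "a + b \<in> ?M" using b(2,3) mono_add by blast
    qed
  qed
  show "graded_ideal n ?T"
    unfolding graded_ideal_def
  proof (intro conjI ballI allI ideal)
    fix p j assume "p \<in> ?T"
    then show "hom_component j p \<in> ?T"
      by (auto simp: monomial_ideal_def mspan_def in_keys_iff subset_iff split: if_splits)
  qed
  have GT: "?G \<subseteq> ?T"
  proof (rule image_subsetI)
    fix b assume "b \<in> L"
    then have "b + 0 \<in> ?M" by (intro CollectI exI conjI) (auto simp: monomials_iff)
    then show "Poly_Mapping.single b 1 \<in> ?T"
      using keys_single_subset[of b "1::'k"] by (auto simp: monomial_ideal_def mspan_def)
  qed
  have "?T \<subseteq> t" if t: "is_ideal n t" "?G \<subseteq> t" for t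
  proof
    fix p assume "p \<in> ?T"
    then have k: "Poly_Mapping.keys p \<subseteq> ?M" by (simp add: monomial_ideal_def mspan_def)
    have term0: "Poly_Mapping.single a (mcoeff p a) \<in> t" if a: "a \<in> Poly_Mapping.keys p" for a
    proof -
      obtain b m where bm: "a = b + m" "b \<in> L" "m \<in> monomials n" using k a by blast
      have "Poly_Mapping.single a (mcoeff p a) = Poly_Mapping.single m (mcoeff p a) * Poly_Mapping.single b 1"
        by (simp add: mult_single bm(1) add.commute)
      moreover have "Poly_Mapping.single m (mcoeff p a) \<in> polys n" by (rule single_in_polys[OF bm(3)])
      moreover have "Poly_Mapping.single b 1 \<in> t" using t(2) bm(2) by blast
      ultimately show ?thesis using t(1) by (auto simp: is_ideal_def)
    qed
    have "(\<Sum>a\<in>B. Poly_Mapping.single a (mcoeff p a)) \<in> t" if "finite B" "B \<subseteq> Poly_Mapping.keys p" for B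
      using that by (induction B) (use term0 t(1) in \<open>auto simp: is_ideal_def\<close>)
    from this[OF finite_keys order_refl] show "p \<in> t" using poly_eq_sum_single[of p] by simp
  qed
  then show "ideal_of n ?G = ?T"
    unfolding ideal_of_def by (intro equalityI hull_minimal[where S = "is_ideal n"] GT ideal) (auto simp: hull_def)
qed

text \<open>A proper multiple of a monomial in \<open>L\<close> has degree above \<open>d\<close>,
  so the lowest graded piece is spanned by \<open>L\<close>.\<close>

lemma monomial_ideal_hpolys:
  assumes L: "L \<subseteq> hmons n d"
  shows "monomial_ideal n L \<inter> hpolys n d = (mspan L :: 'k::field mpoly set)"
    and "j < d \<Longrightarrow> monomial_ideal n L \<inter> hpolys n j = {0 :: 'k mpoly}"
proof -
  have key: "d \<le> j \<and> (j = d \<longrightarrow> a \<in> L)"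
    if p: "p \<in> monomial_ideal n L" "p \<in> hpolys n j" "a \<in> Poly_Mapping.keys p" for p :: "'k mpoly" and a j
  proof -
    obtain b m where bm: "a = b + m" "b \<in> L" "m \<in> monomials n"
      using p(1,3) by (auto simp: monomial_ideal_def mspan_def)
    have "mdeg b = d" using L bm(2) by (auto simp: hmons_def)
    moreover have "mdeg a = j" using p(2,3) by (auto simp: hpolys_def hmons_def)
    ultimately have "d + mdeg m = j" using bm(1) by simp
    then show ?thesis using bm by auto
  qed
  show "monomial_ideal n L \<inter> hpolys n d = (mspan L :: 'k mpoly set)"
  proof (intro equalityI subsetI)
    fix p :: "'k mpoly" assume "p \<in> monomial_ideal n L \<inter> hpolys n d"
    then show "p \<in> mspan L" unfolding mspan_def using key[of p d] by blast
  next
    fix p :: "'k mpoly" assume p: "p \<in> mspan L"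
    have "b \<in> {b + m |b m. b \<in> L \<and> m \<in> monomials n}" if "b \<in> L" for b
      using that by (intro CollectI exI[of _ b] exI[of _ 0]) (simp add: monomials_iff)
    then have "p \<in> monomial_ideal n L" using p unfolding monomial_ideal_def mspan_def by blast
    then show "p \<in> monomial_ideal n L \<inter> hpolys n d" using mspan_hmons[OF L] p by blast
  qed
  show "monomial_ideal n L \<inter> hpolys n j = {0 :: 'k mpoly}" if j: "j < d"
  proof -
    have "p = 0" if "p \<in> monomial_ideal n L" "p \<in> hpolys n j" for p :: "'k mpoly"
    proof (rule ccontr)
      assume "p \<noteq> 0"
      then obtain a where "a \<in> Poly_Mapping.keys p" using nonzero_coeff[of p] by (auto simp: in_keys_iff)
      then show False using key[OF that] j by fastforce
    qed
    moreover have "0 \<in> (monomial_ideal n L :: 'k mpoly set)" by (simp add: monomial_ideal_def mspan_def)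
    ultimately show ?thesis by auto
  qed
qed

lemma lex_ideal_eq:
  assumes "0 < k" "k \<le> card (hmons n d)"
  shows "\<exists>L. lex_closed n d L \<and> card L = k \<and> (lex_ideal n d k :: 'k::field mpoly set) = monomial_ideal n L"
proof -
  have "k - 1 < card (hmons n d)" using assms by simp
  from exists_elem_with_card_greater[OF finite_hmons this]
  obtain m where m: "m \<in> hmons n d" "card {x \<in> hmons n d. m < x} = k - 1" by blast
  have seg: "card {x \<in> hmons n d. b \<le> x} = Suc (card {x \<in> hmons n d. b < x})" if "b \<in> hmons n d" for b
  proof -
    have "{x \<in> hmons n d. b \<le> x} = insert b {x \<in> hmons n d. b < x}" using that by auto
    then show ?thesis by simp
  qed
  have m': "card (lex_segment n m) = k" using lex_segment_eq[OF m(1)] seg[OF m(1)] m(2) assms(1) by simp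
  \<comment> \<open>Smaller monomials have strictly larger segments, so the monomial in the
    definition of \<open>lex_ideal\<close> is unique.\<close>
  have less: "card (lex_segment n b) < card (lex_segment n a)" if "a \<in> hmons n d" "b \<in> hmons n d" "a < b" for a b
    unfolding lex_segment_eq[OF that(1)] lex_segment_eq[OF that(2)]
  proof (rule psubset_card_mono)
    have "a \<in> {x \<in> hmons n d. a \<le> x}" "a \<notin> {x \<in> hmons n d. b \<le> x}" using that by auto
    moreover have "{x \<in> hmons n d. b \<le> x} \<subseteq> {x \<in> hmons n d. a \<le> x}" using that by auto
    ultimately show "{x \<in> hmons n d. b \<le> x} \<subset> {x \<in> hmons n d. a \<le> x}" by (metis psubsetI)
  qed simp
  have "(THE a. a \<in> monomials n \<and> mdeg a = d \<and> card (lex_segment n a) = k) = m"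
  proof (rule the_equality)
    show "m \<in> monomials n \<and> mdeg m = d \<and> card (lex_segment n m) = k" using m(1) m' by (simp add: hmons_def)
    fix a assume "a \<in> monomials n \<and> mdeg a = d \<and> card (lex_segment n a) = k"
    then have a: "a \<in> hmons n d" "card (lex_segment n a) = k" by (simp_all add: hmons_def)
    show "a = m"
    proof (rule ccontr)
      assume "a \<noteq> m"
      then have "a < m \<or> m < a" by auto
      then show False using less[OF a(1) m(1)] less[OF m(1) a(1)] a(2) m' by auto
    qed
  qed
  then have "(lex_ideal n d k :: 'k mpoly set) = ideal_of n ((\<lambda>b. Poly_Mapping.single b 1) ` lex_segment n m)"
    using assms(1) by (simp add: lex_ideal_def)
  moreover have "lex_closed n d (lex_segment n m)" unfolding lex_segment_eq[OF m(1)] by (auto simp: lex_closed_def)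
  moreover from this have "lex_segment n m \<subseteq> monomials n" by (auto simp: lex_closed_def hmons_def)
  ultimately show ?thesis using ideal_of_monomials(1)[of "lex_segment n m" n, where 'k = 'k] m' by blast
qed

section \<open>Ideals with linear resolution\<close>

lemma betti_eq_tor_dim:
  assumes "graded_ideal n I"
  shows "\<exists>F. graded_free_resolution n I F \<and> (\<forall>i q. betti n I i q = tor_dim F i q)"
  using someI_ex[OF graded_free_resolution_exists[OF assms]] unfolding betti_def by blast

text \<open>The formula for the lowest strand holds for every resolution, in particular for the one
  selected in \<open>betti\<close>.\<close>

lemma betti_lowest_strand:
  fixes I :: "'k::field mpoly set"
  assumes "graded_ideal n I" "\<And>j. j < d \<Longrightarrow> I \<inter> hpolys n j = {0}"
  shows "betti n I i (i + d) = fvec.dim (kcycles n i (I \<inter> hpolys n d))"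
  using betti_eq_tor_dim[OF assms(1)] tor_dim_lowest_strand[OF assms(1) _ assms(2)] by metis

lemma subspace_ideal_hpolys:
  assumes "graded_ideal n I"
  shows "pvec.subspace (I \<inter> hpolys n d)" "fin_dim pscale (I \<inter> hpolys n d)"
proof -
  show "pvec.subspace (I \<inter> hpolys n d)"
    using assms subspace_hpolys[of n d] cst_in_polys by (auto simp: pvec.subspace_def graded_ideal_def is_ideal_def)
  show "fin_dim pscale (I \<inter> hpolys n d)" by (rule pvec.fin_dim_subset[OF fin_dim_hpolys[of n d]]) auto
qed

lemma dim_kcycles_0:
  fixes V :: "'k::field mpoly set"
  assumes "pvec.subspace V" "fin_dim pscale V"
  shows "fvec.dim (kcycles n 0 V) = pvec.dim V"
proof -
  have "kos n z = 0" if z: "z \<in> funs (ksets n 0) (\<lambda>_. V)" for z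
  proof (rule kos_degree_0)
    fix A :: "nat set" assume "card A \<noteq> 0 \<or> infinite A"
    then have "A \<notin> ksets n 0" using finite_subset[of A "{..<n}"] by auto
    then show "z A = 0" by (rule funs_out[OF z])
  qed
  then have "kcycles n 0 V = funs (ksets n 0) (\<lambda>_. V)" by (auto simp: kcycles_def)
  then show ?thesis using dim_funs_ksets[OF assms, of n 0] by simp
qed

text \<open>If \<open>I\<close> vanishes below \<open>j\<close>, the Betti number in homological
  degree 0 and internal degree \<open>j\<close> is the dimension of I_j. Linearity makes it 0 for
  \<open>j < d\<close>, and the induction climbs up to \<open>d\<close>.\<close>

lemma linear_resolution_low_degrees:
  fixes I :: "'k::field mpoly set"
  assumes I: "graded_ideal n I" and lin: "linear_resolution n d I"
  shows "j < d \<Longrightarrow> I \<inter> hpolys n j = {0}"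
proof (induction j rule: less_induct)
  case (less j)
  let ?V = "I \<inter> hpolys n j"
  note V = subspace_ideal_hpolys[OF I, of j]
  have "betti n I 0 (0 + j) = fvec.dim (kcycles n 0 ?V)"
    by (rule betti_lowest_strand[OF I]) (use less in auto)
  moreover have "j \<noteq> d" using less.prems by simp
  then have "betti n I 0 (0 + j) = 0" using lin unfolding linear_resolution_def by blast
  ultimately have "pvec.dim ?V \<le> pvec.dim {0 :: 'k mpoly}" using dim_kcycles_0[OF V] by simp
  then show ?case using pvec.dim_eq_subspace_eq[OF V(2) pvec.subspace_single_0] pvec.subspace_0[OF V(1)] by simp
qed

theorem proposition4p4:
  fixes I :: "'k::field mpoly set" and n d k :: nat
  assumes "infinite (UNIV :: 'k set)"
    and "k \<le> (n + d - 1) choose d"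
    and "graded_ideal n I"
    and "linear_resolution n d I"
    and "betti n I 0 d = k"
  shows "\<forall>i j. betti n I i (i + j) \<le> betti n (lex_ideal n d k :: 'k mpoly set) i (i + j)"
proof (intro allI)
  fix i j
  note I = assms(3)
  let ?V = "I \<inter> hpolys n d"
  note V = subspace_ideal_hpolys[OF I, of d]
  have low: "I \<inter> hpolys n j = {0}" if "j < d" for j
    by (rule linear_resolution_low_degrees[OF I assms(4) that])
  have strand: "betti n I i (i + d) = fvec.dim (kcycles n i ?V)" for i
    by (rule betti_lowest_strand[OF I low])
  \<comment> \<open>In exterior degree 0 every family is a cycle, so the number of generators is the
    dimension of I_d, and the lex-segment has the size required for the comparison.\<close>
  have k: "pvec.dim ?V = k" using strand[of 0] dim_kcycles_0[OF V] assms(5) by simp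
  show "betti n I i (i + j) \<le> betti n (lex_ideal n d k :: 'k mpoly set) i (i + j)"
  proof (cases "j = d")
    case False
    then have "betti n I i (i + j) = 0" using assms(4) by (simp add: linear_resolution_def)
    then show ?thesis by simp
  next
    case j: True
    show ?thesis
    proof (cases "k = 0")
      case True
      have "fvec.dim (kcycles n i ?V) \<le> fvec.dim (funs (ksets n i) (\<lambda>_. ?V))"
        by (rule fvec.dim_mono_fin_dim[OF fin_dim_funs[OF finite_card_subsets V(2)]]) (auto simp: kcycles_def)
      also have "\<dots> = 0" using dim_funs_ksets[OF V, of n i] k True by simp
      finally show ?thesis using strand j by simp
    next
      case False
      have "k \<le> pvec.dim (hpolys n d :: 'k mpoly set)"
        unfolding k[symmetric] by (rule pvec.dim_mono_fin_dim[OF fin_dim_hpolys]) simp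
      also have "\<dots> = card (hmons n d)" unfolding hpolys_eq_span by (rule dim_span_monomials)
      finally obtain L where L: "lex_closed n d L" "card L = k"
        "(lex_ideal n d k :: 'k mpoly set) = monomial_ideal n L"
        using lex_ideal_eq[of k n d, where 'k = 'k] False by auto
      have Lh: "L \<subseteq> hmons n d" using L(1) by (simp add: lex_closed_def)
      then have Lm: "L \<subseteq> monomials n" by (auto simp: hmons_def)
      have "betti n (monomial_ideal n L :: 'k mpoly set) i (i + d)
        = fvec.dim (kcycles n i (monomial_ideal n L \<inter> hpolys n d :: 'k mpoly set))"
        by (rule betti_lowest_strand[OF ideal_of_monomials(2)[OF Lm]]) (rule monomial_ideal_hpolys(2)[OF Lh])
      then have "betti n (lex_ideal n d k :: 'k mpoly set) i (i + d) = fvec.dim (kcycles n i (mspan L :: 'k mpoly set))"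
        by (simp only: L(3) monomial_ideal_hpolys(1)[OF Lh])
      moreover have "fvec.dim (kcycles n i ?V) \<le> fvec.dim (kcycles n i (mspan L :: 'k mpoly set))"
        by (rule dim_kcycles_le_lex[OF assms(1) V(1) _ L(1)]) (simp_all add: L(2) k)
      ultimately show ?thesis using strand j by simp
    qed
  qed
qed

end
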